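(* Let $\Gamma$ be a tropical curve and $D$ a divisor on $\Gamma$ with $r(D)\ge 1$. Let $a\ge 1$ be an integer such that for every $P\in\Gamma$ the coefficient $D_P(P)$ of $P$ in $D_P$ is at least $a$. Then there exists a point $P\in\Gamma$ with $D_P(P)\ge a+1$.
   Context: A tropical curve $\Gamma$ is a compact connected metric graph (finite connected graph, loops and multiple edges allowed, with edges identified with closed intervals of positive lengths). A divisor is a finite formal integer combination $D=\sum_v D(v)(v)$ of points. A rational function is a continuous piecewise linear $f:\Gamma\to\mathbb R$ with integer slopes and finitely many pieces on each edge; $\mathrm{div}(f)=\sum_v\mathrm{ord}_v(f)(v)$ with $\mathrm{ord}_v(f)$ the sum of outgoing slopes at $v$; $D\sim D'$ if $D-D'=\mathrm{div}(f)$; $|D|=\{E\ge0:E\sim D\}$; $r(D)=\min\{\deg(E):E\ge0,\ |D-E|=\emptyset\}-1$. For a closed connected $X\subseteq\Gamma$ and $v\in\partial X$, $\deg^{\mathrm{out}}_X(v)$ is the maximum number of internally disjoint segments in $\Gamma\setminus(X\setminus\{v\})$ with an endpoint at $v$. A divisor $D'$ is $P$-reduced if $D'(v)\ge0$ for $v\ne P$ and every closed connected $X$ with $P\notin X$ has a boundary point $v$ with $D'(v)<\deg^{\mathrm{out}}_X(v)$; $D_P$ denotes the unique $P$-reduced divisor linearly equivalent to $D$.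
   Formalization: The tropical curve is additionally assumed to have genus (first Betti number) at least 1; on a tree the claim fails, e.g. for Γ = [0,1], D = (0), a = 1, where D_P = (P) for every P. *)

theory Defs
  imports "HOL-Analysis.Analysis" "Graph_Theory.Digraph_Component"
begin

section \<open>Tropical curves\<close>

text \<open>
  A metric graph is presented by a finite multigraph (loops and multiple edges allowed) with a
  length for every edge. The orientation of an arc \<open>e\<close> only serves to identify the edge with the
  interval \<open>{0..len \<Gamma> e}\<close>, the tail being at \<open>0\<close> and the head at \<open>len \<Gamma> e\<close>.
\<close>

record ('v, 'e) metric_graph =
  model :: "('v, 'e) pre_digraph"
  len :: "'e \<Rightarrow> real"

abbreviation edges :: "('v, 'e) metric_graph \<Rightarrow> 'e set" where
  "edges \<Gamma> \<equiv> arcs (model \<Gamma>)"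

definition tropical_curve :: "('v, 'e) metric_graph \<Rightarrow> bool" where
  "tropical_curve \<Gamma> \<longleftrightarrow>
     fin_digraph (model \<Gamma>) \<and> Digraph_Component.connected (model \<Gamma>) \<and> (\<forall>e\<in>edges \<Gamma>. 0 < len \<Gamma> e)"

text \<open>The first Betti number of a connected graph.\<close>

definition genus :: "('v, 'e) metric_graph \<Rightarrow> int" where
  "genus \<Gamma> = int (card (edges \<Gamma>)) - int (card (verts (model \<Gamma>))) + 1"

datatype ('v, 'e) point = Vertex 'v | Inner 'e real

definition points :: "('v, 'e) metric_graph \<Rightarrow> ('v, 'e) point set" where
  "points \<Gamma> = Vertex ` verts (model \<Gamma>) \<union> {Inner e t | e t. e \<in> edges \<Gamma> \<and> 0 < t \<and> t < len \<Gamma> e}"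

text \<open>The point at distance \<open>t\<close> from the tail on the edge \<open>e\<close>; meaningful for \<open>t \<in> {0..len \<Gamma> e}\<close>.\<close>

definition edge_point :: "('v, 'e) metric_graph \<Rightarrow> 'e \<Rightarrow> real \<Rightarrow> ('v, 'e) point" where
  "edge_point \<Gamma> e t =
     (if t \<le> 0 then Vertex (tail (model \<Gamma>) e)
      else if t \<ge> len \<Gamma> e then Vertex (head (model \<Gamma>) e)
      else Inner e t)"

text \<open>
  The quotient topology of the disjoint union of the closed edges and the vertices. As the graph
  is finite, it is the topology of the path metric.
\<close>

definition curve_topology :: "('v, 'e) metric_graph \<Rightarrow> ('v, 'e) point topology" where
  "curve_topology \<Gamma> = topology (\<lambda>U. U \<subseteq> points \<Gamma> \<and>
     (\<forall>e\<in>edges \<Gamma>. openin (top_of_set {0..len \<Gamma> e}) {t \<in> {0..len \<Gamma> e}. edge_point \<Gamma> e t \<in> U}))"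

lemma openin_curve_topology:
  "openin (curve_topology \<Gamma>) U \<longleftrightarrow> U \<subseteq> points \<Gamma> \<and>
     (\<forall>e\<in>edges \<Gamma>. openin (top_of_set {0..len \<Gamma> e}) {t \<in> {0..len \<Gamma> e}. edge_point \<Gamma> e t \<in> U})"
proof -
  let ?pre = "\<lambda>e U. {t \<in> {0..len \<Gamma> e}. edge_point \<Gamma> e t \<in> U}"
  have "?pre e (S \<inter> T) = ?pre e S \<inter> ?pre e T" for e S T
    by auto
  moreover have "?pre e (\<Union>K) = (\<Union>S\<in>K. ?pre e S)" for e K
    by auto
  ultimately have "istopology (\<lambda>U. U \<subseteq> points \<Gamma> \<and>
      (\<forall>e\<in>edges \<Gamma>. openin (top_of_set {0..len \<Gamma> e}) (?pre e U)))"
    unfolding istopology_def by (force intro!: openin_Int openin_Union)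
  then show ?thesis
    unfolding curve_topology_def by (simp add: topology_inverse')
qed

lemma edge_point_in_points:
  assumes "tropical_curve \<Gamma>" "e \<in> edges \<Gamma>"
  shows "edge_point \<Gamma> e t \<in> points \<Gamma>"
proof -
  interpret fin_digraph "model \<Gamma>"
    using assms(1) by (simp add: tropical_curve_def)
  show ?thesis
    using assms(2) by (auto simp: edge_point_def points_def)
qed

lemma topspace_curve_topology:
  assumes "tropical_curve \<Gamma>"
  shows "topspace (curve_topology \<Gamma>) = points \<Gamma>"
proof -
  have "{t \<in> {0..len \<Gamma> e}. edge_point \<Gamma> e t \<in> points \<Gamma>} = {0..len \<Gamma> e}" if "e \<in> edges \<Gamma>" for e
    using edge_point_in_points[OF assms that] by auto
  then have "openin (curve_topology \<Gamma>) (points \<Gamma>)"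
    by (auto simp: openin_curve_topology)
  then show ?thesis
    by (metis openin_curve_topology openin_subset openin_topspace subset_antisym)
qed


section \<open>Rational functions\<close>

text \<open>The finite set \<open>B\<close> contains the breakpoints in \<open>{0..l}\<close>.\<close>

definition piecewise_linear_int :: "real \<Rightarrow> (real \<Rightarrow> real) \<Rightarrow> bool" where
  "piecewise_linear_int l g \<longleftrightarrow> (\<exists>B. finite B \<and>
     (\<forall>a b. 0 \<le> a \<and> a < b \<and> b \<le> l \<and> {a<..<b} \<inter> B = {} \<longrightarrow>
        (\<exists>(m::int) c. \<forall>t\<in>{a..b}. g t = of_int m * t + c)))"

definition rational_function :: "('v, 'e) metric_graph \<Rightarrow> (('v, 'e) point \<Rightarrow> real) \<Rightarrow> bool" where
  "rational_function \<Gamma> f \<longleftrightarrow> continuous_map (curve_topology \<Gamma>) euclideanreal f \<and>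
     (\<forall>e\<in>edges \<Gamma>. piecewise_linear_int (len \<Gamma> e) (\<lambda>t. f (edge_point \<Gamma> e t)))"

text \<open>
  A tangent direction \<open>(e, t, \<sigma>)\<close> at \<open>x\<close> leaves \<open>x = edge_point \<Gamma> e t\<close> along the edge \<open>e\<close>, towards
  the head if \<open>\<sigma> = 1\<close> and towards the tail if \<open>\<sigma> = -1\<close>. A loop contributes two
  directions at its vertex.
\<close>

definition tangents :: "('v, 'e) metric_graph \<Rightarrow> ('v, 'e) point \<Rightarrow> ('e \<times> real \<times> real) set" where
  "tangents \<Gamma> x = {(e, t, \<sigma>). e \<in> edges \<Gamma> \<and> t \<in> {0..len \<Gamma> e} \<and> edge_point \<Gamma> e t = x \<and>
     (\<sigma> = 1 \<and> t < len \<Gamma> e \<or> \<sigma> = -1 \<and> 0 < t)}"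

definition outgoing_slope ::
  "('v, 'e) metric_graph \<Rightarrow> (('v, 'e) point \<Rightarrow> real) \<Rightarrow> 'e \<times> real \<times> real \<Rightarrow> int" where
  "outgoing_slope \<Gamma> f = (\<lambda>(e, t, \<sigma>). THE m::int.
     \<forall>\<^sub>F s in at_right 0. f (edge_point \<Gamma> e (t + \<sigma> * s)) = f (edge_point \<Gamma> e t) + of_int m * s)"

definition ord_at ::
  "('v, 'e) metric_graph \<Rightarrow> (('v, 'e) point \<Rightarrow> real) \<Rightarrow> ('v, 'e) point \<Rightarrow> int" where
  "ord_at \<Gamma> f x = (\<Sum>\<tau>\<in>tangents \<Gamma> x. outgoing_slope \<Gamma> f \<tau>)"


section \<open>Divisors\<close>

definition divisor :: "('v, 'e) metric_graph \<Rightarrow> (('v, 'e) point \<Rightarrow> int) \<Rightarrow> bool" where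
  "divisor \<Gamma> D \<longleftrightarrow> finite {x. D x \<noteq> 0} \<and> {x. D x \<noteq> 0} \<subseteq> points \<Gamma>"

definition effective :: "(('v, 'e) point \<Rightarrow> int) \<Rightarrow> bool" where
  "effective D \<longleftrightarrow> (\<forall>x. 0 \<le> D x)"

definition div_degree :: "(('v, 'e) point \<Rightarrow> int) \<Rightarrow> int" where
  "div_degree D = (\<Sum>x | D x \<noteq> 0. D x)"

definition div_of ::
  "('v, 'e) metric_graph \<Rightarrow> (('v, 'e) point \<Rightarrow> real) \<Rightarrow> ('v, 'e) point \<Rightarrow> int" where
  "div_of \<Gamma> f = (\<lambda>x. if x \<in> points \<Gamma> then ord_at \<Gamma> f x else 0)"

definition lin_equiv ::
  "('v, 'e) metric_graph \<Rightarrow> (('v, 'e) point \<Rightarrow> int) \<Rightarrow> (('v, 'e) point \<Rightarrow> int) \<Rightarrow> bool" where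
  "lin_equiv \<Gamma> D D' \<longleftrightarrow> (\<exists>f. rational_function \<Gamma> f \<and> D - D' = div_of \<Gamma> f)"

definition linear_system ::
  "('v, 'e) metric_graph \<Rightarrow> (('v, 'e) point \<Rightarrow> int) \<Rightarrow> (('v, 'e) point \<Rightarrow> int) set" where
  "linear_system \<Gamma> D = {E. divisor \<Gamma> E \<and> effective E \<and> lin_equiv \<Gamma> E D}"

definition div_rank :: "('v, 'e) metric_graph \<Rightarrow> (('v, 'e) point \<Rightarrow> int) \<Rightarrow> int" where
  "div_rank \<Gamma> D = (LEAST d. \<exists>E. divisor \<Gamma> E \<and> effective E \<and>
     linear_system \<Gamma> (D - E) = {} \<and> d = div_degree E) - 1"


section \<open>Reduced divisors\<close>

text \<open>
  A segment with an endpoint at \<open>v\<close> is given by an embedding \<open>\<gamma>\<close> of \<open>{0..1}\<close> with \<open>\<gamma> 0 = v\<close>.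
  Two distinct members of a family in \<open>out_degree\<close> have disjoint nonempty interiors, so they
  are distinct as segments as well.
\<close>

definition segment_from ::
  "('v, 'e) metric_graph \<Rightarrow> ('v, 'e) point \<Rightarrow> (real \<Rightarrow> ('v, 'e) point) \<Rightarrow> bool" where
  "segment_from \<Gamma> v \<gamma> \<longleftrightarrow>
     embedding_map (top_of_set {0..1}) (curve_topology \<Gamma>) \<gamma> \<and> \<gamma> 0 = v"

definition out_degree ::
  "('v, 'e) metric_graph \<Rightarrow> ('v, 'e) point set \<Rightarrow> ('v, 'e) point \<Rightarrow> nat" where
  "out_degree \<Gamma> X v = Max {card S | S. finite S \<and>
     (\<forall>\<gamma>\<in>S. segment_from \<Gamma> v \<gamma> \<and> \<gamma> ` {0..1} \<subseteq> points \<Gamma> - (X - {v})) \<and>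
     pairwise (\<lambda>\<gamma> \<delta>. disjnt (\<gamma> ` {0<..<1}) (\<delta> ` {0<..<1})) S}"

text \<open>The empty set has no boundary points and has to be excluded from the test sets \<open>X\<close>.\<close>

definition is_reduced ::
  "('v, 'e) metric_graph \<Rightarrow> ('v, 'e) point \<Rightarrow> (('v, 'e) point \<Rightarrow> int) \<Rightarrow> bool" where
  "is_reduced \<Gamma> P D \<longleftrightarrow> divisor \<Gamma> D \<and> (\<forall>v\<in>points \<Gamma>. v \<noteq> P \<longrightarrow> 0 \<le> D v) \<and>
     (\<forall>X. X \<noteq> {} \<and> closedin (curve_topology \<Gamma>) X \<and> connectedin (curve_topology \<Gamma>) X \<and> P \<notin> X \<longrightarrow>
        (\<exists>v \<in> curve_topology \<Gamma> frontier_of X. D v < int (out_degree \<Gamma> X v)))"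

definition reduced_divisor ::
  "('v, 'e) metric_graph \<Rightarrow> (('v, 'e) point \<Rightarrow> int) \<Rightarrow> ('v, 'e) point \<Rightarrow> ('v, 'e) point \<Rightarrow> int" where
  "reduced_divisor \<Gamma> D P = (THE D'. is_reduced \<Gamma> P D' \<and> lin_equiv \<Gamma> D' D)"

end

theory Submission
  imports Defs
begin

text \<open>
  The coefficient of \<open>P\<close> in the reduced divisor \<open>D\<^sub>P\<close> is the largest \<open>k\<close> for which
  \<open>D - k P\<close> is equivalent to an effective divisor. Suppose that it equals \<open>a\<close> for every \<open>P\<close>, and
  write \<open>D\<^sub>P = a P + E\<^sub>P\<close>. If \<open>Q\<close> is close to \<open>P\<close>, a function \<open>g\<close> with
  \<open>D\<^sub>Q = D\<^sub>P + div g\<close> has its maximum at \<open>P\<close> and its minimum at \<open>Q\<close>; convexity along the rays at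
  \<open>P\<close> leaves no other possibility than that all \<open>a\<close> chips move from \<open>P\<close> to \<open>Q\<close> and \<open>g\<close> is
  constant near \<open>P\<close> and near \<open>Q\<close> outside the segment \<open>PQ\<close>. By the maximum principle, if \<open>K\<close> is
  connected, does not meet the open segment, contains \<open>P\<close> and carries no chip of \<open>E\<^sub>P\<close>, then
  \<open>g\<close> is constant on \<open>K\<close>, so that \<open>Q\<close> is not in \<open>K\<close> and \<open>E\<^sub>Q\<close> has no chip on \<open>K\<close>;
  the same holds with \<open>P\<close> and \<open>Q\<close> exchanged. Moving the base point along a trail from
  its end back to its start, one finds that \<open>E\<^sub>x\<close> has no chip on any trail that starts at the vertex
  \<open>x\<close>. A graph of positive genus contains a cycle, and for \<open>K\<close> a cycle through \<open>x\<close>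
  without a small open segment at \<open>x\<close> the set \<open>K\<close> contains both \<open>P = x\<close> and \<open>Q\<close>, a contradiction.

  Reduced divisors exist because the pointwise supremum of all functions \<open>f\<close> with
  \<open>f P = 0\<close> and \<open>D + div f \<ge> 0\<close> is again such a function.
\<close>

section \<open>Tangent directions and germs\<close>

text \<open>On a tree every \<open>D_P\<close> is \<open>deg D\<close> times \<open>P\<close>, so a
  strict increase somewhere can only come from a cycle. Two obstacles shape the argument. The radius
  within which a base point can be moved depends on the point, with no evident uniform lower bound.
  An edge is therefore traversed by an infimum: a move from the infimum up to a base point already
  treated shows that the infimum is treated too, and a move in the other direction passes it. This
  is why the maximum principle occurs twice, as \<open>sweep_from\<close> for the start of a move
  and as \<open>sweep_to\<close> for its end. Moreover the swept set must avoid the open segment of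
  the move; hence trails, which repeat no edge but may repeat vertices. In the existence proof
  integrality does the work. Bounded slopes leave finitely many integers, so the supremum is locally
  a maximum of finitely many affine functions, and a function close enough to the supremum at a
  point has no larger slopes there.\<close>

lemma eventually_at_right_0:
  "(\<forall>\<^sub>F s in at_right (0::real). P s) \<longleftrightarrow> (\<exists>d>0. \<forall>s. 0 < s \<and> s < d \<longrightarrow> P s)"
  unfolding eventually_at_right_field by auto

definition along :: "('v, 'e) metric_graph \<Rightarrow> 'e \<times> real \<times> real \<Rightarrow> real \<Rightarrow> ('v, 'e) point" where
  "along \<Gamma> = (\<lambda>(e, t, \<sigma>) s. edge_point \<Gamma> e (t + \<sigma> * s))"

definition directions :: "('v, 'e) metric_graph \<Rightarrow> ('e \<times> real \<times> real) set" where
  "directions \<Gamma> = {(e, t, \<sigma>). e \<in> edges \<Gamma> \<and> t \<in> {0..len \<Gamma> e} \<and>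
     (\<sigma> = 1 \<and> t < len \<Gamma> e \<or> \<sigma> = -1 \<and> 0 < t)}"

definition has_slope ::
  "('v, 'e) metric_graph \<Rightarrow> (('v, 'e) point \<Rightarrow> real) \<Rightarrow> 'e \<times> real \<times> real \<Rightarrow> int \<Rightarrow> bool" where
  "has_slope \<Gamma> f \<tau> m \<longleftrightarrow>
     (\<forall>\<^sub>F s in at_right 0. f (along \<Gamma> \<tau> s) = f (along \<Gamma> \<tau> 0) + of_int m * s)"

text \<open>A local substitute for \<open>rational_function\<close>, without continuity and without
  finiteness of the breakpoints; both follow by compactness of the edges, see
  \<open>rational_iff\<close>. Sums, negatives and suprema are checked one direction at a
  time.\<close>

definition integral_germs :: "('v, 'e) metric_graph \<Rightarrow> (('v, 'e) point \<Rightarrow> real) \<Rightarrow> bool" where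
  "integral_germs \<Gamma> f \<longleftrightarrow> (\<forall>\<tau>\<in>directions \<Gamma>. \<exists>m. has_slope \<Gamma> f \<tau> m)"

lemma along_simp [simp]: "along \<Gamma> (e, t, \<sigma>) s = edge_point \<Gamma> e (t + \<sigma> * s)"
  by (simp add: along_def)

lemma has_slope_ex: "has_slope \<Gamma> f \<tau> m \<longleftrightarrow>
    (\<exists>d>0. \<forall>s. 0 < s \<and> s < d \<longrightarrow> f (along \<Gamma> \<tau> s) = f (along \<Gamma> \<tau> 0) + of_int m * s)"
  unfolding has_slope_def eventually_at_right_0 ..

lemma has_slope_unique:
  assumes "has_slope \<Gamma> f \<tau> m" "has_slope \<Gamma> f \<tau> n"
  shows "m = n"
proof -
  have "\<forall>\<^sub>F s in at_right (0::real). of_int m * s = of_int n * s \<and> s > 0"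
    using assms eventually_at_right_less[of 0] unfolding has_slope_def
    by eventually_elim auto
  then have "\<exists>s. of_int m * s = of_int n * s \<and> s > (0::real)"
    by (rule eventually_happens'[rotated]) auto
  then show ?thesis by auto
qed

text \<open>Slopes are definite descriptions; later evaluations exhibit a germ and rely on its
  uniqueness.\<close>

lemma outgoing_slope_eq:
  assumes "has_slope \<Gamma> f \<tau> m"
  shows "outgoing_slope \<Gamma> f \<tau> = m"
proof (cases \<tau>)
  case (fields e t \<sigma>)
  have "has_slope \<Gamma> f \<tau> m' \<longleftrightarrow>
      (\<forall>\<^sub>F s in at_right 0. f (edge_point \<Gamma> e (t + \<sigma> * s)) = f (edge_point \<Gamma> e t) + of_int m' * s)"
    for m'
    by (simp add: has_slope_def fields)
  then have "outgoing_slope \<Gamma> f \<tau> = (THE m'. has_slope \<Gamma> f \<tau> m')"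
    by (simp add: outgoing_slope_def fields)
  also have "\<dots> = m"
    using assms has_slope_unique by blast
  finally show ?thesis .
qed

lemma tangents_eq: "tangents \<Gamma> x = {\<tau> \<in> directions \<Gamma>. along \<Gamma> \<tau> 0 = x}"
  by (auto simp: tangents_def directions_def)

lemma has_slope_outgoing:
  assumes "integral_germs \<Gamma> f" "\<tau> \<in> directions \<Gamma>"
  shows "has_slope \<Gamma> f \<tau> (outgoing_slope \<Gamma> f \<tau>)"
  using assms outgoing_slope_eq unfolding integral_germs_def by metis

lemma has_slope_add:
  assumes "has_slope \<Gamma> f \<tau> m" "has_slope \<Gamma> g \<tau> n"
  shows "has_slope \<Gamma> (\<lambda>x. f x + g x) \<tau> (m + n)"
  using assms unfolding has_slope_def by eventually_elim (auto simp: algebra_simps)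

lemma has_slope_uminus:
  assumes "has_slope \<Gamma> f \<tau> m"
  shows "has_slope \<Gamma> (\<lambda>x. - f x) \<tau> (- m)"
  using assms unfolding has_slope_def by eventually_elim (auto simp: algebra_simps)

lemma has_slope_const: "has_slope \<Gamma> (\<lambda>x. c) \<tau> 0"
  unfolding has_slope_def by auto

lemma has_slope_eventually_const:
  assumes "\<forall>\<^sub>F s in at_right 0. f (along \<Gamma> \<tau> s) = f (along \<Gamma> \<tau> 0)"
  shows "has_slope \<Gamma> f \<tau> 0"
  using assms unfolding has_slope_def by eventually_elim auto

lemma integral_germs_add:
  "integral_germs \<Gamma> f \<Longrightarrow> integral_germs \<Gamma> g \<Longrightarrow> integral_germs \<Gamma> (\<lambda>x. f x + g x)"
  unfolding integral_germs_def using has_slope_add by blast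

lemma integral_germs_uminus: "integral_germs \<Gamma> f \<Longrightarrow> integral_germs \<Gamma> (\<lambda>x. - f x)"
  unfolding integral_germs_def using has_slope_uminus by blast

lemma integral_germs_const: "integral_germs \<Gamma> (\<lambda>x. c)"
  unfolding integral_germs_def using has_slope_const by blast

lemma outgoing_slope_add:
  assumes "integral_germs \<Gamma> f" "integral_germs \<Gamma> g" "\<tau> \<in> directions \<Gamma>"
  shows "outgoing_slope \<Gamma> (\<lambda>x. f x + g x) \<tau> = outgoing_slope \<Gamma> f \<tau> + outgoing_slope \<Gamma> g \<tau>"
  by (intro outgoing_slope_eq has_slope_add has_slope_outgoing assms)

lemma outgoing_slope_uminus:
  assumes "integral_germs \<Gamma> f" "\<tau> \<in> directions \<Gamma>"
  shows "outgoing_slope \<Gamma> (\<lambda>x. - f x) \<tau> = - outgoing_slope \<Gamma> f \<tau>"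
  by (intro outgoing_slope_eq has_slope_uminus has_slope_outgoing assms)

lemma ord_at_add:
  assumes "integral_germs \<Gamma> f" "integral_germs \<Gamma> g"
  shows "ord_at \<Gamma> (\<lambda>x. f x + g x) x = ord_at \<Gamma> f x + ord_at \<Gamma> g x"
  unfolding ord_at_def sum.distrib[symmetric]
  by (rule sum.cong) (auto simp: tangents_eq outgoing_slope_add assms)

lemma ord_at_uminus:
  assumes "integral_germs \<Gamma> f"
  shows "ord_at \<Gamma> (\<lambda>x. - f x) x = - ord_at \<Gamma> f x"
  unfolding ord_at_def sum_negf[symmetric]
  by (rule sum.cong) (auto simp: tangents_eq outgoing_slope_uminus assms)

lemma ord_at_const: "ord_at \<Gamma> (\<lambda>x. c) x = 0"
  unfolding ord_at_def by (simp add: outgoing_slope_eq[OF has_slope_const])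

lemma outgoing_slope_le:
  assumes "has_slope \<Gamma> f \<tau> m" "has_slope \<Gamma> g \<tau> n" "g (along \<Gamma> \<tau> 0) = f (along \<Gamma> \<tau> 0)"
    "\<forall>\<^sub>F s in at_right 0. f (along \<Gamma> \<tau> s) \<le> g (along \<Gamma> \<tau> s)"
  shows "m \<le> n"
proof -
  have "\<forall>\<^sub>F s in at_right (0::real). of_int m * s \<le> of_int n * s \<and> s > 0"
    using assms(1,2,4) eventually_at_right_less[of 0] unfolding has_slope_def
    by eventually_elim (use assms(3) in auto)
  then have "\<exists>s. of_int m * s \<le> of_int n * s \<and> s > (0::real)"
    by (rule eventually_happens'[rotated]) auto
  then show ?thesis by auto
qed

section \<open>Points, directions and orders on a fixed curve\<close>

locale tropical =
  fixes \<Gamma> :: "('v, 'e) metric_graph"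
  assumes tropical: "tropical_curve \<Gamma>"
begin

sublocale model: fin_digraph "model \<Gamma>"
  using tropical by (simp add: tropical_curve_def)

abbreviation "ep \<equiv> edge_point \<Gamma>"
abbreviation "ell \<equiv> len \<Gamma>"
abbreviation "hd_e \<equiv> head (model \<Gamma>)"
abbreviation "tl_e \<equiv> tail (model \<Gamma>)"
abbreviation "CT \<equiv> curve_topology \<Gamma>"
abbreviation "slope \<equiv> outgoing_slope \<Gamma>"

lemma len_pos: "e \<in> edges \<Gamma> \<Longrightarrow> 0 < ell e"
  using tropical by (simp add: tropical_curve_def)

lemma ep_in_points [simp]: "e \<in> edges \<Gamma> \<Longrightarrow> ep e t \<in> points \<Gamma>"
  using edge_point_in_points[OF tropical] .

lemma topspace_CT [simp]: "topspace CT = points \<Gamma>"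
  using topspace_curve_topology[OF tropical] .

lemma ep_inner [simp]: "0 < t \<Longrightarrow> t < ell e \<Longrightarrow> ep e t = Inner e t"
  by (simp add: edge_point_def)

lemma ep_0 [simp]: "ep e 0 = Vertex (tl_e e)"
  by (simp add: edge_point_def)

lemma ep_len [simp]: "e \<in> edges \<Gamma> \<Longrightarrow> ep e (ell e) = Vertex (hd_e e)"
  using len_pos[of e] by (simp add: edge_point_def)

lemma ep_eq_InnerD: "ep e t = Inner e' t' \<Longrightarrow> e = e' \<and> t = t' \<and> 0 < t \<and> t < ell e"
  by (auto simp: edge_point_def split: if_splits)

lemma points_cases:
  assumes "x \<in> points \<Gamma>"
  obtains v where "x = Vertex v" "v \<in> verts (model \<Gamma>)"
  | e t where "x = Inner e t" "e \<in> edges \<Gamma>" "0 < t" "t < ell e" "x = ep e t"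
  using assms unfolding points_def by auto

lemma directionsD:
  assumes "(e, t, \<sigma>) \<in> directions \<Gamma>"
  shows "e \<in> edges \<Gamma>" "0 \<le> t" "t \<le> ell e" "\<sigma> = 1 \<or> \<sigma> = -1"
    "\<sigma> = 1 \<Longrightarrow> t < ell e" "\<sigma> = -1 \<Longrightarrow> 0 < t"
  using assms by (auto simp: directions_def)

lemma along_in_points [simp]: "\<tau> \<in> directions \<Gamma> \<Longrightarrow> along \<Gamma> \<tau> s \<in> points \<Gamma>"
  by (cases \<tau>) (auto simp: directions_def)

lemma tangents_directions: "\<tau> \<in> tangents \<Gamma> x \<Longrightarrow> \<tau> \<in> directions \<Gamma>"
  by (simp add: tangents_eq)

lemma tangents_along: "\<tau> \<in> tangents \<Gamma> x \<Longrightarrow> along \<Gamma> \<tau> 0 = x"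
  by (simp add: tangents_eq)



lemma tangents_inner:
  assumes "e \<in> edges \<Gamma>" "0 < t" "t < ell e"
  shows "tangents \<Gamma> (Inner e t) = {(e, t, 1), (e, t, -1)}"
  using assms by (auto simp: tangents_def dest!: ep_eq_InnerD)

lemma tangents_ep:
  assumes "e \<in> edges \<Gamma>" "0 < t" "t < ell e" "\<sigma> = 1 \<or> \<sigma> = -1"
  shows "tangents \<Gamma> (ep e t) = {(e, t, \<sigma>), (e, t, -\<sigma>)}"
  using assms by (auto simp: tangents_inner)

lemma finite_tangents [simp]: "finite (tangents \<Gamma> x)"
proof (cases x)
  case (Vertex v)
  have "tangents \<Gamma> x \<subseteq> (\<lambda>e. (e, 0, 1)) ` edges \<Gamma> \<union> (\<lambda>e. (e, ell e, -1)) ` edges \<Gamma>"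
    unfolding Vertex by (auto simp: tangents_def edge_point_def split: if_splits)
  then show ?thesis
    by (rule finite_subset) auto
next
  case (Inner e t)
  have "tangents \<Gamma> x \<subseteq> {(e, t, 1), (e, t, -1)}"
    unfolding Inner by (auto simp: tangents_def dest!: ep_eq_InnerD)
  then show ?thesis
    by (rule finite_subset) auto
qed

lemma ord_at_ep:
  assumes "e \<in> edges \<Gamma>" "0 < t" "t < ell e" "\<sigma> = 1 \<or> \<sigma> = -1"
  shows "ord_at \<Gamma> f (ep e t) = slope f (e, t, \<sigma>) + slope f (e, t, -\<sigma>)"
  unfolding ord_at_def tangents_ep[OF assms] using assms(4) by auto

lemma eventually_along_inner:
  assumes "(e, t, \<sigma>) \<in> directions \<Gamma>"
  shows "\<forall>\<^sub>F s in at_right 0. 0 < t + \<sigma> * s \<and> t + \<sigma> * s < ell e"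
proof -
  have "\<exists>d>0. \<forall>s. 0 < s \<and> s < d \<longrightarrow> 0 < t + \<sigma> * s \<and> t + \<sigma> * s < ell e"
  proof (cases "\<sigma> = 1")
    case True
    then show ?thesis using directionsD[OF assms] by (intro exI[of _ "ell e - t"]) auto
  next
    case False
    then show ?thesis using directionsD[OF assms] by (intro exI[of _ t]) auto
  qed
  then show ?thesis by (simp add: eventually_at_right_0)
qed

lemma eventually_along_notin_finite:
  assumes "\<tau> \<in> directions \<Gamma>" "finite W"
  shows "\<forall>\<^sub>F s in at_right 0. along \<Gamma> \<tau> s \<notin> W"
proof (cases \<tau>)
  case (fields e t \<sigma>)
  have 1: "\<forall>\<^sub>F s in at_right 0. along \<Gamma> \<tau> s \<noteq> w" for w
  proof (cases w)
    case (Vertex v)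
    show ?thesis
      using eventually_along_inner[OF assms(1)[unfolded fields]]
      by eventually_elim (auto simp: fields Vertex)
  next
    case (Inner e' t')
    \<comment> \<open>As \<open>\<sigma>\<close> is 1 or -1, the ray can meet the given inner point
      only at the parameter \<open>\<bar>t' - t\<bar>\<close>.\<close>
    have "\<forall>\<^sub>F s in at_right 0. s \<noteq> \<bar>t' - t\<bar>"
    proof (cases "\<bar>t' - t\<bar> = 0")
      case True
      then show ?thesis using eventually_at_right_less[of 0] by (auto elim: eventually_mono)
    next
      case False
      then show ?thesis by (intro iffD2[OF eventually_at_right_0] exI[of _ "\<bar>t' - t\<bar>"]) auto
    qed
    with eventually_along_inner[OF assms(1)[unfolded fields]] eventually_at_right_less[of 0]
    show ?thesis
      by eventually_elim (use directionsD(4)[OF assms(1)[unfolded fields]] in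
          \<open>auto simp: fields Inner abs_if split: if_splits\<close>)
  qed
  from eventually_ball_finite[OF assms(2), of "\<lambda>s w. along \<Gamma> \<tau> s \<noteq> w" "at_right 0"] 1
  have "\<forall>\<^sub>F s in at_right 0. \<forall>w\<in>W. along \<Gamma> \<tau> s \<noteq> w" by blast
  then show ?thesis
    by eventually_elim auto
qed

section \<open>Topology of the curve\<close>

text \<open>The source of open neighbourhoods later on. If \<open>Q\<close> holds on an interval
  around \<open>t\<close> in an edge, then a nearby parameter other than \<open>t\<close> is an
  inner point of that edge, and its only two directions stay in the interval.\<close>

lemma openin_star_interior:
  "openin CT {x \<in> points \<Gamma>. Q x \<and> (\<forall>\<tau>\<in>tangents \<Gamma> x. \<forall>\<^sub>F s in at_right 0. Q (along \<Gamma> \<tau> s))}"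
    (is "openin CT ?U")
  unfolding openin_curve_topology
proof (intro conjI ballI)
  show "?U \<subseteq> points \<Gamma>" by auto
next
  fix e assume e: "e \<in> edges \<Gamma>"
  let ?P = "{t \<in> {0..ell e}. ep e t \<in> ?U}"
  have "\<exists>d>0. \<forall>t'\<in>{0..ell e}. dist t' t < d \<longrightarrow> t' \<in> ?P" if t: "t \<in> ?P" for t
  proof -
    have t01: "0 \<le> t" "t \<le> ell e" using t by auto
    have Qt: "Q (ep e t)" and Qtau: "\<And>\<tau>. \<tau> \<in> tangents \<Gamma> (ep e t) \<Longrightarrow> \<forall>\<^sub>F s in at_right 0. Q (along \<Gamma> \<tau> s)"
      using t by auto
    have "\<exists>d>0. \<forall>s. 0 < s \<and> s < d \<and> t + s \<le> ell e \<longrightarrow> Q (ep e (t + s))"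
    proof (cases "t < ell e")
      case True
      then have "(e, t, 1) \<in> tangents \<Gamma> (ep e t)" using e t01 by (auto simp: tangents_def)
      from Qtau[OF this] show ?thesis by (auto simp: eventually_at_right_0)
    next
      case False
      then show ?thesis by (intro exI[of _ 1]) (use t01 in auto)
    qed
    then obtain d1 where d1: "d1 > 0" "\<And>s. 0 < s \<Longrightarrow> s < d1 \<Longrightarrow> t + s \<le> ell e \<Longrightarrow> Q (ep e (t + s))" by blast
    have "\<exists>d>0. \<forall>s. 0 < s \<and> s < d \<and> t - s \<ge> 0 \<longrightarrow> Q (ep e (t - s))"
    proof (cases "t > 0")
      case True
      then have "(e, t, -1) \<in> tangents \<Gamma> (ep e t)" using e t01 by (auto simp: tangents_def)
      from Qtau[OF this] show ?thesis by (auto simp: eventually_at_right_0)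
    next
      case False
      then show ?thesis by (intro exI[of _ 1]) (use t01 in auto)
    qed
    then obtain d2 where d2: "d2 > 0" "\<And>s. 0 < s \<Longrightarrow> s < d2 \<Longrightarrow> t - s \<ge> 0 \<Longrightarrow> Q (ep e (t - s))" by blast
    \<comment> \<open>The second minimum keeps every parameter other than \<open>t\<close> within
      distance \<open>d\<close> strictly inside the edge.\<close>
    define d where "d = min (min d1 d2) (min (if t = 0 then ell e else t) (if t = ell e then ell e else ell e - t))"
    have "d > 0" using d1 d2 t01 len_pos[OF e] by (auto simp: d_def)
    have Qb: "Q (ep e u)" if "u \<in> {0..ell e}" "dist u t < d" for u
    proof -
      consider "u = t" | "u > t" | "u < t" by linarith
      then show ?thesis
      proof cases
        case 2
        then show ?thesis using d1(2)[of "u - t"] that by (auto simp: d_def dist_real_def)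
      next
        case 3
        then show ?thesis using d2(2)[of "t - u"] that by (auto simp: d_def dist_real_def)
      qed (use Qt in auto)
    qed
    have "t' \<in> ?P" if t': "t' \<in> {0..ell e}" "dist t' t < d" for t'
    proof (cases "t' = t")
      case False
      have inn: "0 < t'" "t' < ell e"
        using t' False t01 unfolding d_def dist_real_def by (auto split: if_splits)
      define d' where "d' = min (d - dist t' t) (min t' (ell e - t'))"
      have d': "d' > 0" using inn t' by (auto simp: d'_def)
      have "Q (ep e (t' + \<sigma> * s))" if "\<sigma> = 1 \<or> \<sigma> = -1" "0 < s" "s < d'" for \<sigma> s
        by (rule Qb) (use that in \<open>auto simp: d'_def dist_real_def\<close>)
      then have "\<forall>\<tau>\<in>tangents \<Gamma> (ep e t'). \<forall>\<^sub>F s in at_right 0. Q (along \<Gamma> \<tau> s)"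
        unfolding tangents_ep[OF e inn, of 1, simplified] eventually_at_right_0
        using d' by (force simp del: ep_inner)
      then show ?thesis using Qb[OF t'] t' e by simp
    qed (use t in auto)
    then show ?thesis using \<open>d > 0\<close> by blast
  qed
  then show "openin (top_of_set {0..ell e}) ?P"
    unfolding openin_euclidean_subtopology_iff by blast
qed

lemma openin_edge_piece:
  assumes "e \<in> edges \<Gamma>" "0 \<le> a" "b \<le> ell e"
  shows "openin CT (Inner e ` {a<..<b})"
  unfolding openin_curve_topology
proof (intro conjI ballI)
  show "Inner e ` {a<..<b} \<subseteq> points \<Gamma>" using assms by (auto simp: points_def)
next
  fix e' assume e': "e' \<in> edges \<Gamma>"
  have "{t \<in> {0..ell e'}. ep e' t \<in> Inner e ` {a<..<b}} =
      (if e' = e then {0..ell e'} \<inter> {a<..<b} else {})"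
    using assms by (auto simp: image_iff dest!: ep_eq_InnerD)
  then show "openin (top_of_set {0..ell e'}) {t \<in> {0..ell e'}. ep e' t \<in> Inner e ` {a<..<b}}"
    by (auto simp: openin_open)
qed

lemma continuous_map_ep:
  assumes "e \<in> edges \<Gamma>"
  shows "continuous_map (top_of_set {0..ell e}) CT (ep e)"
  unfolding continuous_map_def
proof (intro conjI allI impI)
  fix U assume "openin CT U"
  then show "openin (top_of_set {0..ell e}) {x \<in> topspace (top_of_set {0..ell e}). ep e x \<in> U}"
    using assms by (simp add: openin_curve_topology)
qed (use assms in auto)

text \<open>The universal property of the quotient topology, which reduces continuity to real
  functions on closed intervals.\<close>

lemma continuous_map_curve_iff:
  "continuous_map CT euclideanreal f \<longleftrightarrow> (\<forall>e\<in>edges \<Gamma>. continuous_on {0..ell e} (\<lambda>t. f (ep e t)))"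
proof
  assume L: "continuous_map CT euclideanreal f"
  show "\<forall>e\<in>edges \<Gamma>. continuous_on {0..ell e} (\<lambda>t. f (ep e t))"
    using continuous_map_compose[OF continuous_map_ep L] by (simp add: o_def)
next
  assume R: "\<forall>e\<in>edges \<Gamma>. continuous_on {0..ell e} (\<lambda>t. f (ep e t))"
  show "continuous_map CT euclideanreal f"
    unfolding continuous_map_def
  proof (intro conjI allI impI)
    fix U :: "real set" assume "openin euclideanreal U"
    then have U: "open U" by simp
    show "openin CT {x \<in> topspace CT. f x \<in> U}"
      unfolding openin_curve_topology
    proof (intro conjI ballI)
      fix e assume e: "e \<in> edges \<Gamma>"
      have "openin (top_of_set {0..ell e}) ({0..ell e} \<inter> (\<lambda>t. f (ep e t)) -` U)"
        using R e U by (auto intro: continuous_openin_preimage_gen)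
      moreover have "{0..ell e} \<inter> (\<lambda>t. f (ep e t)) -` U =
          {t \<in> {0..ell e}. ep e t \<in> {x \<in> topspace CT. f x \<in> U}}"
        using e by auto
      ultimately show "openin (top_of_set {0..ell e}) {t \<in> {0..ell e}. ep e t \<in> {x \<in> topspace CT. f x \<in> U}}"
        by simp
    qed auto
  qed auto
qed

section \<open>Rational functions via integral germs\<close>

text \<open>A two-sided form with a common radius. At an end of the edge the missing side admits
  only \<open>s = 0\<close>, so any slope serves there.\<close>

lemma integral_germs_edge:
  assumes "integral_germs \<Gamma> f" "e \<in> edges \<Gamma>" "t \<in> {0..ell e}"
  shows "\<exists>d>0. \<exists>m n :: int.
    (\<forall>s. 0 \<le> s \<and> s < d \<and> t + s \<le> ell e \<longrightarrow> f (ep e (t + s)) = f (ep e t) + of_int m * s) \<and>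
    (\<forall>s. 0 \<le> s \<and> s < d \<and> t - s \<ge> 0 \<longrightarrow> f (ep e (t - s)) = f (ep e t) + of_int n * s)"
proof -
  have "\<exists>m d. d > 0 \<and> (\<forall>s. 0 \<le> s \<and> s < d \<and> t + s \<le> ell e \<longrightarrow> f (ep e (t + s)) = f (ep e t) + of_int m * s)"
  proof (cases "t < ell e")
    case True
    then have "(e, t, 1) \<in> directions \<Gamma>" using assms by (auto simp: directions_def)
    then obtain m where "has_slope \<Gamma> f (e, t, 1) m" using assms by (auto simp: integral_germs_def)
    then obtain d where d: "d > 0" "\<forall>s. 0 < s \<and> s < d \<longrightarrow> f (ep e (t + s)) = f (ep e t) + of_int m * s"
      by (auto simp: has_slope_ex)
    have "f (ep e (t + s)) = f (ep e t) + of_int m * s" if "0 \<le> s" "s < d" for s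
      using d that by (cases "s = 0") auto
    then show ?thesis using d(1) by blast
  next
    case False
    then show ?thesis using assms(3) by (intro exI[of _ 0] exI[of _ 1]) auto
  qed
  then obtain m d1 where 1: "d1 > 0" "\<forall>s. 0 \<le> s \<and> s < d1 \<and> t + s \<le> ell e \<longrightarrow> f (ep e (t + s)) = f (ep e t) + of_int m * s"
    by blast
  have "\<exists>m d. d > 0 \<and> (\<forall>s. 0 \<le> s \<and> s < d \<and> t - s \<ge> 0 \<longrightarrow> f (ep e (t - s)) = f (ep e t) + of_int m * s)"
  proof (cases "t > 0")
    case True
    then have "(e, t, -1) \<in> directions \<Gamma>" using assms by (auto simp: directions_def)
    then obtain m where "has_slope \<Gamma> f (e, t, -1) m" using assms by (auto simp: integral_germs_def)
    then obtain d where d: "d > 0" "\<forall>s. 0 < s \<and> s < d \<longrightarrow> f (ep e (t - s)) = f (ep e t) + of_int m * s"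
      by (auto simp: has_slope_ex)
    have "f (ep e (t - s)) = f (ep e t) + of_int m * s" if "0 \<le> s" "s < d" for s
      using d that by (cases "s = 0") auto
    then show ?thesis using d(1) by blast
  next
    case False
    then show ?thesis using assms(3) by (intro exI[of _ 0] exI[of _ 1]) auto
  qed
  then obtain n d2 where 2: "d2 > 0" "\<forall>s. 0 \<le> s \<and> s < d2 \<and> t - s \<ge> 0 \<longrightarrow> f (ep e (t - s)) = f (ep e t) + of_int n * s"
    by blast
  show ?thesis
    by (rule exI[of _ "min d1 d2"], rule conjI, use 1 2 in simp, intro exI[of _ m] exI[of _ n])
      (use 1 2 in auto)
qed

lemma integral_germs_continuous:
  assumes "integral_germs \<Gamma> f"
  shows "continuous_map CT euclideanreal f"
  unfolding continuous_map_curve_iff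
proof
  fix e assume e: "e \<in> edges \<Gamma>"
  show "continuous_on {0..ell e} (\<lambda>t. f (ep e t))"
    unfolding continuous_on_iff
  proof (intro ballI allI impI)
    fix t r :: real assume t: "t \<in> {0..ell e}" and r: "r > 0"
    obtain d and m n :: int where d: "d > 0"
      "\<And>s. 0 \<le> s \<Longrightarrow> s < d \<Longrightarrow> t + s \<le> ell e \<Longrightarrow> f (ep e (t + s)) = f (ep e t) + of_int m * s"
      "\<And>s. 0 \<le> s \<Longrightarrow> s < d \<Longrightarrow> t - s \<ge> 0 \<Longrightarrow> f (ep e (t - s)) = f (ep e t) + of_int n * s"
      using integral_germs_edge[OF assms e t] by blast
    \<comment> \<open>A local Lipschitz constant; adding 1 makes the division by \<open>K\<close>
      safe.\<close>
    define K where "K = \<bar>real_of_int m\<bar> + \<bar>real_of_int n\<bar> + 1"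
    have K: "K > 0" "\<bar>real_of_int m\<bar> \<le> K" "\<bar>real_of_int n\<bar> \<le> K" by (auto simp: K_def)
    show "\<exists>d>0. \<forall>x'\<in>{0..ell e}. dist x' t < d \<longrightarrow> dist (f (ep e x')) (f (ep e t)) < r"
    proof (intro exI[of _ "min d (r / K)"] conjI ballI impI)
      show "0 < min d (r / K)" using d K r by auto
      fix u assume u: "u \<in> {0..ell e}" "dist u t < min d (r / K)"
      have "\<bar>f (ep e u) - f (ep e t)\<bar> \<le> K * dist u t"
      proof (cases "u \<ge> t")
        case True
        then have "f (ep e u) = f (ep e t) + of_int m * (u - t)"
          using d(2)[of "u - t"] u by (auto simp: dist_real_def)
        then show ?thesis using K True by (auto simp: dist_real_def abs_mult mult_right_mono)
      next
        case False
        then have "f (ep e u) = f (ep e t) + of_int n * (t - u)"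
          using d(3)[of "t - u"] u by (auto simp: dist_real_def)
        then show ?thesis using K False by (auto simp: dist_real_def abs_mult mult_right_mono)
      qed
      also have "K * dist u t < r" using u K by (auto simp: field_simps)
      finally show "dist (f (ep e u)) (f (ep e t)) < r" by (simp add: dist_real_def)
    qed
  qed
qed

text \<open>From left to right, a gap between breakpoints gives each germ. From right to left, each
  parameter has a neighbourhood with itself as the only breakpoint, and bisection of the compact
  edge turns this into finitely many breakpoints.\<close>

lemma rational_iff: "rational_function \<Gamma> f \<longleftrightarrow> integral_germs \<Gamma> f"
proof
  assume L: "rational_function \<Gamma> f"
  show "integral_germs \<Gamma> f"
    unfolding integral_germs_def
  proof
    fix \<tau> assume "\<tau> \<in> directions \<Gamma>"
    then obtain e t \<sigma> where \<tau>: "\<tau> = (e, t, \<sigma>)" "(e, t, \<sigma>) \<in> directions \<Gamma>" by (cases \<tau>) auto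
    note D = directionsD[OF \<tau>(2)]
    have "piecewise_linear_int (ell e) (\<lambda>t. f (ep e t))"
      using L D(1) by (simp add: rational_function_def)
    then obtain B where B: "finite B" "\<forall>a b. 0 \<le> a \<and> a < b \<and> b \<le> ell e \<and> {a<..<b} \<inter> B = {} \<longrightarrow>
        (\<exists>(m::int) c. \<forall>u\<in>{a..b}. f (ep e u) = of_int m * u + c)"
      unfolding piecewise_linear_int_def by blast
    from finite_set_avoid[OF B(1), of t] obtain d where d: "d > 0" "\<forall>x\<in>B. x \<noteq> t \<longrightarrow> d \<le> dist t x"
      by blast
    show "\<exists>m. has_slope \<Gamma> f \<tau> m"
    proof (cases "\<sigma> = 1")
      case True
      then have tl: "t < ell e" using D by auto
      define b where "b = min (ell e) (t + d)"
      have b: "t < b" "b \<le> ell e" using d tl by (auto simp: b_def)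
      have "{t<..<b} \<inter> B = {}" using d by (fastforce simp: b_def dist_real_def)
      with B(2)[rule_format, of t b] D(2) b obtain m :: int and c
        where m: "\<forall>u\<in>{t..b}. f (ep e u) = of_int m * u + c" by auto
      have "has_slope \<Gamma> f \<tau> m"
        unfolding has_slope_ex \<tau>(1) True along_simp
        by (rule exI[of _ "b - t"]) (use m b in \<open>auto simp: algebra_simps\<close>)
      then show ?thesis ..
    next
      case False
      then have tl: "\<sigma> = -1" "t > 0" using D by auto
      define a where "a = max 0 (t - d)"
      have a: "0 \<le> a" "a < t" using d tl by (auto simp: a_def)
      have "{a<..<t} \<inter> B = {}" using d by (fastforce simp: a_def dist_real_def)
      with B(2)[rule_format, of a t] D(3) a obtain m :: int and c
        where m: "\<forall>u\<in>{a..t}. f (ep e u) = of_int m * u + c" by auto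
      have "has_slope \<Gamma> f \<tau> (-m)"
        unfolding has_slope_ex \<tau>(1) tl along_simp
        by (rule exI[of _ "t - a"]) (use m a in \<open>auto simp: algebra_simps\<close>)
      then show ?thesis ..
    qed
  qed
next
  assume R: "integral_germs \<Gamma> f"
  have "piecewise_linear_int (ell e) (\<lambda>t. f (ep e t))" if e: "e \<in> edges \<Gamma>" for e
  proof -
    let ?A = "\<lambda>a b. \<exists>(m::int) c. \<forall>t\<in>{a..b}. f (ep e t) = of_int m * t + c"
    \<comment> \<open>\<open>Bolzano\<close> asks for all real intervals around a point, also those
      that leave the edge, so they are clipped to it.\<close>
    define P where "P = (\<lambda>a b. \<exists>B. finite B \<and> (\<forall>a' b'. max 0 a \<le> a' \<and> a' < b' \<and> b' \<le> min b (ell e) \<and> {a'<..<b'} \<inter> B = {} \<longrightarrow> ?A a' b'))"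
    have "P 0 (ell e)"
    proof (rule Bolzano)
      show "0 \<le> ell e" using len_pos[OF e] by simp
    next
      fix a b c assume "P b c" "P a b" and abc: "a \<le> b" "b \<le> c"
      then obtain B1 where B1: "finite B1" "\<forall>a' b'. max 0 a \<le> a' \<and> a' < b' \<and> b' \<le> min b (ell e) \<and> {a'<..<b'} \<inter> B1 = {} \<longrightarrow> ?A a' b'"
        unfolding P_def by blast
      from \<open>P b c\<close> obtain B2 where B2: "finite B2" "\<forall>a' b'. max 0 b \<le> a' \<and> a' < b' \<and> b' \<le> min c (ell e) \<and> {a'<..<b'} \<inter> B2 = {} \<longrightarrow> ?A a' b'"
        unfolding P_def by blast
      show "P a c"
        unfolding P_def
      proof (intro exI[of _ "B1 \<union> B2 \<union> {b}"] conjI allI impI)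
        fix a' b' assume *: "max 0 a \<le> a' \<and> a' < b' \<and> b' \<le> min c (ell e) \<and> {a'<..<b'} \<inter> (B1 \<union> B2 \<union> {b}) = {}"
        then have "b \<notin> {a'<..<b'}" by auto
        then consider "b' \<le> b" | "b \<le> a'" by fastforce
        then show "?A a' b'"
        proof cases
          case 1
          show ?thesis by (rule B1(2)[rule_format]) (use * 1 in auto)
        next
          case 2
          show ?thesis by (rule B2(2)[rule_format]) (use * 2 in auto)
        qed
      qed (use B1 B2 in auto)
    next
      fix t assume t: "0 \<le> t" "t \<le> ell e"
      then have t': "t \<in> {0..ell e}" by auto
      obtain d and m n :: int where d: "d > 0"
        "\<And>s. 0 \<le> s \<Longrightarrow> s < d \<Longrightarrow> t + s \<le> ell e \<Longrightarrow> f (ep e (t + s)) = f (ep e t) + of_int m * s"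
        "\<And>s. 0 \<le> s \<Longrightarrow> s < d \<Longrightarrow> t - s \<ge> 0 \<Longrightarrow> f (ep e (t - s)) = f (ep e t) + of_int n * s"
        using integral_germs_edge[OF R e t'] by blast
      have d2: "f (ep e u) = of_int m * u + (f (ep e t) - of_int m * t)" if "t \<le> u" "u < t + d" "u \<le> ell e" for u
        using d(2)[of "u - t"] that by (auto simp: algebra_simps)
      have d3: "f (ep e u) = of_int (-n) * u + (f (ep e t) + of_int n * t)" if "u \<le> t" "t < u + d" "0 \<le> u" for u
        using d(3)[of "t - u"] that by (auto simp: algebra_simps)
      have "P a b" if ab: "a \<le> t \<and> t \<le> b \<and> b - a < d" for a b
        unfolding P_def
      proof (intro exI[of _ "{t}"] conjI allI impI)
        fix a' b' assume *: "max 0 a \<le> a' \<and> a' < b' \<and> b' \<le> min b (ell e) \<and> {a'<..<b'} \<inter> {t} = {}"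
        then have "t \<notin> {a'<..<b'}" by auto
        then consider "b' \<le> t" | "t \<le> a'" by fastforce
        then show "?A a' b'"
        proof cases
          case 1
          then have "\<forall>u\<in>{a'..b'}. f (ep e u) = of_int (-n) * u + (f (ep e t) + of_int n * t)"
            using * ab by (intro ballI d3) auto
          then show ?thesis by blast
        next
          case 2
          then have "\<forall>u\<in>{a'..b'}. f (ep e u) = of_int m * u + (f (ep e t) - of_int m * t)"
            using * ab by (intro ballI d2) auto
          then show ?thesis by blast
        qed
      qed auto
      then show "\<exists>d>0. \<forall>a b. a \<le> t \<and> t \<le> b \<and> b - a < d \<longrightarrow> P a b"
        using d(1) by blast
    qed
    then show ?thesis
      unfolding P_def piecewise_linear_int_def by auto
  qed
  then show "rational_function \<Gamma> f"
    using integral_germs_continuous[OF R] by (simp add: rational_function_def)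
qed

text \<open>At an inner point that is not a breakpoint the function is affine on both sides and the
  two outgoing slopes cancel.\<close>

lemma finite_ord_at:
  assumes "integral_germs \<Gamma> f"
  shows "finite {x \<in> points \<Gamma>. ord_at \<Gamma> f x \<noteq> 0}"
proof -
  have "\<forall>e\<in>edges \<Gamma>. \<exists>B. finite B \<and> (\<forall>a b. 0 \<le> a \<and> a < b \<and> b \<le> ell e \<and> {a<..<b} \<inter> B = {} \<longrightarrow>
        (\<exists>(m::int) c. \<forall>u\<in>{a..b}. f (ep e u) = of_int m * u + c))"
    using assms unfolding rational_iff[symmetric] rational_function_def piecewise_linear_int_def by simp
  from bchoice[OF this] obtain B where B': "\<forall>e\<in>edges \<Gamma>. finite (B e) \<and>
      (\<forall>a b. 0 \<le> a \<and> a < b \<and> b \<le> ell e \<and> {a<..<b} \<inter> B e = {} \<longrightarrow>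
        (\<exists>(m::int) c. \<forall>u\<in>{a..b}. f (ep e u) = of_int m * u + c))" ..
  then have B: "\<And>e. e \<in> edges \<Gamma> \<Longrightarrow> finite (B e)"
    "\<And>e a b. e \<in> edges \<Gamma> \<Longrightarrow> 0 \<le> a \<Longrightarrow> a < b \<Longrightarrow> b \<le> ell e \<Longrightarrow> {a<..<b} \<inter> B e = {} \<Longrightarrow>
        \<exists>(m::int) c. \<forall>u\<in>{a..b}. f (ep e u) = of_int m * u + c"
    by simp_all
  have "{x \<in> points \<Gamma>. ord_at \<Gamma> f x \<noteq> 0} \<subseteq> Vertex ` verts (model \<Gamma>) \<union> (\<Union>e\<in>edges \<Gamma>. Inner e ` B e)"
  proof
    fix x assume x: "x \<in> {x \<in> points \<Gamma>. ord_at \<Gamma> f x \<noteq> 0}"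
    then have "x \<in> points \<Gamma>" by simp
    then show "x \<in> Vertex ` verts (model \<Gamma>) \<union> (\<Union>e\<in>edges \<Gamma>. Inner e ` B e)"
    proof (cases rule: points_cases)
      case (2 e t)
      have "t \<in> B e"
      proof (rule ccontr)
        assume t: "t \<notin> B e"
        from finite_set_avoid[OF B(1)[OF 2(2)], of t] obtain d where d: "d > 0" "\<forall>x\<in>B e. x \<noteq> t \<longrightarrow> d \<le> dist t x"
          by blast
        then have d: "d > 0" "\<forall>x\<in>B e. d \<le> dist t x" using t by auto
        define r where "r = min d (min t (ell e - t))"
        have r: "r > 0" "r \<le> t" "t + r \<le> ell e" using 2 d by (auto simp: r_def)
        have "{t-r<..<t+r} \<inter> B e = {}" using d by (fastforce simp: r_def dist_real_def)
        then obtain m :: int and c where m: "\<forall>u\<in>{t-r..t+r}. f (ep e u) = of_int m * u + c"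
          using B(2)[OF 2(2), of "t - r" "t + r"] r by auto
        have "f (ep e (t + s)) = f (ep e t) + of_int m * s"
          "f (ep e (t - s)) = f (ep e t) - of_int m * s" if "0 < s \<and> s < r" for s
          using m[rule_format, of t] m[rule_format, of "t + s"] m[rule_format, of "t - s"] that r
          by (simp_all add: algebra_simps)
        then have "has_slope \<Gamma> f (e, t, 1) m" "has_slope \<Gamma> f (e, t, -1) (-m)"
          unfolding has_slope_ex along_simp using r(1) by (auto intro!: exI[of _ r] simp del: ep_inner)
        then have "ord_at \<Gamma> f (ep e t) = 0"
          using ord_at_ep[OF 2(2,3,4), of 1 f] by (simp add: outgoing_slope_eq)
        then show False using x 2 by simp
      qed
      then show ?thesis using 2 by auto
    qed auto
  qed
  then show ?thesis
    by (rule finite_subset) (use B in auto)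
qed

end

section \<open>Convexity along edges\<close>

text \<open>Nonnegative sums of the two outgoing slopes are convexity for piecewise linear
  functions, and a convex function lies above its initial tangent line. After subtraction of the
  line this becomes a maximum principle.\<close>

lemma support_line_le:
  fixes \<phi> :: "real \<Rightarrow> real"
  assumes cont: "continuous_on {a..b} \<phi>"
    and inner: "\<And>t. a < t \<Longrightarrow> t < b \<Longrightarrow> \<exists>m n. m + n \<ge> 0 \<and>
      (\<exists>d>0. \<forall>s. 0 < s \<and> s < d \<longrightarrow> \<phi> (t + s) = \<phi> t + m * s \<and> \<phi> (t - s) = \<phi> t + n * s)"
    and left: "\<exists>d>0. \<forall>s. 0 < s \<and> s < d \<longrightarrow> \<phi> (a + s) = \<phi> a + m * s"
    and t: "a \<le> t" "t \<le> b"
  shows "\<phi> a + m * (t - a) \<le> \<phi> t"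
proof (rule ccontr)
  define \<psi> where "\<psi> u = \<phi> u - \<phi> a - m * (u - a)" for u
  assume "\<not> \<phi> a + m * (t - a) \<le> \<phi> t"
  then have neg: "\<psi> t < 0" by (simp add: \<psi>_def)
  have \<psi>a: "\<psi> a = 0" by (simp add: \<psi>_def)
  have cont\<psi>: "continuous_on {a..t} \<psi>"
    unfolding \<psi>_def by (intro continuous_intros continuous_on_subset[OF cont]) (use t in auto)
  obtain u0 where u0: "u0 \<in> {a..t}" "\<forall>u\<in>{a..t}. \<psi> u \<le> \<psi> u0"
    using continuous_attains_sup[OF compact_Icc _ cont\<psi>] t by auto
  define A where "A = {u \<in> {a..t}. \<psi> u = \<psi> u0}"
  have "closed A"
    unfolding A_def using continuous_closed_preimage_constant[OF cont\<psi> closed_atLeastAtMost, of "\<psi> u0"]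
    by simp
  then have "compact ({a..t} \<inter> A)" by (rule compact_Int_closed[OF compact_Icc])
  moreover have "{a..t} \<inter> A = A" by (auto simp: A_def)
  ultimately have "compact A" by simp
  moreover have "A \<noteq> {}" using u0 by (auto simp: A_def)
  \<comment> \<open>The last maximum of \<open>\<psi>\<close> on \<open>{a..t}\<close>. Both slopes
    of \<open>\<psi>\<close> are at most 0 there and their sum is nonnegative, so they vanish; then
    \<open>\<psi>\<close> stays maximal a little beyond \<open>w\<close>, a contradiction. If
    \<open>w = a\<close>, the initial slope of \<open>\<psi>\<close> is 0 by construction.\<close>
  ultimately obtain w where w: "w \<in> A" "\<forall>u\<in>A. u \<le> w"
    using compact_attains_sup[of A] by blast
  have wM: "\<psi> u \<le> \<psi> w" if "u \<in> {a..t}" for u using w u0 that by (auto simp: A_def)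
  have "w \<noteq> t" using wM[of a] \<psi>a neg t by auto
  then have wI: "a \<le> w" "w < t" using w(1) by (auto simp: A_def)
  have not_const: "\<not> (\<exists>d>0. \<forall>s. 0 < s \<and> s < d \<longrightarrow> \<psi> (w + s) = \<psi> w)"
  proof
    assume "\<exists>d>0. \<forall>s. 0 < s \<and> s < d \<longrightarrow> \<psi> (w + s) = \<psi> w"
    then obtain d where d: "d > 0" "\<forall>s. 0 < s \<and> s < d \<longrightarrow> \<psi> (w + s) = \<psi> w" by blast
    define s where "s = min (d/2) (t - w)"
    have "s > 0" "s < d" "w + s \<le> t" using d wI by (auto simp: s_def)
    then have "w + s \<in> A" using d wI w by (auto simp: A_def)
    then have "w + s \<le> w" using w(2) by blast
    then show False using \<open>s > 0\<close> by simp
  qed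
  show False
  proof (cases "w = a")
    case True
    obtain d where "d > 0" "\<forall>s. 0 < s \<and> s < d \<longrightarrow> \<phi> (a + s) = \<phi> a + m * s" using left by blast
    then have "d > 0 \<and> (\<forall>s. 0 < s \<and> s < d \<longrightarrow> \<psi> (w + s) = \<psi> w)"
      by (auto simp: \<psi>_def True)
    then have "\<exists>d>0. \<forall>s. 0 < s \<and> s < d \<longrightarrow> \<psi> (w + s) = \<psi> w" by blast
    then show False using not_const by blast
  next
    case False
    then have "a < w" "w < b" using wI t by auto
    from inner[OF this] obtain p q d where pq: "p + q \<ge> 0" and d: "d > 0"
      "\<forall>s. 0 < s \<and> s < d \<longrightarrow> \<phi> (w + s) = \<phi> w + p * s \<and> \<phi> (w - s) = \<phi> w + q * s" by blast
    have 1: "\<psi> (w + s) = \<psi> w + (p - m) * s" "\<psi> (w - s) = \<psi> w + (q + m) * s" if "0 < s" "s < d" for s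
      using d(2) that by (auto simp: \<psi>_def algebra_simps)
    define s where "s = min (d/2) (min (t - w) (w - a))"
    have s: "s > 0" "s < d" "w + s \<le> t" "w - s \<ge> a"
      unfolding s_def using d(1) wI \<open>a < w\<close> by linarith+
    have "(p - m) * s \<le> 0" "(q + m) * s \<le> 0"
      using wM[of "w + s"] wM[of "w - s"] 1[OF s(1,2)] s wI \<open>a < w\<close> by auto
    then have "p - m \<le> 0" "q + m \<le> 0" using s(1) by (auto simp: mult_le_0_iff)
    then have "p - m = 0" using pq by linarith
    then have "\<exists>d>0. \<forall>s. 0 < s \<and> s < d \<longrightarrow> \<psi> (w + s) = \<psi> w"
      using 1 d(1) by (intro exI[of _ d]) auto
    then show False using not_const by blast
  qed
qed

text \<open>The germ version of the outgoing degree: \<open>out_degree_eq_card_leaving\<close>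
  replaces families of embedded segments by a count of these directions.\<close>

definition leaving ::
  "('v, 'e) metric_graph \<Rightarrow> ('v, 'e) point set \<Rightarrow> ('v, 'e) point \<Rightarrow> ('e \<times> real \<times> real) set" where
  "leaving \<Gamma> X v = {\<tau> \<in> tangents \<Gamma> v. \<forall>\<^sub>F s in at_right 0. along \<Gamma> \<tau> s \<notin> X}"

context tropical
begin

lemma continuous_on_along:
  assumes "integral_germs \<Gamma> f" "(e, t, \<sigma>) \<in> directions \<Gamma>" "0 \<le> t + \<sigma> * l" "t + \<sigma> * l \<le> ell e"
  shows "continuous_on {0..l} (\<lambda>s. f (along \<Gamma> (e, t, \<sigma>) s))"
proof -
  note D = directionsD[OF assms(2)]
  have "continuous_on {0..ell e} (\<lambda>t. f (ep e t))"
    using integral_germs_continuous[OF assms(1)] D(1) continuous_map_curve_iff by blast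
  moreover have "continuous_on {0..l} (\<lambda>s. t + \<sigma> * s)" by (intro continuous_intros)
  moreover have "(\<lambda>s. t + \<sigma> * s) ` {0..l} \<subseteq> {0..ell e}"
  proof
    fix y assume "y \<in> (\<lambda>s. t + \<sigma> * s) ` {0..l}"
    then obtain s where s: "y = t + \<sigma> * s" "0 \<le> s" "s \<le> l" by fastforce
    show "y \<in> {0..ell e}" using D(4) s D(2,3) assms(3,4) by auto
  qed
  ultimately show ?thesis
    unfolding along_simp
    by (rule continuous_on_compose2)
qed

lemma along_between:
  assumes "(e, t, \<sigma>) \<in> directions \<Gamma>" "0 \<le> t + \<sigma> * l" "t + \<sigma> * l \<le> ell e" "0 < s" "s < l"
  shows "0 < t + \<sigma> * s" "t + \<sigma> * s < ell e"
  using directionsD[OF assms(1)] assms(2-) by auto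

lemma directions_between:
  assumes "(e, t, \<sigma>) \<in> directions \<Gamma>" "0 \<le> t + \<sigma> * l" "t + \<sigma> * l \<le> ell e" "0 < s" "s < l"
  shows "(e, t + \<sigma> * s, \<sigma>) \<in> directions \<Gamma>" "(e, t + \<sigma> * s, -\<sigma>) \<in> directions \<Gamma>"
  using directionsD[OF assms(1)] along_between[OF assms] unfolding directions_def by auto

lemma direction_end:
  assumes "(e, t, \<sigma>) \<in> directions \<Gamma>" "0 \<le> t + \<sigma> * l" "t + \<sigma> * l \<le> ell e" "0 < l"
  shows "(e, t + \<sigma> * l, -\<sigma>) \<in> directions \<Gamma>"
  using directionsD[OF assms(1)] assms unfolding directions_def by auto

text \<open>At an inner point of an edge the order is the sum of the two opposite slopes, so
  nonnegative orders are the convexity required by \<open>support_line_le\<close>.\<close>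

lemma along_support_line:
  assumes f: "integral_germs \<Gamma> f" and \<tau>: "(e, t, \<sigma>) \<in> directions \<Gamma>"
    and l: "0 \<le> t + \<sigma> * l" "t + \<sigma> * l \<le> ell e"
    and ord: "\<And>s. 0 < s \<Longrightarrow> s < l \<Longrightarrow> 0 \<le> ord_at \<Gamma> f (along \<Gamma> (e, t, \<sigma>) s)"
    and s: "0 \<le> s" "s \<le> l"
  shows "f (along \<Gamma> (e, t, \<sigma>) 0) + of_int (slope f (e, t, \<sigma>)) * s \<le> f (along \<Gamma> (e, t, \<sigma>) s)"
proof -
  note D = directionsD[OF \<tau>]
  let ?\<phi> = "\<lambda>s. f (along \<Gamma> (e, t, \<sigma>) s)"
  have "?\<phi> 0 + of_int (slope f (e, t, \<sigma>)) * (s - 0) \<le> ?\<phi> s"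
  proof (rule support_line_le[of 0 l])
    show "continuous_on {0..l} ?\<phi>" by (rule continuous_on_along[OF f \<tau> l])
    show "\<exists>d>0. \<forall>s. 0 < s \<and> s < d \<longrightarrow> ?\<phi> (0 + s) = ?\<phi> 0 + of_int (slope f (e, t, \<sigma>)) * s"
      using has_slope_outgoing[OF f \<tau>] by (simp add: has_slope_ex)
  next
    fix u assume u: "0 < u" "u < l"
    let ?m = "slope f (e, t + \<sigma> * u, \<sigma>)" and ?n = "slope f (e, t + \<sigma> * u, -\<sigma>)"
    note dirs = directions_between[OF \<tau> l u]
    from has_slope_outgoing[OF f dirs(1)] obtain d1 where d1: "d1 > 0"
      "\<forall>s. 0 < s \<and> s < d1 \<longrightarrow> f (ep e (t + \<sigma> * u + \<sigma> * s)) = f (ep e (t + \<sigma> * u)) + of_int ?m * s"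
      by (auto simp: has_slope_ex)
    from has_slope_outgoing[OF f dirs(2)] obtain d2 where d2: "d2 > 0"
      "\<forall>s. 0 < s \<and> s < d2 \<longrightarrow> f (ep e (t + \<sigma> * u - \<sigma> * s)) = f (ep e (t + \<sigma> * u)) + of_int ?n * s"
      by (auto simp: has_slope_ex)
    have "0 \<le> ?m + ?n"
      using ord[OF u] ord_at_ep[OF D(1) along_between[OF \<tau> l u] D(4), of f] by simp
    then have "0 \<le> real_of_int ?m + real_of_int ?n" by linarith
    moreover have "\<forall>s. 0 < s \<and> s < min d1 d2 \<longrightarrow>
        ?\<phi> (u + s) = ?\<phi> u + of_int ?m * s \<and> ?\<phi> (u - s) = ?\<phi> u + of_int ?n * s"
      using d1 d2 by (simp add: algebra_simps)
    ultimately show "\<exists>m n. m + n \<ge> 0 \<and> (\<exists>d>0. \<forall>s. 0 < s \<and> s < d \<longrightarrow>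
        ?\<phi> (u + s) = ?\<phi> u + m * s \<and> ?\<phi> (u - s) = ?\<phi> u + n * s)"
      using d1(1) d2(1) by (metis min_less_iff_conj)
  qed (use s in auto)
  then show ?thesis by simp
qed

section \<open>Outgoing degrees\<close>

text \<open>Within such a radius the punctured neighbourhood of \<open>v\<close> is a disjoint union
  of open rays, one for each tangent direction; a loop at \<open>v\<close> contributes two of
  them.\<close>

definition star_radius :: "('v, 'e) point \<Rightarrow> real \<Rightarrow> bool" where
  "star_radius v r \<longleftrightarrow> 0 < r \<and>
     (\<forall>(e, t, \<sigma>)\<in>tangents \<Gamma> v. \<forall>s. 0 < s \<and> s < r \<longrightarrow> 0 < t + \<sigma> * s \<and> t + \<sigma> * s < ell e) \<and>
     (\<forall>\<tau>\<in>tangents \<Gamma> v. \<forall>\<tau>'\<in>tangents \<Gamma> v. \<forall>s s'. 0 < s \<and> s < r \<and> 0 < s' \<and> s' < r \<and>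
        along \<Gamma> \<tau> s = along \<Gamma> \<tau>' s' \<longrightarrow> \<tau> = \<tau>' \<and> s = s')"

lemma star_radius_pos: "star_radius v r \<Longrightarrow> 0 < r"
  by (simp add: star_radius_def)

lemma star_radius_inner:
  assumes "star_radius v r" "(e, t, \<sigma>) \<in> tangents \<Gamma> v" "0 < s" "s < r"
  shows "0 < t + \<sigma> * s" "t + \<sigma> * s < ell e"
  using assms by (auto simp: star_radius_def)

lemma star_radius_inj:
  assumes "star_radius v r" "\<tau> \<in> tangents \<Gamma> v" "\<tau>' \<in> tangents \<Gamma> v"
    "0 < s" "s < r" "0 < s'" "s' < r" "along \<Gamma> \<tau> s = along \<Gamma> \<tau>' s'"
  shows "\<tau> = \<tau>'" "s = s'"
proof -
  have "\<forall>s s'. 0 < s \<and> s < r \<and> 0 < s' \<and> s' < r \<and> along \<Gamma> \<tau> s = along \<Gamma> \<tau>' s' \<longrightarrow> \<tau> = \<tau>' \<and> s = s'"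
    using assms(1-3) unfolding star_radius_def by blast
  then show "\<tau> = \<tau>'" "s = s'" using assms(4-) by auto
qed

lemma ex_star_radius: "\<exists>r. star_radius v r"
proof -
  have "\<forall>\<^sub>F s in at_right 0. \<forall>\<tau>\<in>tangents \<Gamma> v. case \<tau> of (e, t, \<sigma>) \<Rightarrow> 0 < t + \<sigma> * s \<and> t + \<sigma> * s < ell e"
    by (rule eventually_ball_finite)
      (auto dest!: tangents_directions eventually_along_inner)
  then obtain r1 where r1: "r1 > 0" "\<forall>s. 0 < s \<and> s < r1 \<longrightarrow>
      (\<forall>\<tau>\<in>tangents \<Gamma> v. case \<tau> of (e, t, \<sigma>) \<Rightarrow> 0 < t + \<sigma> * s \<and> t + \<sigma> * s < ell e)"
    unfolding eventually_at_right_0 by blast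
  \<comment> \<open>Different rays from \<open>v\<close> can meet only if they enter the same edge
    from its two ends, and half the least length keeps these apart. The inserted 1 covers a curve
    without edges.\<close>
  define r2 where "r2 = Min (insert 1 (ell ` edges \<Gamma>)) / 2"
  have "r2 > 0" using len_pos by (auto simp: r2_def)
  have r2: "2 * r2 \<le> ell e" if "e \<in> edges \<Gamma>" for e
    using that by (auto simp: r2_def)
  have inn: "0 < t + \<sigma> * s \<and> t + \<sigma> * s < ell e" if "(e, t, \<sigma>) \<in> tangents \<Gamma> v" "0 < s" "s < r1" for e t \<sigma> s
    using r1(2) that by fastforce
  have "\<tau> = \<tau>' \<and> s = s'" if *: "\<tau> \<in> tangents \<Gamma> v" "\<tau>' \<in> tangents \<Gamma> v" "0 < s" "s < min r1 r2"
      "0 < s'" "s' < min r1 r2" "along \<Gamma> \<tau> s = along \<Gamma> \<tau>' s'" for \<tau> \<tau>' s s'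
  proof -
    obtain e t \<sigma> where \<tau>: "\<tau> = (e, t, \<sigma>)" by (cases \<tau>) auto
    obtain e' t' \<sigma>' where \<tau>': "\<tau>' = (e', t', \<sigma>')" by (cases \<tau>') auto
    have "0 < t + \<sigma> * s" "t + \<sigma> * s < ell e" "0 < t' + \<sigma>' * s'" "t' + \<sigma>' * s' < ell e'"
      using inn[of e t \<sigma> s] inn[of e' t' \<sigma>' s'] * \<tau> \<tau>' by auto
    then have eq: "e = e'" "t + \<sigma> * s = t' + \<sigma>' * s'" using *(7) by (auto simp: \<tau> \<tau>')
    have T: "e \<in> edges \<Gamma>" "0 \<le> t" "t \<le> ell e" "0 \<le> t'" "t' \<le> ell e" "ep e t = v" "ep e t' = v"
      "\<sigma> = 1 \<or> \<sigma> = -1" "\<sigma>' = 1 \<or> \<sigma>' = -1"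
      "\<sigma> = 1 \<Longrightarrow> t < ell e" "\<sigma> = -1 \<Longrightarrow> 0 < t" "\<sigma>' = 1 \<Longrightarrow> t' < ell e" "\<sigma>' = -1 \<Longrightarrow> 0 < t'"
      using *(1,2) eq(1) by (auto simp: \<tau> \<tau>' tangents_def)
    have "t = t' \<or> (t = 0 \<and> t' = ell e) \<or> (t' = 0 \<and> t = ell e)"
      using T(2-7) by (auto simp: edge_point_def split: if_splits)
    moreover have "2 * r2 \<le> ell e" "s < r2" "s' < r2" using r2[OF T(1)] * by auto
    ultimately show "\<tau> = \<tau>' \<and> s = s'"
      using eq T(8-) *(3,5) \<tau> \<tau>' by auto
  qed
  then have "star_radius v (min r1 r2)"
    unfolding star_radius_def using r1(1) \<open>r2 > 0\<close> inn by (auto simp del: along_simp)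
  then show ?thesis ..
qed


lemma mem_ray: "z \<in> along \<Gamma> \<tau> ` {a<..<b} \<longleftrightarrow> (\<exists>s. a < s \<and> s < b \<and> z = along \<Gamma> \<tau> s)"
  by auto

lemma openin_ray_piece:
  assumes \<tau>: "\<tau> \<in> directions \<Gamma>" and a: "0 \<le> a"
    and inn: "\<And>s. 0 < s \<Longrightarrow> s < b \<Longrightarrow> along \<Gamma> \<tau> s = Inner (fst \<tau>) (fst (snd \<tau>) + snd (snd \<tau>) * s) \<and>
      0 < fst (snd \<tau>) + snd (snd \<tau>) * s \<and> fst (snd \<tau>) + snd (snd \<tau>) * s < ell (fst \<tau>)"
  shows "openin CT (along \<Gamma> \<tau> ` {a<..<b})"
proof (cases "a < b")
  case True
  obtain e t \<sigma> where \<tau>e: "\<tau> = (e, t, \<sigma>)" by (cases \<tau>) auto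
  note D = directionsD[OF \<tau>[unfolded \<tau>e]]
  have inn': "along \<Gamma> \<tau> s = Inner e (t + \<sigma> * s)" "0 < t + \<sigma> * s" "t + \<sigma> * s < ell e" if "0 < s" "s < b" for s
    using inn[OF that] by (auto simp: \<tau>e)
  \<comment> \<open>The hypothesis speaks only of \<open>s < b\<close>. If \<open>b\<close> reached
    beyond the end of the edge, it would fail at the parameter of that end.\<close>
  have bb: "0 \<le> t + \<sigma> * b \<and> t + \<sigma> * b \<le> ell e"
  proof (cases "\<sigma> = 1")
    case True
    have "\<not> t + b > ell e"
      using inn'(3)[of "ell e - t"] D(5)[OF True] True by auto
    then show ?thesis using True D(2) \<open>a < b\<close> a by auto
  next
    case False
    then have \<sigma>: "\<sigma> = -1" using D by auto
    have "\<not> t - b < 0"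
      using inn'(2)[of t] D(6)[OF \<sigma>] \<sigma> by auto
    then show ?thesis using \<sigma> D(3) \<open>a < b\<close> a by auto
  qed
  have "along \<Gamma> \<tau> ` {a<..<b} = (\<lambda>s. Inner e (t + \<sigma> * s)) ` {a<..<b}"
    using inn' a by (intro image_cong) auto
  also have "\<dots> = Inner e ` ((\<lambda>s. t + \<sigma> * s) ` {a<..<b})" by (simp add: image_image)
  also have "(\<lambda>s. t + \<sigma> * s) ` {a<..<b} = (if \<sigma> = 1 then {t+a<..<t+b} else {t-b<..<t-a})"
  proof (cases "\<sigma> = 1")
    case True
    have "x \<in> (\<lambda>s. t + s) ` {a<..<b}" if "x \<in> {t+a<..<t+b}" for x
      by (rule image_eqI[of _ _ "x - t"]) (use that in auto)
    then show ?thesis using True by auto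
  next
    case False
    have "x \<in> (\<lambda>s. t - s) ` {a<..<b}" if "x \<in> {t-b<..<t-a}" for x
      by (rule image_eqI[of _ _ "t - x"]) (use that in auto)
    then show ?thesis using False D(4) by auto
  qed
  also have "openin CT (Inner e ` \<dots>)"
    using D a bb by (auto intro!: openin_edge_piece)
  finally show ?thesis .
qed auto

text \<open>Near its start an embedded segment lies in the star of \<open>v\<close> and avoids
  \<open>v\<close> itself, so by connectedness it stays on a single ray. It also comes arbitrarily
  close to \<open>v\<close>, so it cannot skip a point of that ray.\<close>

lemma segment_covers_ray:
  assumes v: "v \<in> points \<Gamma>" and seg: "segment_from \<Gamma> v \<gamma>"
  shows "\<exists>\<tau>\<in>tangents \<Gamma> v. \<exists>d>0. \<forall>s. 0 < s \<and> s < d \<longrightarrow> along \<Gamma> \<tau> s \<in> \<gamma> ` {0<..<1}"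
proof -
  have emb: "embedding_map (top_of_set {0..1}) CT \<gamma>" and \<gamma>0: "\<gamma> 0 = v"
    using seg by (auto simp: segment_from_def)
  have cont: "continuous_map (top_of_set {0..1}) CT \<gamma>"
    using emb embedding_map_def homeomorphic_imp_continuous_map continuous_map_in_subtopology by blast
  have inj: "inj_on \<gamma> {0..1}"
    using emb by (simp add: embedding_map_def homeomorphic_map_def)
  obtain r where sr: "star_radius v r" using ex_star_radius by blast
  note r = star_radius_pos[OF sr]
  have near: "\<exists>\<eta>>0. \<eta> \<le> 1 \<and> (\<forall>u. 0 < u \<and> u < \<eta> \<longrightarrow> (\<exists>\<tau>\<in>tangents \<Gamma> v. \<exists>s. 0 < s \<and> s < \<rho> \<and> \<gamma> u = along \<Gamma> \<tau> s))"
    if \<rho>: "0 < \<rho>" "\<rho> \<le> r" for \<rho>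
  proof -
    \<comment> \<open>The star of radius \<open>\<rho>\<close> contains a neighbourhood of
      \<open>v\<close>, namely its star interior \<open>U\<close>. Continuity of
      \<open>\<gamma>\<close> at 0 brings \<open>\<gamma> u\<close> into it, and injectivity
      excludes \<open>v\<close>.\<close>
    define Q where "Q x \<longleftrightarrow> x = v \<or> (\<exists>\<tau>\<in>tangents \<Gamma> v. \<exists>s. 0 < s \<and> s < \<rho> \<and> x = along \<Gamma> \<tau> s)" for x
    define U where "U = {x \<in> points \<Gamma>. Q x \<and> (\<forall>\<tau>\<in>tangents \<Gamma> x. \<forall>\<^sub>F s in at_right 0. Q (along \<Gamma> \<tau> s))}"
    have "\<forall>\<^sub>F s in at_right 0. Q (along \<Gamma> \<tau> s)" if "\<tau> \<in> tangents \<Gamma> v" for \<tau>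
      unfolding eventually_at_right_0 Q_def using that \<rho> by blast
    then have vU: "v \<in> U" using v by (auto simp: Q_def U_def)
    have "openin CT U" unfolding U_def by (rule openin_star_interior)
    then have "openin (top_of_set {0..1}) {u \<in> {0..1}. \<gamma> u \<in> U}"
      using openin_continuous_map_preimage[OF cont, of U] by simp
    then have "\<forall>x\<in>{u \<in> {0..1}. \<gamma> u \<in> U}. \<exists>e>0. \<forall>x'\<in>{0..1}. dist x' x < e \<longrightarrow> x' \<in> {u \<in> {0..1}. \<gamma> u \<in> U}"
      unfolding openin_euclidean_subtopology_iff by blast
    moreover have "0 \<in> {u \<in> {0..1::real}. \<gamma> u \<in> U}" using vU \<gamma>0 by simp
    ultimately obtain \<eta> where \<eta>: "\<eta> > 0" "\<forall>u\<in>{0..1}. dist u 0 < \<eta> \<longrightarrow> \<gamma> u \<in> U"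
      by blast
    have "\<exists>\<tau>\<in>tangents \<Gamma> v. \<exists>s. 0 < s \<and> s < \<rho> \<and> \<gamma> u = along \<Gamma> \<tau> s" if "0 < u" "u < min \<eta> 1" for u
    proof -
      have "\<gamma> u \<noteq> v" using inj_onD[OF inj, of u 0] that \<gamma>0 by auto
      moreover have "Q (\<gamma> u)" using \<eta>(2) that by (auto simp: U_def)
      ultimately show ?thesis by (auto simp: Q_def)
    qed
    then show ?thesis using \<eta>(1) by (intro exI[of _ "min \<eta> 1"]) auto
  qed
  obtain \<eta> where \<eta>: "\<eta> > 0" "\<eta> \<le> 1"
    "\<forall>u. 0 < u \<and> u < \<eta> \<longrightarrow> (\<exists>\<tau>\<in>tangents \<Gamma> v. \<exists>s. 0 < s \<and> s < r \<and> \<gamma> u = along \<Gamma> \<tau> s)"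
    using near[of r] r by auto
  define C where "C = \<gamma> ` {0<..<\<eta>}"
  have C: "connectedin CT C"
    unfolding C_def
    by (rule connectedin_continuous_map_image[OF cont])
      (use \<eta> in \<open>auto simp: connectedin_subtopology\<close>)
  have piece: "openin CT (along \<Gamma> \<tau> ` {a<..<b})" if "\<tau> \<in> tangents \<Gamma> v" "0 \<le> a" "b \<le> r" for \<tau> a b
    by (rule openin_ray_piece[OF tangents_directions[OF that(1)] that(2)])
      (use that star_radius_inner[OF sr, of "fst \<tau>" "fst (snd \<tau>)" "snd (snd \<tau>)"] in \<open>auto simp: along_def split: prod.splits\<close>)
  obtain \<tau> s0 where \<tau>: "\<tau> \<in> tangents \<Gamma> v" and s0: "0 < s0" "s0 < r" "\<gamma> (\<eta>/2) = along \<Gamma> \<tau> s0"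
    using \<eta>(3)[rule_format, of "\<eta>/2"] \<eta>(1) by auto
  have uC: "along \<Gamma> \<tau> s0 \<in> C" unfolding s0(3)[symmetric] C_def using \<eta> by auto
  have Cray: "C \<subseteq> along \<Gamma> \<tau> ` {0<..<r}"
  proof (rule ccontr)
    assume "\<not> C \<subseteq> along \<Gamma> \<tau> ` {0<..<r}"
    then obtain y where y: "y \<in> C" "y \<notin> along \<Gamma> \<tau> ` {0<..<r}" by blast
    let ?O = "\<Union>\<tau>'\<in>tangents \<Gamma> v - {\<tau>}. along \<Gamma> \<tau>' ` {0<..<r}"
    have "C \<subseteq> along \<Gamma> \<tau> ` {0<..<r} \<union> ?O"
    proof
      fix z assume "z \<in> C"
      then obtain u where "0 < u \<and> u < \<eta>" "z = \<gamma> u" by (auto simp: C_def)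
      then obtain \<tau>' s' where "\<tau>' \<in> tangents \<Gamma> v" "0 < s'" "s' < r" "z = along \<Gamma> \<tau>' s'"
        using \<eta>(3) by blast
      then have "\<tau>' \<in> tangents \<Gamma> v" "z \<in> along \<Gamma> \<tau>' ` {0<..<r}" by auto
      then show "z \<in> along \<Gamma> \<tau> ` {0<..<r} \<union> ?O" by blast
    qed
    moreover have "openin CT ?O" by (intro openin_Union) (auto intro!: piece)
    moreover have "along \<Gamma> \<tau> ` {0<..<r} \<inter> ?O \<inter> C = {}"
    proof -
      have False if "z \<in> along \<Gamma> \<tau> ` {0<..<r}" "z \<in> ?O" for z
      proof -
        from that(2) obtain \<tau>' where \<tau>': "\<tau>' \<in> tangents \<Gamma> v" "\<tau>' \<noteq> \<tau>" "z \<in> along \<Gamma> \<tau>' ` {0<..<r}"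
          by blast
        obtain s s' where "z = along \<Gamma> \<tau> s" "z = along \<Gamma> \<tau>' s'"
          "0 < s" "s < r" "0 < s'" "s' < r"
          using \<open>z \<in> along \<Gamma> \<tau> ` {0<..<r}\<close> \<tau>'(3) unfolding mem_ray by blast
        then show False using star_radius_inj(1)[OF sr \<tau> \<tau>'(1), of s s'] \<tau>'(2) by simp
      qed
      then show ?thesis by blast
    qed
    moreover have "?O \<inter> C \<noteq> {}"
      using UnE[OF subsetD[OF calculation(1) y(1)]] y by (metis (lifting) disjoint_iff)
    moreover have "along \<Gamma> \<tau> ` {0<..<r} \<inter> C \<noteq> {}"
    proof -
      have "along \<Gamma> \<tau> s0 \<in> along \<Gamma> \<tau> ` {0<..<r}" using s0 by simp
      then show ?thesis using uC by blast
    qed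
    moreover have "openin CT (along \<Gamma> \<tau> ` {0<..<r})" using piece[OF \<tau>, of 0 r] by simp
    ultimately show False
      using connectedinD[OF C, of "along \<Gamma> \<tau> ` {0<..<r}" ?O] by blast
  qed
  show ?thesis
  proof (intro bexI[of _ \<tau>] exI[of _ s0] conjI allI impI)
    fix s assume "0 < s \<and> s < s0"
    then have s: "0 < s" "s < s0" by auto
    \<comment> \<open>A missed point at distance \<open>s\<close> would split the connected set
      \<open>C\<close> into an inner and an outer open piece. The inner one is nonempty by
      \<open>near\<close> with radius \<open>s\<close>.\<close>
    have "along \<Gamma> \<tau> s \<in> C"
    proof (rule ccontr)
      assume nC: "along \<Gamma> \<tau> s \<notin> C"
      have "C \<subseteq> along \<Gamma> \<tau> ` {0<..<s} \<union> along \<Gamma> \<tau> ` {s<..<r}"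
      proof
        fix y assume y: "y \<in> C"
        then have "y \<in> along \<Gamma> \<tau> ` {0<..<r}" using Cray by blast
        then obtain s' where "0 < s'" "s' < r" "y = along \<Gamma> \<tau> s'" unfolding mem_ray by blast
        moreover then have "s' \<noteq> s" using nC y by auto
        ultimately show "y \<in> along \<Gamma> \<tau> ` {0<..<s} \<union> along \<Gamma> \<tau> ` {s<..<r}" by fastforce
      qed
      moreover have "along \<Gamma> \<tau> ` {0<..<s} \<inter> along \<Gamma> \<tau> ` {s<..<r} \<inter> C = {}"
      proof -
        have False if "z \<in> along \<Gamma> \<tau> ` {0<..<s}" "z \<in> along \<Gamma> \<tau> ` {s<..<r}" for z
        proof -
          obtain a b where "z = along \<Gamma> \<tau> a" "z = along \<Gamma> \<tau> b"
            "0 < a" "a < s" "s < b" "b < r"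
            using \<open>z \<in> along \<Gamma> \<tau> ` {0<..<s}\<close> \<open>z \<in> along \<Gamma> \<tau> ` {s<..<r}\<close> unfolding mem_ray by blast
          then show False using star_radius_inj(2)[OF sr \<tau> \<tau>, of a b] s s0 by simp
        qed
        then show ?thesis by blast
      qed
      moreover have "along \<Gamma> \<tau> s0 \<in> along \<Gamma> \<tau> ` {s<..<r}" using s s0 by simp
      then have "along \<Gamma> \<tau> ` {s<..<r} \<inter> C \<noteq> {}" using uC by blast
      moreover have "along \<Gamma> \<tau> ` {0<..<s} \<inter> C \<noteq> {}"
      proof -
        obtain \<eta>' where \<eta>': "\<eta>' > 0" "\<forall>u. 0 < u \<and> u < \<eta>' \<longrightarrow> (\<exists>\<tau>\<in>tangents \<Gamma> v. \<exists>s'. 0 < s' \<and> s' < s \<and> \<gamma> u = along \<Gamma> \<tau> s')"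
          using near[of s] s s0 by auto
        define u where "u = min (\<eta>/2) (\<eta>'/2)"
        have u: "0 < u" "u < \<eta>" "u < \<eta>'" using \<eta> \<eta>' by (auto simp: u_def)
        then obtain \<tau>' s' where 1: "\<tau>' \<in> tangents \<Gamma> v" "0 < s'" "s' < s" "\<gamma> u = along \<Gamma> \<tau>' s'" using \<eta>' by blast
        have uC: "\<gamma> u \<in> C" using u by (auto simp: C_def)
        then have "\<gamma> u \<in> along \<Gamma> \<tau> ` {0<..<r}" using Cray by blast
        then obtain s'' where "0 < s''" "s'' < r" "\<gamma> u = along \<Gamma> \<tau> s''" unfolding mem_ray by blast
        then have "\<tau>' = \<tau>" using star_radius_inj(1)[OF sr 1(1) \<tau>, of s' s''] 1 s s0 by simp
        then have "\<gamma> u \<in> along \<Gamma> \<tau> ` {0<..<s}" using 1 by simp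
        then show ?thesis using uC by blast
      qed
      ultimately show False
        using connectedinD[OF C piece[OF \<tau>, of 0 s] piece[OF \<tau>, of s r]] s s0 by simp
    qed
    then show "along \<Gamma> \<tau> s \<in> \<gamma> ` {0<..<1}"
      using \<eta> by (auto simp: C_def)
  qed (use \<tau> s0 in auto)
qed

text \<open>A continuous left inverse defined on the whole curve makes the map an embedding. The
  length \<open>2 * \<delta>\<close> leaves room for this inverse to return to 0 before the edge
  ends.\<close>

lemma segment_along:
  assumes \<tau>: "\<tau> \<in> tangents \<Gamma> v" and \<delta>: "0 < \<delta>"
    and inn: "0 \<le> fst (snd \<tau>) + snd (snd \<tau>) * (2 * \<delta>)" "fst (snd \<tau>) + snd (snd \<tau>) * (2 * \<delta>) \<le> ell (fst \<tau>)"
  shows "segment_from \<Gamma> v (\<lambda>u. along \<Gamma> \<tau> (\<delta> * u))"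
proof -
  obtain e t \<sigma> where \<tau>e: "\<tau> = (e, t, \<sigma>)" by (cases \<tau>) auto
  have inn': "0 \<le> t + \<sigma> * (2 * \<delta>)" "t + \<sigma> * (2 * \<delta>) \<le> ell e" using inn by (auto simp: \<tau>e)
  note dir = tangents_directions[OF \<tau>, unfolded \<tau>e]
  note D = directionsD[OF dir]
  have bt: "0 < t + \<sigma> * s" "t + \<sigma> * s < ell e" if "0 < s" "s < 2 * \<delta>" for s
    using along_between[OF dir inn' that] by auto
  \<comment> \<open>A tent: at distance \<open>\<delta> * u\<close> from \<open>v\<close> along the
    ray it has the value \<open>u\<close> for \<open>u\<close> up to 1, and it is 0 from distance
    \<open>2 * \<delta>\<close> on. It vanishes at both ends of the edge and hence extends by 0 to
    the curve.\<close>
  let ?h = "\<lambda>t'. max 0 (1 - \<bar>\<sigma> * (t' - t) / \<delta> - 1\<bar>)"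
  define c where "c x = (case x of Inner e' t' \<Rightarrow> if e' = e then ?h t' else 0 | Vertex _ \<Rightarrow> 0)" for x :: "('v, 'e) point"
  have h0: "?h 0 = 0" and h1: "?h (ell e) = 0"
    using D \<delta> inn' by (auto simp: max_def field_simps abs_if)
  have hc: "c (ep e t') = ?h t'" if "t' \<in> {0..ell e}" for t'
  proof -
    consider "t' = 0" | "t' = ell e" | "0 < t'" "t' < ell e" using \<open>t' \<in> {0..ell e}\<close> by fastforce
    then show ?thesis
      by cases (use h0 h1 D(1) in \<open>auto simp: c_def\<close>)
  qed
  have "continuous_map CT euclideanreal c"
    unfolding continuous_map_curve_iff
  proof
    fix e' assume e': "e' \<in> edges \<Gamma>"
    show "continuous_on {0..ell e'} (\<lambda>t. c (ep e' t))"
    proof (cases "e' = e")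
      case True
      have "continuous_on {0..ell e} (\<lambda>t'. c (ep e t')) \<longleftrightarrow> continuous_on {0..ell e} ?h"
        by (rule continuous_on_cong) (use hc in auto)
      moreover have "continuous_on {0..ell e} ?h"
        using \<delta> by (intro continuous_intros) auto
      ultimately show ?thesis using True by simp
    next
      case False
      then have "c (ep e' t') = 0" for t' by (auto simp: c_def edge_point_def)
      then show ?thesis by simp
    qed
  qed
  moreover have "c x \<in> {0..1}" for x by (auto simp: c_def split: point.splits)
  ultimately have cmap: "continuous_map CT (top_of_set {0..1}) c"
    by (simp add: continuous_map_in_subtopology image_subset_iff)
  have gmap: "continuous_map (top_of_set {0..1}) CT (\<lambda>u. along \<Gamma> \<tau> (\<delta> * u))"
  proof -
    have "t + \<sigma> * (\<delta> * u) \<in> {0..ell e}" if "u \<in> {0..1}" for u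
    proof (cases "u = 0")
      case False
      then show ?thesis using bt[of "\<delta> * u"] that \<delta> by (auto simp: less_imp_le mult_le_cancel_left1)
    qed (use D in auto)
    then have "continuous_map (top_of_set {0..1}) (top_of_set {0..ell e}) (\<lambda>u. t + \<sigma> * (\<delta> * u))"
      by (auto intro!: continuous_intros)
    from continuous_map_compose[OF this continuous_map_ep[OF D(1)]]
    show ?thesis by (simp add: \<tau>e o_def)
  qed
  have "c (along \<Gamma> \<tau> (\<delta> * u)) = u" if u: "u \<in> {0..1}" for u
  proof (cases "u = 0")
    case True
    then show ?thesis using hc[of t] D by (auto simp: \<tau>e)
  next
    case False
    then have "0 < \<delta> * u" "\<delta> * u < 2 * \<delta>" using u \<delta> by auto
    then have "t + \<sigma> * (\<delta> * u) \<in> {0..ell e}" using bt[of "\<delta> * u"] by auto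
    from hc[OF this] show ?thesis using u D(4) \<delta> by (auto simp: \<tau>e)
  qed
  then have "section_map (top_of_set {0..1}) CT (\<lambda>u. along \<Gamma> \<tau> (\<delta> * u))"
    unfolding section_map_def retraction_maps_def using gmap cmap by auto
  then show ?thesis
    using section_imp_embedding_map tangents_along[OF \<tau>] by (auto simp: segment_from_def)
qed

text \<open>Each segment of an admissible family covers the beginning of one leaving direction, and
  disjoint interiors force different directions. Conversely, short initial pieces of all leaving
  directions form an admissible family.\<close>

lemma out_degree_eq_card_leaving:
  assumes v: "v \<in> points \<Gamma>"
  shows "out_degree \<Gamma> X v = card (leaving \<Gamma> X v)"
proof -
  let ?fam = "\<lambda>S. finite S \<and> (\<forall>\<gamma>\<in>S. segment_from \<Gamma> v \<gamma> \<and> \<gamma> ` {0..1} \<subseteq> points \<Gamma> - (X - {v})) \<and>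
     pairwise (\<lambda>\<gamma> \<delta>. disjnt (\<gamma> ` {0<..<1}) (\<delta> ` {0<..<1})) S"
  have finL: "finite (leaving \<Gamma> X v)" by (simp add: leaving_def)
  have upper: "card S \<le> card (leaving \<Gamma> X v)" if S: "?fam S" for S
  proof -
    have "\<exists>\<tau>\<in>tangents \<Gamma> v. \<exists>d>0. \<forall>s. 0 < s \<and> s < d \<longrightarrow> along \<Gamma> \<tau> s \<in> \<gamma> ` {0<..<1}" if "\<gamma> \<in> S" for \<gamma>
      using segment_covers_ray[OF v, of \<gamma>] S that by simp
    then have "\<exists>T. \<forall>\<gamma>\<in>S. T \<gamma> \<in> tangents \<Gamma> v \<and>
        (\<exists>d>0. \<forall>s. 0 < s \<and> s < d \<longrightarrow> along \<Gamma> (T \<gamma>) s \<in> \<gamma> ` {0<..<1})"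
      by (intro bchoice) blast
    then obtain T where T: "\<And>\<gamma>. \<gamma> \<in> S \<Longrightarrow> T \<gamma> \<in> tangents \<Gamma> v"
      "\<And>\<gamma>. \<gamma> \<in> S \<Longrightarrow> \<exists>d>0. \<forall>s. 0 < s \<and> s < d \<longrightarrow> along \<Gamma> (T \<gamma>) s \<in> \<gamma> ` {0<..<1}"
      by blast
    have "T ` S \<subseteq> leaving \<Gamma> X v"
    proof
      fix \<tau> assume "\<tau> \<in> T ` S"
      then obtain \<gamma> where \<gamma>: "\<gamma> \<in> S" "\<tau> = T \<gamma>" by auto
      have "\<forall>\<^sub>F s in at_right 0. along \<Gamma> \<tau> s \<in> \<gamma> ` {0<..<1}"
        unfolding eventually_at_right_0 using T(2)[OF \<gamma>(1)] \<gamma> by blast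
      \<comment> \<open>The segments avoid only \<open>X - {v}\<close>; off \<open>v\<close> this
        means that they avoid \<open>X\<close>.\<close>
      moreover have "\<forall>\<^sub>F s in at_right 0. along \<Gamma> \<tau> s \<notin> {v}"
        by (rule eventually_along_notin_finite) (use T(1)[OF \<gamma>(1)] \<gamma> tangents_directions in auto)
      ultimately have "\<forall>\<^sub>F s in at_right 0. along \<Gamma> \<tau> s \<notin> X"
      proof eventually_elim
        case (elim s)
        then have "along \<Gamma> \<tau> s \<in> \<gamma> ` {0..1}" by auto
        then show ?case using S \<gamma> elim(2) by auto
      qed
      then show "\<tau> \<in> leaving \<Gamma> X v" using T(1)[OF \<gamma>(1)] \<gamma> by (simp add: leaving_def)
    qed
    moreover have "inj_on T S"
    proof (rule inj_onI, rule ccontr)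
      fix \<gamma> \<gamma>' assume *: "\<gamma> \<in> S" "\<gamma>' \<in> S" "T \<gamma> = T \<gamma>'" "\<gamma> \<noteq> \<gamma>'"
      obtain d where d: "d > 0" "\<forall>s. 0 < s \<and> s < d \<longrightarrow> along \<Gamma> (T \<gamma>) s \<in> \<gamma> ` {0<..<1}" using T(2)[OF *(1)] by blast
      obtain d' where d': "d' > 0" "\<forall>s. 0 < s \<and> s < d' \<longrightarrow> along \<Gamma> (T \<gamma>) s \<in> \<gamma>' ` {0<..<1}" using T(2)[OF *(2)] *(3) by auto
      have "along \<Gamma> (T \<gamma>) (min d d' / 2) \<in> \<gamma> ` {0<..<1} \<inter> \<gamma>' ` {0<..<1}"
        using d d' by auto
      moreover have "disjnt (\<gamma> ` {0<..<1}) (\<gamma>' ` {0<..<1})"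
        using S * by (auto simp: pairwise_def)
      ultimately show False by (auto simp: disjnt_def)
    qed
    ultimately show ?thesis using card_inj_on_le finL by blast
  qed
  have "\<exists>S. ?fam S \<and> card S = card (leaving \<Gamma> X v)"
  proof -
    obtain r where sr: "star_radius v r" using ex_star_radius by blast
    note r = star_radius_pos[OF sr]
    have "\<forall>\<^sub>F s in at_right 0. \<forall>\<tau>\<in>leaving \<Gamma> X v. along \<Gamma> \<tau> s \<notin> X"
      by (rule eventually_ball_finite[OF finL]) (auto simp: leaving_def)
    then obtain d where d: "d > 0" "\<forall>s. 0 < s \<and> s < d \<longrightarrow> (\<forall>\<tau>\<in>leaving \<Gamma> X v. along \<Gamma> \<tau> s \<notin> X)"
      by (auto simp: eventually_at_right_0)
    \<comment> \<open>The bound \<open>d/2\<close> keeps the pieces outside \<open>X\<close>;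
      \<open>r/3\<close> gives \<open>2 * \<delta> < r\<close>, as \<open>segment_along\<close>
      requires, and makes the pieces disjoint.\<close>
    define \<delta> where "\<delta> = min (d/2) (r/3)"
    have \<delta>: "0 < \<delta>" "\<delta> < d" "2 * \<delta> < r" using d r by (auto simp: \<delta>_def)
    define G where "G \<tau> = (\<lambda>u. along \<Gamma> \<tau> (\<delta> * u))" for \<tau>
    have Lt: "\<tau> \<in> tangents \<Gamma> v" if "\<tau> \<in> leaving \<Gamma> X v" for \<tau> using that by (simp add: leaving_def)
    have seg: "segment_from \<Gamma> v (G \<tau>)" if "\<tau> \<in> leaving \<Gamma> X v" for \<tau>
      unfolding G_def
      by (rule segment_along[OF Lt[OF that] \<delta>(1)])
        (use star_radius_inner[OF sr, of "fst \<tau>" "fst (snd \<tau>)" "snd (snd \<tau>)" "2 * \<delta>"] Lt[OF that] \<delta> in auto)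
    have im: "G \<tau> ` {0..1} \<subseteq> points \<Gamma> - (X - {v})" if "\<tau> \<in> leaving \<Gamma> X v" for \<tau>
    proof
      fix y assume "y \<in> G \<tau> ` {0..1}"
      then obtain u where u: "0 \<le> u" "u \<le> 1" "y = along \<Gamma> \<tau> (\<delta> * u)" by (auto simp: G_def)
      have "y \<in> points \<Gamma>" using u tangents_directions[OF Lt[OF that]] by simp
      moreover have "y \<notin> X - {v}"
      proof (cases "u = 0")
        case True
        then show ?thesis using u tangents_along[OF Lt[OF that]] by simp
      next
        case False
        then have "0 < \<delta> * u" "\<delta> * u < d" using u \<delta> by (auto simp: mult_le_cancel_left1 intro: le_less_trans[of _ \<delta>])
        then show ?thesis using d(2) that u by auto
      qed
      ultimately show "y \<in> points \<Gamma> - (X - {v})" by blast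
    qed
    have disj: "\<tau> = \<tau>'" if T: "\<tau> \<in> leaving \<Gamma> X v" "\<tau>' \<in> leaving \<Gamma> X v"
      "y \<in> G \<tau> ` {0<..<1}" "y \<in> G \<tau>' ` {0<..<1}" for \<tau> \<tau>' y
    proof -
      obtain u u' where u: "0 < u" "u < 1" "y = along \<Gamma> \<tau> (\<delta> * u)" "0 < u'" "u' < 1" "y = along \<Gamma> \<tau>' (\<delta> * u')"
        using T(3,4) by (auto simp: G_def)
      have "\<delta> * u < \<delta>" "\<delta> * u' < \<delta>" using u \<delta> by (auto simp: mult_less_cancel_left2)
      then have "\<delta> * u < r" "\<delta> * u' < r" using \<delta> by linarith+
      then show ?thesis using star_radius_inj(1)[OF sr Lt[OF T(1)] Lt[OF T(2)], of "\<delta> * u" "\<delta> * u'"] u \<delta> by auto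
    qed
    have ne: "G \<tau> (1/2) \<in> G \<tau> ` {0<..<1}" for \<tau> by auto
    have injG: "inj_on G (leaving \<Gamma> X v)"
    proof (rule inj_onI)
      fix \<tau> \<tau>' assume *: "\<tau> \<in> leaving \<Gamma> X v" "\<tau>' \<in> leaving \<Gamma> X v" "G \<tau> = G \<tau>'"
      show "\<tau> = \<tau>'" by (rule disj[OF *(1,2) ne]) (use ne[of \<tau>'] *(3) in simp)
    qed
    have "pairwise (\<lambda>\<gamma> \<delta>. disjnt (\<gamma> ` {0<..<1}) (\<delta> ` {0<..<1})) (G ` leaving \<Gamma> X v)"
    proof (rule pairwiseI)
      fix \<gamma> \<gamma>' assume "\<gamma> \<in> G ` leaving \<Gamma> X v" "\<gamma>' \<in> G ` leaving \<Gamma> X v" "\<gamma> \<noteq> \<gamma>'"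
      then obtain \<tau> \<tau>' where "\<tau> \<in> leaving \<Gamma> X v" "\<tau>' \<in> leaving \<Gamma> X v" "\<tau> \<noteq> \<tau>'" "\<gamma> = G \<tau>" "\<gamma>' = G \<tau>'" by blast
      then show "disjnt (\<gamma> ` {0<..<1}) (\<gamma>' ` {0<..<1})"
        unfolding disjnt_iff using disj by blast
    qed
    then have "?fam (G ` leaving \<Gamma> X v)" using seg im finL by auto
    moreover have "card (G ` leaving \<Gamma> X v) = card (leaving \<Gamma> X v)" by (rule card_image[OF injG])
    ultimately show ?thesis by blast
  qed
  then obtain S where "?fam S" "card S = card (leaving \<Gamma> X v)" by (elim exE conjE) blast
  then have mem: "card (leaving \<Gamma> X v) \<in> {card S | S. ?fam S}"
    by (intro CollectI exI[of _ S]) simp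
  have "{card S | S. ?fam S} \<subseteq> {..card (leaving \<Gamma> X v)}" using upper by blast
  then have "finite {card S | S. ?fam S}" by (rule finite_subset) simp
  then show ?thesis
    unfolding out_degree_def by (rule Max_eqI) (use upper mem in blast)+
qed

end

section \<open>Reduced divisors: uniqueness\<close>

context tropical
begin

section \<open>Connectedness and compactness of the curve\<close>

lemma connectedin_along:
  assumes "(e, t, \<sigma>) \<in> directions \<Gamma>" "0 \<le> t + \<sigma> * l" "t + \<sigma> * l \<le> ell e"
  shows "connectedin CT (along \<Gamma> (e, t, \<sigma>) ` {0..l})"
proof -
  note D = directionsD[OF assms(1)]
  have "continuous_map (top_of_set {0..l}) (top_of_set {0..ell e}) (\<lambda>s. t + \<sigma> * s)"
  proof -
    have "t + \<sigma> * s \<in> {0..ell e}" if "s \<in> {0..l}" for s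
      using D(4) that assms(2,3) D(2,3) by auto
    then show ?thesis by (auto intro!: continuous_intros)
  qed
  from continuous_map_compose[OF this continuous_map_ep[OF D(1)]]
  have "continuous_map (top_of_set {0..l}) CT (along \<Gamma> (e, t, \<sigma>))"
    by (simp add: o_def along_def)
  then show ?thesis
    by (rule connectedin_continuous_map_image) (simp add: connectedin_subtopology)
qed

text \<open>Connectedness of the graph as an induction principle. Propagation within an edge works
  both ways, so reachability in the symmetric closure carries \<open>Q\<close> to every
  vertex.\<close>

lemma points_edge_induct:
  assumes P: "P \<in> points \<Gamma>" "Q P"
    and step: "\<And>e t t'. e \<in> edges \<Gamma> \<Longrightarrow> t \<in> {0..ell e} \<Longrightarrow> t' \<in> {0..ell e} \<Longrightarrow>
      Q (ep e t) \<Longrightarrow> Q (ep e t')"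
    and x: "x \<in> points \<Gamma>"
  shows "Q x"
proof -
  have ends: "Q (Vertex (hd_e e)) \<longleftrightarrow> Q (Vertex (tl_e e))" if e: "e \<in> edges \<Gamma>" for e
    using step[OF e, of 0 "ell e"] step[OF e, of "ell e" 0] len_pos[OF e] e by auto
  have inner: "Q (Vertex (tl_e e)) \<longleftrightarrow> Q (ep e t)" if "e \<in> edges \<Gamma>" "t \<in> {0..ell e}" for e t
    using step[OF that(1), of 0 t] step[OF that(1), of t 0] len_pos[OF that(1)] that by auto
  obtain u where u: "u \<in> verts (model \<Gamma>)" "Q (Vertex u)"
    using P(1)
  proof (cases rule: points_cases)
    case (2 e t)
    then show ?thesis using P(2) inner[of e t] that[of "tl_e e"] by auto
  qed (use P that in auto)
  have "strongly_connected (with_proj (mk_symmetric (model \<Gamma>)))"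
    using tropical by (simp add: tropical_curve_def Digraph_Component.connected_def)
  then have reach: "u \<rightarrow>\<^sup>*\<^bsub>with_proj (mk_symmetric (model \<Gamma>))\<^esub> v" if "v \<in> verts (model \<Gamma>)" for v
    using u(1) that by (auto simp: strongly_connected_def mk_symmetric_def)
  have V: "Q (Vertex v)" if "v \<in> verts (model \<Gamma>)" for v
    using reachable_rtranclI[OF reach[OF that]]
  proof (induction rule: rtrancl_induct)
    case (step x y)
    then have "(x, y) \<in> parcs (mk_symmetric (model \<Gamma>))"
      by (auto simp: arcs_ends_conv)
    then show ?case using step(3) ends by (auto simp: mk_symmetric_def)
  qed (rule u)
  from x show ?thesis
  proof (cases rule: points_cases)
    case (2 e t)
    then show ?thesis using V[of "tl_e e"] inner[of e t] by auto
  qed (use V in auto)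
qed

lemma lin_equiv_iff:
  "lin_equiv \<Gamma> D D' \<longleftrightarrow> (\<exists>f. integral_germs \<Gamma> f \<and> (\<forall>x\<in>points \<Gamma>. D x = D' x + ord_at \<Gamma> f x) \<and>
     (\<forall>x. x \<notin> points \<Gamma> \<longrightarrow> D x = D' x))"
  unfolding lin_equiv_def rational_iff fun_eq_iff div_of_def by (rule ex_cong1) (force split: if_splits)

text \<open>The set of values is a finite union of continuous images of compact intervals and a
  finite set of vertex values.\<close>

lemma attains_max:
  assumes "integral_germs \<Gamma> g" "P \<in> points \<Gamma>"
  obtains x where "x \<in> points \<Gamma>" "\<And>y. y \<in> points \<Gamma> \<Longrightarrow> g y \<le> g x"
proof -
  have "compact ((\<lambda>t. g (ep e t)) ` {0..ell e})" if "e \<in> edges \<Gamma>" for e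
    using integral_germs_continuous[OF assms(1)] that
    by (intro compact_continuous_image compact_Icc) (auto simp: continuous_map_curve_iff)
  then have "compact (g ` Vertex ` verts (model \<Gamma>) \<union> (\<Union>e\<in>edges \<Gamma>. (\<lambda>t. g (ep e t)) ` {0..ell e}))"
    by (intro compact_Un[OF finite_imp_compact compact_UN]) auto
  moreover have "g ` points \<Gamma> = g ` Vertex ` verts (model \<Gamma>) \<union> (\<Union>e\<in>edges \<Gamma>. (\<lambda>t. g (ep e t)) ` {0..ell e})"
    (is "_ = ?R")
  proof
    show "g ` points \<Gamma> \<subseteq> ?R"
    proof
      fix y assume "y \<in> g ` points \<Gamma>"
      then obtain x where x: "x \<in> points \<Gamma>" "y = g x" by blast
      from x(1) show "y \<in> ?R"
      proof (cases rule: points_cases)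
        case (2 e t)
        then have "y = (\<lambda>t. g (ep e t)) t" "t \<in> {0..ell e}" using x by auto
        then show ?thesis using 2(2) by blast
      qed (use x in auto)
    qed
    show "?R \<subseteq> g ` points \<Gamma>"
      using ep_in_points by (fastforce simp: points_def[of \<Gamma>])
  qed
  ultimately have "compact (g ` points \<Gamma>)" by simp
  then obtain m where "m \<in> g ` points \<Gamma>" "\<forall>y\<in>g ` points \<Gamma>. y \<le> m"
    using compact_attains_sup[of "g ` points \<Gamma>"] assms(2) by blast
  then show thesis using that by auto
qed

section \<open>Slopes at extrema and the firing argument for reduced divisors\<close>

lemma slope_at_max:
  assumes g: "integral_germs \<Gamma> g" and \<tau>: "\<tau> \<in> tangents \<Gamma> x"
    and max: "\<And>y. y \<in> points \<Gamma> \<Longrightarrow> g y \<le> g x"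
  shows "slope g \<tau> \<le> 0"
proof -
  note d = tangents_directions[OF \<tau>]
  have "\<forall>\<^sub>F s in at_right 0. g (along \<Gamma> \<tau> s) \<le> g x"
    using max along_in_points[OF d] by simp
  then show ?thesis
    using outgoing_slope_le[OF has_slope_outgoing[OF g d] has_slope_const[of \<Gamma> "g x" \<tau>]]
      tangents_along[OF \<tau>] by simp
qed

lemma slope_at_min:
  assumes g: "integral_germs \<Gamma> g" and \<tau>: "\<tau> \<in> tangents \<Gamma> x"
    and min: "\<And>y. y \<in> points \<Gamma> \<Longrightarrow> g x \<le> g y"
  shows "0 \<le> slope g \<tau>"
  using slope_at_max[OF integral_germs_uminus[OF g] \<tau>] min
    outgoing_slope_uminus[OF g tangents_directions[OF \<tau>]] by simp

lemma slope_0_eventually: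
  assumes g: "integral_germs \<Gamma> g" and \<tau>: "\<tau> \<in> tangents \<Gamma> x" and "slope g \<tau> = 0"
  shows "\<forall>\<^sub>F s in at_right 0. g (along \<Gamma> \<tau> s) = g x"
  using has_slope_outgoing[OF g tangents_directions[OF \<tau>]] assms(3) tangents_along[OF \<tau>]
  by (simp add: has_slope_def)

text \<open>Otherwise a component of the maximum locus of \<open>g\<close> could be fired.\<close>

lemma reduced_max_at:
  assumes P: "P \<in> points \<Gamma>" and red: "is_reduced \<Gamma> P D1" and g: "integral_germs \<Gamma> g"
    and eff: "\<And>v. v \<in> points \<Gamma> \<Longrightarrow> v \<noteq> P \<Longrightarrow> 0 \<le> D1 v + ord_at \<Gamma> g v"
    and y: "y \<in> points \<Gamma>"
  shows "g y \<le> g P"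
proof (rule ccontr)
  assume "\<not> g y \<le> g P"
  obtain x0 where x0: "x0 \<in> points \<Gamma>" "\<And>y. y \<in> points \<Gamma> \<Longrightarrow> g y \<le> g x0"
    using attains_max[OF g P] by metis
  define X0 where "X0 = {x \<in> points \<Gamma>. g x = g x0}"
  have PX0: "P \<notin> X0" using \<open>\<not> g y \<le> g P\<close> x0(2)[OF y] by (auto simp: X0_def)
  have cX0: "closedin CT X0"
    using closedin_continuous_map_preimage[OF integral_germs_continuous[OF g], of "{g x0}"]
    by (simp add: X0_def)
  define X where "X = Collect (connected_component_of (subtopology CT X0) x0)"
  have x0X0: "x0 \<in> X0" using x0 by (simp add: X0_def)
  have "closedin (subtopology CT X0) X" unfolding X_def by (rule closedin_connected_component_of)
  then have cX: "closedin CT X" and XX0: "X \<subseteq> X0"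
    using closedin_trans_full[OF _ cX0] closedin_subset topspace_subtopology by fastforce+
  have conX: "connectedin CT X"
    using connectedin_connected_component_of[of "subtopology CT X0" x0]
    unfolding X_def connectedin_subtopology by blast
  have "x0 \<in> X"
    unfolding X_def using x0X0 x0(1) by (simp add: connected_component_of_refl)
  then have "\<exists>v \<in> CT frontier_of X. D1 v < int (Defs.out_degree \<Gamma> X v)"
    using red cX conX PX0 XX0 unfolding is_reduced_def by blast
  then obtain v where v: "v \<in> CT frontier_of X" "D1 v < int (Defs.out_degree \<Gamma> X v)" by blast
  have vX: "v \<in> X" using v(1) frontier_of_subset_closedin[OF cX] by blast
  then have vp: "v \<in> points \<Gamma>" "g v = g x0" "v \<noteq> P" using XX0 PX0 by (auto simp: X0_def)
  have vmax: "g y \<le> g v" if "y \<in> points \<Gamma>" for y using x0(2)[OF that] vp by simp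
  \<comment> \<open>If a leaving direction had slope 0, a short piece of it would be a connected
    part of the maximum locus attached to \<open>X\<close>, although \<open>X\<close> is a whole
    component. So the slope is negative, and by integrality at most -1.\<close>
  have sl: "slope g \<tau> \<le> (if \<tau> \<in> leaving \<Gamma> X v then -1 else 0)" if \<tau>: "\<tau> \<in> tangents \<Gamma> v" for \<tau>
  proof (cases "\<tau> \<in> leaving \<Gamma> X v")
    case True
    have "slope g \<tau> \<noteq> 0"
    proof
      assume "slope g \<tau> = 0"
      from slope_0_eventually[OF g \<tau> this]
      have "\<forall>\<^sub>F s in at_right 0. g (along \<Gamma> \<tau> s) = g v" .
      moreover obtain e t \<sigma> where \<tau>e: "\<tau> = (e, t, \<sigma>)" by (cases \<tau>) auto
      have d: "(e, t, \<sigma>) \<in> directions \<Gamma>" using tangents_directions[OF \<tau>] \<tau>e by simp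
      moreover have "\<forall>\<^sub>F s in at_right 0. along \<Gamma> \<tau> s \<notin> X" using True by (simp add: leaving_def)
      ultimately have "\<forall>\<^sub>F s in at_right 0. g (along \<Gamma> \<tau> s) = g v \<and> along \<Gamma> \<tau> s \<notin> X \<and>
          0 < t + \<sigma> * s \<and> t + \<sigma> * s < ell e"
        using eventually_along_inner[OF d] by (simp add: eventually_conj_iff)
      then obtain r where r: "r > 0" "\<forall>s. 0 < s \<and> s < r \<longrightarrow> g (along \<Gamma> \<tau> s) = g v \<and> along \<Gamma> \<tau> s \<notin> X \<and>
          0 < t + \<sigma> * s \<and> t + \<sigma> * s < ell e"
        unfolding eventually_at_right_0 by blast
      define l where "l = r / 2"
      have l: "0 < l" "l < r" using r(1) by (auto simp: l_def)
      have con: "connectedin CT (along \<Gamma> \<tau> ` {0..l})"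
        unfolding \<tau>e by (rule connectedin_along[OF d]) (use r l in auto)
      have "g (along \<Gamma> \<tau> s) = g v" if "s \<in> {0..l}" for s
        using r(2) l that tangents_along[OF \<tau>] by (cases "s = 0") auto
      then have "along \<Gamma> \<tau> ` {0..l} \<subseteq> X0"
        using vp along_in_points[OF tangents_directions[OF \<tau>]] by (auto simp: X0_def)
      then have "connectedin (subtopology CT X0) (X \<union> along \<Gamma> \<tau> ` {0..l})"
        using con conX XX0 vX tangents_along[OF \<tau>] l
        by (auto simp: connectedin_subtopology intro!: connectedin_Un bexI[of _ 0])
      moreover have "x0 \<in> X \<union> along \<Gamma> \<tau> ` {0..l}" using \<open>x0 \<in> X\<close> by simp
      ultimately have "X \<union> along \<Gamma> \<tau> ` {0..l} \<subseteq> X"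
        unfolding X_def using connected_component_of_maximal by metis
      moreover have "along \<Gamma> \<tau> l \<in> along \<Gamma> \<tau> ` {0..l}" using l by simp
      ultimately show False using r(2) l by blast
    qed
    then show ?thesis using slope_at_max[OF g \<tau> vmax] True by auto
  qed (use slope_at_max[OF g \<tau> vmax] in auto)
  have "ord_at \<Gamma> g v \<le> (\<Sum>\<tau>\<in>tangents \<Gamma> v. if \<tau> \<in> leaving \<Gamma> X v then -1 else 0)"
    unfolding ord_at_def by (rule sum_mono) (use sl in auto)
  also have "\<dots> = - int (card (leaving \<Gamma> X v))"
    by (simp add: sum.If_cases leaving_def Int_def)
  finally show False
    using eff[OF vp(1,3)] v(2) out_degree_eq_card_leaving[OF vp(1), of X] by simp
qed

text \<open>The difference function and its negative both attain their maximum at \<open>P\<close>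
  by \<open>reduced_max_at\<close>, so the difference function is constant.\<close>

lemma reduced_unique:
  assumes P: "P \<in> points \<Gamma>" and red: "is_reduced \<Gamma> P D1" "is_reduced \<Gamma> P D2"
    and equiv: "lin_equiv \<Gamma> D1 D" "lin_equiv \<Gamma> D2 D"
  shows "D1 = D2"
proof
  fix x
  obtain f1 f2 where f: "integral_germs \<Gamma> f1" "integral_germs \<Gamma> f2"
    "\<forall>x\<in>points \<Gamma>. D1 x = D x + ord_at \<Gamma> f1 x" "\<forall>x\<in>points \<Gamma>. D2 x = D x + ord_at \<Gamma> f2 x"
    and out: "\<forall>x. x \<notin> points \<Gamma> \<longrightarrow> D1 x = D x" "\<forall>x. x \<notin> points \<Gamma> \<longrightarrow> D2 x = D x"
    using equiv unfolding lin_equiv_iff by blast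
  define g where "g = (\<lambda>x. f2 x + - f1 x)"
  have g: "integral_germs \<Gamma> g"
    unfolding g_def by (intro integral_germs_add integral_germs_uminus f)
  have og: "ord_at \<Gamma> g x = D2 x - D1 x" if "x \<in> points \<Gamma>" for x
    unfolding g_def ord_at_add[OF f(2) integral_germs_uminus[OF f(1)]] ord_at_uminus[OF f(1)]
    using f that by simp
  have nn: "0 \<le> D1 v" "0 \<le> D2 v" if "v \<in> points \<Gamma>" "v \<noteq> P" for v
    using red that by (auto simp: is_reduced_def)
  have 1: "g y \<le> g P" if "y \<in> points \<Gamma>" for y
    by (rule reduced_max_at[OF P red(1) g _ that]) (use og nn in auto)
  have 2: "- g y \<le> - g P" if "y \<in> points \<Gamma>" for y
    by (rule reduced_max_at[OF P red(2) integral_germs_uminus[OF g] _ that])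
      (use og nn ord_at_uminus[OF g] in auto)
  have const: "g y = g P" if "y \<in> points \<Gamma>" for y using 1[OF that] 2[OF that] by simp
  show "D1 x = D2 x"
  proof (cases "x \<in> points \<Gamma>")
    case True
    have "slope g \<tau> = 0" if "\<tau> \<in> tangents \<Gamma> x" for \<tau>
      by (rule outgoing_slope_eq, rule has_slope_eventually_const)
        (use const along_in_points[OF tangents_directions[OF that]] in simp)
    then have "ord_at \<Gamma> g x = 0" by (simp add: ord_at_def)
    then show ?thesis using og[OF True] by simp
  qed (use out in auto)
qed

end

section \<open>The extremal function of an effective divisor\<close>

text \<open>Just to the right of 0 the largest constant term wins, and among equal constant terms
  the largest slope.\<close>

lemma Max_affine_germ:
  fixes C :: "int \<Rightarrow> real"
  assumes "finite S" "S \<noteq> {}"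
  obtains m where "m \<in> S" "C m = Max ((\<lambda>k. C k) ` S)"
    "\<forall>\<^sub>F s in at_right 0. Max ((\<lambda>k. C k + of_int k * s) ` S) = C m + of_int m * s"
proof -
  define M where "M = Max ((\<lambda>k. C k) ` S)"
  define m where "m = Max {k \<in> S. C k = M}"
  have "M \<in> (\<lambda>k. C k) ` S" unfolding M_def using assms by (intro Max_in) auto
  then have "{k \<in> S. C k = M} \<noteq> {}" by auto
  then have "m \<in> {k \<in> S. C k = M}" unfolding m_def using assms by (intro Max_in) auto
  then have m: "m \<in> S" "C m = M" by auto
  have "\<forall>\<^sub>F s in at_right 0. C k + of_int k * s \<le> C m + of_int m * s" if k: "k \<in> S" for k
  proof (cases "C k = M")
    case True
    then have km: "k \<le> m" unfolding m_def using k assms by (intro Max_ge) auto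
    show ?thesis
      using eventually_at_right_less[of "0::real"]
      by eventually_elim (simp add: True m km mult_right_mono)
  next
    case False
    moreover have "C k \<le> M" unfolding M_def using k assms by (intro Max_ge) auto
    ultimately have lt: "C k < M" by simp
    \<comment> \<open>A line with a smaller constant term cannot make up the deficit before
      \<open>d\<close>, as the difference of the two slopes is below the denominator.\<close>
    define d where "d = (M - C k) / (\<bar>of_int k\<bar> + \<bar>of_int m\<bar> + 1)"
    have "d > 0" using lt by (auto simp: d_def)
    have "C k + of_int k * s \<le> C m + of_int m * s" if s: "0 < s" "s < d" for s
    proof -
      have "of_int k * s - of_int m * s \<le> (\<bar>of_int k\<bar> + \<bar>of_int m\<bar> + 1) * s"
        unfolding left_diff_distrib[symmetric] using s by (intro mult_right_mono) auto
      also have "\<dots> \<le> M - C k"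
        using s by (simp add: d_def pos_less_divide_eq mult.commute)
      finally show ?thesis using m by simp
    qed
    then show ?thesis unfolding eventually_at_right_0 using \<open>d > 0\<close> by blast
  qed
  then have "\<forall>\<^sub>F s in at_right 0. \<forall>k\<in>S. C k + of_int k * s \<le> C m + of_int m * s"
    by (intro eventually_ball_finite assms) auto
  then have "\<forall>\<^sub>F s in at_right 0. Max ((\<lambda>k. C k + of_int k * s) ` S) = C m + of_int m * s"
    by eventually_elim (rule Max_eqI, use m assms in auto)
  then show thesis using that m M_def by blast
qed

context tropical
begin

text \<open>Away from these points every member of \<open>rfun D\<close> has nonnegative order and
  is therefore convex along the edge.\<close>

definition special :: "(('v, 'e) point \<Rightarrow> int) \<Rightarrow> ('v, 'e) point set" where
  "special D = Vertex ` verts (model \<Gamma>) \<union> {x. D x \<noteq> 0}"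

text \<open>The tropical semimodule usually written \<open>R(D)\<close>, whose members parametrize
  the complete linear system.\<close>

definition rfun :: "(('v, 'e) point \<Rightarrow> int) \<Rightarrow> (('v, 'e) point \<Rightarrow> real) set" where
  "rfun D = {f. integral_germs \<Gamma> f \<and> (\<forall>x\<in>points \<Gamma>. 0 \<le> D x + ord_at \<Gamma> f x)}"

lemma finite_special: "divisor \<Gamma> D \<Longrightarrow> finite (special D)"
  by (simp add: special_def divisor_def)

lemma special_points: "divisor \<Gamma> D \<Longrightarrow> special D \<subseteq> points \<Gamma>"
  by (auto simp: special_def divisor_def points_def)

lemma next_special:
  assumes W: "finite W" "Vertex ` verts (model \<Gamma>) \<subseteq> W" and \<tau>: "(e, t, \<sigma>) \<in> directions \<Gamma>"
  obtains l where "0 < l" "0 \<le> t + \<sigma> * l" "t + \<sigma> * l \<le> ell e" "along \<Gamma> (e, t, \<sigma>) l \<in> W"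
    "\<And>s. 0 < s \<Longrightarrow> s < l \<Longrightarrow> along \<Gamma> (e, t, \<sigma>) s \<notin> W"
proof -
  note D = directionsD[OF \<tau>]
  define L where "L = (if \<sigma> = 1 then ell e - t else t)"
  have L: "0 < L" "t + \<sigma> * L = (if \<sigma> = 1 then ell e else 0)" using D by (auto simp: L_def)
  have sL: "0 \<le> t + \<sigma> * s" "t + \<sigma> * s \<le> ell e" if "0 \<le> s" "s \<le> L" for s
    using D that by (auto simp: L_def)
  have sL': "0 < t + \<sigma> * s" "t + \<sigma> * s < ell e" if "0 < s" "s < L" for s
    using D that by (auto simp: L_def)
  define A where "A = {l. 0 < l \<and> l \<le> L \<and> along \<Gamma> (e, t, \<sigma>) l \<in> W}"
  have "A \<subseteq> {L} \<union> (\<lambda>s. Inner e (t + \<sigma> * s)) -` W"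
  proof
    fix s assume s: "s \<in> A"
    show "s \<in> {L} \<union> (\<lambda>s. Inner e (t + \<sigma> * s)) -` W"
      using s sL'[of s] by (cases "s = L") (auto simp: A_def)
  qed
  moreover have "inj (\<lambda>s. Inner e (t + \<sigma> * s))" using D(4) by (auto intro!: injI)
  then have "finite ((\<lambda>s. Inner e (t + \<sigma> * s)) -` W)" by (rule finite_vimageI[OF W(1)])
  ultimately have finA: "finite A" by (meson finite.emptyI finite.insertI finite_UnI finite_subset)
  have "along \<Gamma> (e, t, \<sigma>) L \<in> Vertex ` verts (model \<Gamma>)"
    using L D(1) by auto
  then have "L \<in> A" using W L by (auto simp: A_def)
  then have MA: "Min A \<in> A" using finA by (intro Min_in) auto
  show thesis
  proof (rule that[of "Min A"])
    fix s assume s: "0 < s" "s < Min A"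
    then have "s \<notin> A" using finA Min_le by fastforce
    then show "along \<Gamma> (e, t, \<sigma>) s \<notin> W" using s MA by (auto simp: A_def)
  qed (use MA sL[of "Min A"] in \<open>auto simp: A_def\<close>)
qed

section \<open>Slope bounds and support lines for the functions of a linear system\<close>

lemma rfun_D:
  assumes "f \<in> rfun D"
  shows "integral_germs \<Gamma> f" "x \<in> points \<Gamma> \<Longrightarrow> 0 \<le> D x + ord_at \<Gamma> f x"
  using assms by (auto simp: rfun_def)

lemma rfun_ord_nonneg:
  assumes "f \<in> rfun D" "x \<in> points \<Gamma>" "x \<notin> special D"
  shows "0 \<le> ord_at \<Gamma> f x"
  using rfun_D(2)[OF assms(1,2)] assms(3) by (simp add: special_def)

lemma rfun_support_line:
  assumes f: "f \<in> rfun D" and \<tau>: "(e, t, \<sigma>) \<in> directions \<Gamma>"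
    and l: "0 \<le> t + \<sigma> * l" "t + \<sigma> * l \<le> ell e"
    and ns: "\<And>s. 0 < s \<Longrightarrow> s < l \<Longrightarrow> along \<Gamma> (e, t, \<sigma>) s \<notin> special D"
    and s: "0 \<le> s" "s \<le> l"
  shows "f (along \<Gamma> (e, t, \<sigma>) 0) + of_int (slope f (e, t, \<sigma>)) * s \<le> f (along \<Gamma> (e, t, \<sigma>) s)"
  by (rule along_support_line[OF rfun_D(1)[OF f] \<tau> l _ s])
    (use rfun_ord_nonneg[OF f] ns along_in_points[OF \<tau>] in blast)

text \<open>
  A large outgoing slope forces many special points at which the function is larger. This bounds the
  outgoing slopes, since there are only finitely many special points.
\<close>

lemma rfun_slope_bounds:
  assumes D: "divisor \<Gamma> D" "effective D"
  obtains K where "\<And>f \<tau>. f \<in> rfun D \<Longrightarrow> \<tau> \<in> directions \<Gamma> \<Longrightarrow> \<bar>slope f \<tau>\<bar> \<le> K"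
proof -
  let ?V = "special D"
  have finV: "finite ?V" by (rule finite_special[OF D(1)])
  \<comment> \<open>Bounds the number of directions at every point of the curve: the sum takes care
    of the special points, the summand 2 of all others.\<close>
  define n where "n = (\<Sum>x\<in>?V. card (tangents \<Gamma> x)) + 2"
  define N where "N = int n"
  define d where "d = (\<Sum>x\<in>?V. D x)"
  have D0: "0 \<le> D x" for x using D(2) by (simp add: effective_def)
  have cardn: "card (tangents \<Gamma> x) \<le> n" if x: "x \<in> points \<Gamma>" for x
  proof (cases "x \<in> ?V")
    case True
    then show ?thesis unfolding n_def using member_le_sum[OF True, of "\<lambda>x. card (tangents \<Gamma> x)"] finV by simp
  next
    case False
    from x show ?thesis
    proof (cases rule: points_cases)
      case (2 e t)
      then have "card (tangents \<Gamma> x) \<le> 2" by (simp add: tangents_inner card_insert_if)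
      then show ?thesis by (simp add: n_def)
    qed (use False in \<open>auto simp: special_def\<close>)
  qed
  then have cardN: "int (card (tangents \<Gamma> x)) \<le> N" if "x \<in> points \<Gamma>" for x
    using that by (simp add: N_def)
  have Dd: "D x \<le> d" for x
  proof (cases "x \<in> ?V")
    case True
    then show ?thesis unfolding d_def using member_le_sum[OF True, of D] finV D0 by simp
  next
    case False
    then show ?thesis unfolding d_def by (simp add: special_def sum_nonneg D0)
  qed
  have "N \<ge> 0" by (simp add: N_def)
  have "d \<ge> 0" unfolding d_def by (simp add: sum_nonneg D0)
  \<comment> \<open>A function that climbs to a special point with slope at least
    \<open>B (Suc k)\<close> has order at least \<open>- d\<close> there. With at most
    \<open>N\<close> directions available, one of them must go on with slope at least
    \<open>B k\<close>.\<close>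
  define B where "B = rec_nat (1::int) (\<lambda>_ b. N * b + d + 1)"
  have B0: "B 0 = 1" and BS: "B (Suc k) = N * B k + d + 1" for k by (simp_all add: B_def)
  have B1: "B k \<ge> 1" for k
    by (induction k) (use \<open>N \<ge> 0\<close> \<open>d \<ge> 0\<close> in \<open>simp_all add: B0 BS\<close>)
  have claim: "k \<le> card {w \<in> ?V. f w > f (along \<Gamma> \<tau> 0)}"
    if "f \<in> rfun D" "\<tau> \<in> directions \<Gamma>" "B k \<le> slope f \<tau>" for f \<tau> k
    using that
  proof (induction k arbitrary: \<tau>)
    case (Suc k)
    note f = rfun_D[OF Suc.prems(1)]
    obtain e t \<sigma> where \<tau>e: "\<tau> = (e, t, \<sigma>)" by (cases \<tau>) auto
    note \<tau> = Suc.prems(2)[unfolded \<tau>e]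
    let ?x = "along \<Gamma> \<tau> 0" and ?m = "slope f \<tau>"
    obtain l where l: "0 < l" "0 \<le> t + \<sigma> * l" "t + \<sigma> * l \<le> ell e" "along \<Gamma> (e, t, \<sigma>) l \<in> ?V"
      "\<And>s. 0 < s \<Longrightarrow> s < l \<Longrightarrow> along \<Gamma> (e, t, \<sigma>) s \<notin> ?V"
      using next_special[OF finV _ \<tau>] unfolding special_def by blast
    let ?w = "along \<Gamma> \<tau> l" and ?\<rho> = "(e, t + \<sigma> * l, -\<sigma>)"
    have \<rho>: "?\<rho> \<in> directions \<Gamma>" by (rule direction_end[OF \<tau> l(2,3,1)])
    have \<rho>w: "along \<Gamma> ?\<rho> 0 = ?w" and \<rho>s: "along \<Gamma> ?\<rho> s = along \<Gamma> \<tau> (l - s)" for s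
      by (simp_all add: \<tau>e algebra_simps)
    have up: "f ?x + of_int ?m * l \<le> f ?w"
      unfolding \<tau>e by (rule rfun_support_line[OF Suc.prems(1) \<tau> l(2,3,5)]) (use l in auto)
    \<comment> \<open>Convexity between neighbouring special points, now read from the far end.
      Together with \<open>up\<close> it shows that the slope back from \<open>?w\<close> is at most
      \<open>- ?m\<close>.\<close>
    have "f (along \<Gamma> ?\<rho> 0) + of_int (slope f ?\<rho>) * l \<le> f (along \<Gamma> ?\<rho> l)"
    proof (rule rfun_support_line[OF Suc.prems(1) \<rho>])
      show "along \<Gamma> ?\<rho> s \<notin> ?V" if "0 < s" "s < l" for s
        unfolding \<rho>s \<tau>e using l(5)[of "l - s"] that by simp
    qed (use directionsD[OF \<tau>] l in auto)
    then have "f ?w + of_int (slope f ?\<rho>) * l \<le> f ?x" unfolding \<rho>w \<rho>s by simp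
    with up have "(of_int (slope f ?\<rho>) + of_int ?m) * l \<le> 0" by (simp add: algebra_simps)
    then have "of_int (slope f ?\<rho>) + of_int ?m \<le> (0::real)" using l(1) by (simp add: mult_le_0_iff)
    then have \<rho>m: "slope f ?\<rho> \<le> - ?m" by linarith
    have m1: "?m \<ge> 1" using Suc.prems(3) B1[of "Suc k"] by linarith
    have "0 < of_int ?m * l" using m1 l(1) by simp
    with up have fxw: "f ?x < f ?w" by linarith
    have wV: "?w \<in> ?V" using l(4) \<tau>e by simp
    then have wp: "?w \<in> points \<Gamma>" using special_points[OF D(1)] by blast
    have "\<exists>\<tau>'\<in>tangents \<Gamma> ?w. B k \<le> slope f \<tau>'"
    proof (rule ccontr)
      assume "\<not> ?thesis"
      then have small: "slope f \<tau>' \<le> B k" if "\<tau>' \<in> tangents \<Gamma> ?w" for \<tau>' using that by force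
      have \<rho>t: "?\<rho> \<in> tangents \<Gamma> ?w" using \<rho> \<rho>w by (simp add: tangents_eq)
      have "ord_at \<Gamma> f ?w = slope f ?\<rho> + (\<Sum>\<tau>'\<in>tangents \<Gamma> ?w - {?\<rho>}. slope f \<tau>')"
        unfolding ord_at_def by (rule sum.remove[OF finite_tangents \<rho>t])
      also have "(\<Sum>\<tau>'\<in>tangents \<Gamma> ?w - {?\<rho>}. slope f \<tau>') \<le> (\<Sum>\<tau>'\<in>tangents \<Gamma> ?w - {?\<rho>}. B k)"
        by (rule sum_mono) (use small in auto)
      also have "\<dots> \<le> N * B k"
      proof -
        have "int (card (tangents \<Gamma> ?w - {?\<rho>})) \<le> N"
          using cardN[OF wp] card_Diff1_le[of "tangents \<Gamma> ?w" ?\<rho>] by linarith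
        then show ?thesis using B1[of k] by (simp add: mult_right_mono)
      qed
      finally have "ord_at \<Gamma> f ?w \<le> - ?m + N * B k" using \<rho>m by linarith
      moreover have "- d \<le> ord_at \<Gamma> f ?w" using f(2)[OF wp] Dd[of ?w] by linarith
      ultimately show False using Suc.prems(3) BS[of k] by linarith
    qed
    then obtain \<tau>' where \<tau>': "\<tau>' \<in> tangents \<Gamma> ?w" "B k \<le> slope f \<tau>'" by blast
    have "k \<le> card {w \<in> ?V. f w > f ?w}"
      using Suc.IH[OF Suc.prems(1) tangents_directions[OF \<tau>'(1)] \<tau>'(2)] tangents_along[OF \<tau>'(1)] by simp
    also have "\<dots> < card {w \<in> ?V. f w > f ?x}"
    proof (rule psubset_card_mono)
      show "{w \<in> ?V. f w > f ?w} \<subset> {w \<in> ?V. f w > f ?x}" using fxw wV by force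
    qed (use finV in auto)
    finally show ?case by simp
  qed simp
  \<comment> \<open>One step more than there are special points, so a slope above \<open>K\<close>
    contradicts \<open>claim\<close>.\<close>
  define K where "K = B (card ?V + 1)"
  have upper: "slope f \<tau> \<le> K" if "f \<in> rfun D" "\<tau> \<in> directions \<Gamma>" for f \<tau>
  proof (rule ccontr)
    assume "\<not> slope f \<tau> \<le> K"
    then have "card ?V + 1 \<le> card {w \<in> ?V. f w > f (along \<Gamma> \<tau> 0)}"
      using claim[OF that] by (simp add: K_def)
    also have "\<dots> \<le> card ?V" by (rule card_mono[OF finV]) auto
    finally show False by simp
  qed
  \<comment> \<open>A lower bound follows from the upper one: the order is at least
    \<open>- d\<close>, and the other directions at the point contribute at most
    \<open>N * K\<close>.\<close>
  have "\<bar>slope f \<tau>\<bar> \<le> d + (N + 1) * K" if f: "f \<in> rfun D" and \<tau>: "\<tau> \<in> directions \<Gamma>" for f \<tau>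
  proof -
    let ?x = "along \<Gamma> \<tau> 0"
    have xp: "?x \<in> points \<Gamma>" using \<tau> by simp
    have \<tau>t: "\<tau> \<in> tangents \<Gamma> ?x" using \<tau> by (simp add: tangents_eq)
    have K1: "K \<ge> 1" unfolding K_def by (rule B1)
    have "ord_at \<Gamma> f ?x = slope f \<tau> + (\<Sum>\<tau>'\<in>tangents \<Gamma> ?x - {\<tau>}. slope f \<tau>')"
      unfolding ord_at_def by (rule sum.remove[OF finite_tangents \<tau>t])
    also have "(\<Sum>\<tau>'\<in>tangents \<Gamma> ?x - {\<tau>}. slope f \<tau>') \<le> (\<Sum>\<tau>'\<in>tangents \<Gamma> ?x - {\<tau>}. K)"
      by (rule sum_mono) (use upper[OF f] tangents_directions in auto)
    also have "\<dots> \<le> N * K"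
    proof -
      have "int (card (tangents \<Gamma> ?x - {\<tau>})) \<le> N"
        using cardN[OF xp] card_Diff1_le[of "tangents \<Gamma> ?x" \<tau>] by linarith
      then show ?thesis using K1 by (simp add: mult_right_mono)
    qed
    finally have "ord_at \<Gamma> f ?x \<le> slope f \<tau> + N * K" by simp
    moreover have "- d \<le> ord_at \<Gamma> f ?x" using rfun_D(2)[OF f xp] Dd[of ?x] by linarith
    ultimately have "- (d + N * K) \<le> slope f \<tau>" by linarith
    moreover have "0 \<le> N * K" using K1 \<open>N \<ge> 0\<close> by simp
    ultimately show ?thesis using upper[OF f \<tau>] K1 \<open>d \<ge> 0\<close> by (simp add: algebra_simps abs_le_iff)
  qed
  then show thesis using that by blast
qed

text \<open>At an end of the edge the slope in the missing direction is an unspecified value, but it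
  is multiplied only by \<open>s = 0\<close>.\<close>

lemma slope_germs_edge:
  assumes f: "integral_germs \<Gamma> f" and e: "e \<in> edges \<Gamma>" and t: "t \<in> {0..ell e}"
  shows "\<exists>d>0. (\<forall>s. 0 \<le> s \<and> s < d \<and> t + s \<le> ell e \<longrightarrow>
      f (ep e (t + s)) = f (ep e t) + of_int (slope f (e, t, 1)) * s) \<and>
    (\<forall>s. 0 \<le> s \<and> s < d \<and> t - s \<ge> 0 \<longrightarrow>
      f (ep e (t - s)) = f (ep e t) + of_int (slope f (e, t, -1)) * s)"
proof -
  obtain d m n where d: "d > 0"
    "\<forall>s. 0 \<le> s \<and> s < d \<and> t + s \<le> ell e \<longrightarrow> f (ep e (t + s)) = f (ep e t) + of_int m * s"
    "\<forall>s. 0 \<le> s \<and> s < d \<and> t - s \<ge> 0 \<longrightarrow> f (ep e (t - s)) = f (ep e t) + of_int n * s"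
    using integral_germs_edge[OF f e t] by blast
  have "slope f (e, t, 1) = m" if "t < ell e"
    by (rule outgoing_slope_eq) (use d that in \<open>auto simp: has_slope_ex intro!: exI[of _ "min d (ell e - t)"]\<close>)
  moreover have "slope f (e, t, -1) = n" if "t > 0"
    by (rule outgoing_slope_eq) (use d that in \<open>auto simp: has_slope_ex intro!: exI[of _ "min d t"]\<close>)
  ultimately have "(\<forall>s. 0 \<le> s \<and> s < d \<and> t + s \<le> ell e \<longrightarrow>
      f (ep e (t + s)) = f (ep e t) + of_int (slope f (e, t, 1)) * s)"
    "(\<forall>s. 0 \<le> s \<and> s < d \<and> t - s \<ge> 0 \<longrightarrow>
      f (ep e (t - s)) = f (ep e t) + of_int (slope f (e, t, -1)) * s)"
    using d(2,3) t by (metis add.right_neutral add_le_same_cancel1 atLeastAtMost_iff linorder_not_le mult_zero_right order_le_less order_antisym_conv diff_zero diff_ge_0_iff_ge)+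
  then show ?thesis using d(1) by blast
qed

text \<open>The estimate holds on small intervals around each parameter by the germs there, and it
  adds up over adjacent intervals; bisection does the rest.\<close>

lemma slopes_bounded_lipschitz:
  assumes f: "integral_germs \<Gamma> f" and K: "\<And>\<tau>. \<tau> \<in> directions \<Gamma> \<Longrightarrow> \<bar>slope f \<tau>\<bar> \<le> K"
    and e: "e \<in> edges \<Gamma>" and ab: "0 \<le> a" "a \<le> b" "b \<le> ell e"
  shows "\<bar>f (ep e b) - f (ep e a)\<bar> \<le> of_int K * (b - a)"
proof -
  define Q where "Q a b \<longleftrightarrow> (0 \<le> a \<and> a \<le> b \<and> b \<le> ell e \<longrightarrow> \<bar>f (ep e b) - f (ep e a)\<bar> \<le> of_int K * (b - a))" for a b
  have "Q a b"
  proof (rule Bolzano[OF ab(2)])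
    fix a b c assume "Q a b" "Q b c" "a \<le> b" "b \<le> c"
    then show "Q a c" unfolding Q_def by (auto simp: algebra_simps abs_if split: if_splits)
  next
    fix t
    show "\<exists>d>0. \<forall>a b. a \<le> t \<and> t \<le> b \<and> b - a < d \<longrightarrow> Q a b"
    proof (cases "t \<in> {0..ell e}")
      case False
      then have "\<forall>a b. a \<le> t \<and> t \<le> b \<and> b - a < 1 \<longrightarrow> Q a b" by (auto simp: Q_def)
      then show ?thesis by (intro exI[of _ 1]) auto
    next
      case True
      obtain d where d: "d > 0"
        "\<forall>s. 0 \<le> s \<and> s < d \<and> t + s \<le> ell e \<longrightarrow> f (ep e (t + s)) = f (ep e t) + of_int (slope f (e, t, 1)) * s"
        "\<forall>s. 0 \<le> s \<and> s < d \<and> t - s \<ge> 0 \<longrightarrow> f (ep e (t - s)) = f (ep e t) + of_int (slope f (e, t, -1)) * s"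
        using slope_germs_edge[OF f e True] by blast
      have "Q a b" if *: "a \<le> t \<and> t \<le> b \<and> b - a < d" for a b
        unfolding Q_def
      proof
        assume ab: "0 \<le> a \<and> a \<le> b \<and> b \<le> ell e"
        have 1: "\<bar>f (ep e b) - f (ep e t)\<bar> \<le> of_int K * (b - t)"
        proof (cases "b = t")
          case False
          then have "(e, t, 1) \<in> directions \<Gamma>" using * ab e by (auto simp: directions_def)
          then have "\<bar>real_of_int (slope f (e, t, 1))\<bar> \<le> of_int K" using K by (metis of_int_abs of_int_le_iff)
          moreover have "f (ep e b) - f (ep e t) = of_int (slope f (e, t, 1)) * (b - t)"
            using d(2)[rule_format, of "b - t"] * ab by auto
          ultimately show ?thesis using * by (simp add: abs_mult mult_right_mono)
        qed simp
        have 2: "\<bar>f (ep e a) - f (ep e t)\<bar> \<le> of_int K * (t - a)"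
        proof (cases "a = t")
          case False
          then have "(e, t, -1) \<in> directions \<Gamma>" using * ab e by (auto simp: directions_def)
          then have "\<bar>real_of_int (slope f (e, t, -1))\<bar> \<le> of_int K" using K by (metis of_int_abs of_int_le_iff)
          moreover have "f (ep e a) - f (ep e t) = of_int (slope f (e, t, -1)) * (t - a)"
            using d(3)[rule_format, of "t - a"] * ab by auto
          ultimately show ?thesis using * by (simp add: abs_mult mult_right_mono)
        qed simp
        from 1 2 show "\<bar>f (ep e b) - f (ep e a)\<bar> \<le> of_int K * (b - a)"
          by (simp add: algebra_simps abs_le_iff)
      qed
      then show ?thesis using d(1) by blast
    qed
  qed
  then show ?thesis using ab by (simp add: Q_def)
qed

text \<open>A subgradient that is itself an outgoing slope of \<open>f\<close>, hence an integer
  subject to the bound of \<open>rfun_slope_bounds\<close>. The forward slope serves on both sides,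
  since by convexity the backward slope is at least its negative.\<close>

lemma rfun_two_sided_support:
  assumes f: "f \<in> rfun D" and \<tau>: "(e, t, \<sigma>) \<in> directions \<Gamma>"
    and l: "0 \<le> t + \<sigma> * l" "t + \<sigma> * l \<le> ell e"
    and ns: "\<And>s. 0 < s \<Longrightarrow> s < l \<Longrightarrow> along \<Gamma> (e, t, \<sigma>) s \<notin> special D"
    and s: "0 \<le> s" "s < l"
  obtains \<rho> where "\<rho> \<in> directions \<Gamma>"
    "\<And>u. 0 \<le> u \<Longrightarrow> u < l \<Longrightarrow>
      f (along \<Gamma> (e, t, \<sigma>) s) + of_int (slope f \<rho>) * (u - s) \<le> f (along \<Gamma> (e, t, \<sigma>) u)"
proof (cases "s = 0")
  case True
  show thesis
  proof (rule that[OF \<tau>])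
    fix u assume "0 \<le> u" "u < l"
    then show "f (along \<Gamma> (e, t, \<sigma>) s) + of_int (slope f (e, t, \<sigma>)) * (u - s) \<le> f (along \<Gamma> (e, t, \<sigma>) u)"
      using rfun_support_line[OF f \<tau> l ns, of u] True by simp
  qed
next
  case False
  then have s0: "0 < s" using s by simp
  note D = directionsD[OF \<tau>]
  let ?\<rho> = "(e, t + \<sigma> * s, \<sigma>)" and ?\<rho>' = "(e, t + \<sigma> * s, -\<sigma>)"
  note dirs = directions_between[OF \<tau> l s0 s(2)]
  note btw = along_between[OF \<tau> l s0 s(2)]
  have "0 \<le> ord_at \<Gamma> f (along \<Gamma> (e, t, \<sigma>) s)"
    using rfun_ord_nonneg[OF f along_in_points[OF \<tau>] ns[OF s0 s(2)]] .
  then have sum: "0 \<le> slope f ?\<rho> + slope f ?\<rho>'"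
    using ord_at_ep[OF D(1) btw D(4), of f] by simp
  have \<rho>u: "along \<Gamma> ?\<rho> u = along \<Gamma> (e, t, \<sigma>) (s + u)" "along \<Gamma> ?\<rho>' u = along \<Gamma> (e, t, \<sigma>) (s - u)" for u
    by (simp_all add: algebra_simps)
  show thesis
  proof (rule that[OF dirs(1)])
    fix u assume u: "0 \<le> u" "u < l"
    show "f (along \<Gamma> (e, t, \<sigma>) s) + of_int (slope f ?\<rho>) * (u - s) \<le> f (along \<Gamma> (e, t, \<sigma>) u)"
    proof (cases "s \<le> u")
      case True
      have "f (along \<Gamma> ?\<rho> 0) + of_int (slope f ?\<rho>) * (u - s) \<le> f (along \<Gamma> ?\<rho> (u - s))"
      proof (rule rfun_support_line[OF f dirs(1), of "l - s"])
        show "along \<Gamma> ?\<rho> u \<notin> special D" if "0 < u" "u < l - s" for u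
          unfolding \<rho>u using ns that s by auto
      qed (use l u True in \<open>auto simp: algebra_simps\<close>)
      then show ?thesis unfolding \<rho>u by simp
    next
      case False
      have "f (along \<Gamma> ?\<rho>' 0) + of_int (slope f ?\<rho>') * (s - u) \<le> f (along \<Gamma> ?\<rho>' (s - u))"
      proof (rule rfun_support_line[OF f dirs(2), of s])
        show "along \<Gamma> ?\<rho>' u \<notin> special D" if "0 < u" "u < s" for u
          unfolding \<rho>u using ns that s by auto
      qed (use D u False in \<open>auto simp: algebra_simps\<close>)
      then have "f (along \<Gamma> (e, t, \<sigma>) s) + of_int (slope f ?\<rho>') * (s - u) \<le> f (along \<Gamma> (e, t, \<sigma>) u)"
        unfolding \<rho>u by simp
      moreover have "- of_int (slope f ?\<rho>) * (s - u) \<le> of_int (slope f ?\<rho>') * (s - u)"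
        using sum False by (intro mult_right_mono) linarith+
      ultimately show ?thesis by (simp add: algebra_simps)
    qed
  qed
qed

text \<open>
  The extremal function \<open>F\<close> at \<open>P\<close> is the pointwise supremum of the functions \<open>f\<close> in \<open>rfun D\<close>
  with \<open>f P = 0\<close>. On a segment without special points it is a maximum of finitely many
  affine functions, one for each possible slope.
\<close>

lemma extremal_function:
  assumes D: "divisor \<Gamma> D" "effective D" and P: "P \<in> points \<Gamma>"
  obtains F where "F \<in> rfun D" "F P = 0"
    "\<And>f x. f \<in> rfun D \<Longrightarrow> f P = 0 \<Longrightarrow> x \<in> points \<Gamma> \<Longrightarrow> f x \<le> F x"
proof -
  obtain K where K: "\<And>f \<tau>. f \<in> rfun D \<Longrightarrow> \<tau> \<in> directions \<Gamma> \<Longrightarrow> \<bar>slope f \<tau>\<bar> \<le> K"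
    using rfun_slope_bounds[OF D] by blast
  define R where "R = {f \<in> rfun D. f P = 0}"
  have R: "f \<in> rfun D" "f P = 0" if "f \<in> R" for f using that by (auto simp: R_def)
  have "(\<lambda>_. 0) \<in> R"
    using D(2) by (auto simp: R_def rfun_def integral_germs_const ord_at_const effective_def)
  then have Rne: "R \<noteq> {}" by blast
  \<comment> \<open>All functions in \<open>R\<close> vanish at \<open>P\<close> and share the
    Lipschitz constant \<open>K\<close>, so a common upper bound spreads from \<open>P\<close> over
    the connected curve.\<close>
  have "\<exists>C. \<forall>f\<in>R. f x \<le> C" if "x \<in> points \<Gamma>" for x
  proof (rule points_edge_induct[OF P _ _ that])
    show "\<exists>C. \<forall>f\<in>R. f P \<le> C" by (intro exI[of _ 0] ballI) (simp add: R(2))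
  next
    fix e t t' assume e: "e \<in> edges \<Gamma>" "t \<in> {0..ell e}" "t' \<in> {0..ell e}" "\<exists>C. \<forall>f\<in>R. f (ep e t) \<le> C"
    then obtain C where C: "\<forall>f\<in>R. f (ep e t) \<le> C" by blast
    have "f (ep e t') \<le> C + of_int K * \<bar>t' - t\<bar>" if f: "f \<in> R" for f
    proof -
      note lip = slopes_bounded_lipschitz[OF rfun_D(1)[OF R(1)[OF f]] K[OF R(1)[OF f]] e(1)]
      show ?thesis
      proof (cases "t \<le> t'")
        case True
        then show ?thesis using lip[of t t'] e C[rule_format, OF f] by auto
      next
        case False
        then show ?thesis using lip[of t' t] e C[rule_format, OF f] by auto
      qed
    qed
    then show "\<exists>C. \<forall>f\<in>R. f (ep e t') \<le> C" by blast
  qed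
  then have bdd: "bdd_above ((\<lambda>f. f x) ` R)" if "x \<in> points \<Gamma>" for x
    using that by (auto simp: bdd_above_def)
  define F where "F x = (SUP f\<in>R. f x)" for x
  have Fge: "f x \<le> F x" if "f \<in> R" "x \<in> points \<Gamma>" for f x
    unfolding F_def by (rule cSUP_upper[OF that(1) bdd[OF that(2)]])
  have Fle: "F x \<le> c" if "\<And>f. f \<in> R \<Longrightarrow> f x \<le> c" for x c
    unfolding F_def by (rule cSUP_least[OF Rne that])
  have FP: "F P = 0"
  proof -
    have "(\<lambda>f. f P) ` R = (\<lambda>f. 0) ` R" by (rule image_cong) (use R(2) in auto)
    then show ?thesis unfolding F_def using Rne by simp
  qed
  have ray: "\<exists>l>0. 0 \<le> t + \<sigma> * l \<and> t + \<sigma> * l \<le> ell e \<and> (\<forall>s. 0 < s \<and> s < l \<longrightarrow> along \<Gamma> (e, t, \<sigma>) s \<notin> special D)"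
    if \<tau>: "(e, t, \<sigma>) \<in> directions \<Gamma>" for e t \<sigma>
  proof -
    have "Vertex ` verts (model \<Gamma>) \<subseteq> special D" by (simp add: special_def)
    then obtain l where "0 < l" "0 \<le> t + \<sigma> * l" "t + \<sigma> * l \<le> ell e"
      "\<And>s. 0 < s \<Longrightarrow> s < l \<Longrightarrow> along \<Gamma> (e, t, \<sigma>) s \<notin> special D"
      using next_special[OF finite_special[OF D(1)] _ \<tau>] by metis
    then show ?thesis by blast
  qed
  have germs: "\<exists>m. has_slope \<Gamma> F \<tau> m" if "\<tau> \<in> directions \<Gamma>" for \<tau>
  proof -
    obtain e t \<sigma> where \<tau>e: "\<tau> = (e, t, \<sigma>)" by (cases \<tau>) auto
    note \<tau> = that[unfolded \<tau>e]
    obtain l where l: "0 < l" "0 \<le> t + \<sigma> * l" "t + \<sigma> * l \<le> ell e"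
      "\<And>s. 0 < s \<Longrightarrow> s < l \<Longrightarrow> along \<Gamma> (e, t, \<sigma>) s \<notin> special D"
      using ray[OF \<tau>] by blast
    \<comment> \<open>Intercepts of the lines of slope \<open>k\<close> that lie below some member
      of \<open>R\<close> on the whole piece of length \<open>l\<close>; \<open>C k\<close> is the
      best of them.\<close>
    define Z where "Z k = {c. \<exists>f\<in>R. \<forall>u. 0 \<le> u \<and> u < l \<longrightarrow> c + of_int k * u \<le> f (along \<Gamma> \<tau> u)}" for k :: int
    define S where "S = {k \<in> {-K..K}. Z k \<noteq> {}}"
    define C where "C k = Sup (Z k)" for k
    have pts: "along \<Gamma> \<tau> u \<in> points \<Gamma>" for u using that by simp
    have Zb: "c + of_int k * u \<le> F (along \<Gamma> \<tau> u)" if "c \<in> Z k" "0 \<le> u" "u < l" for c k u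
      using that Fge[OF _ pts[of u]] unfolding Z_def by force
    have Zbdd: "bdd_above (Z k)" for k
      unfolding bdd_above_def using Zb[of _ k 0] l(1) by fastforce
    have CF: "C k + of_int k * u \<le> F (along \<Gamma> \<tau> u)" if "k \<in> S" "0 \<le> u" "u < l" for k u
    proof -
      have "C k \<le> F (along \<Gamma> \<tau> u) - of_int k * u"
        unfolding C_def by (rule cSup_least) (use that Zb[of _ k u] in \<open>force simp: S_def\<close>)+
      then show ?thesis by simp
    qed
    \<comment> \<open>A value of \<open>f\<close> equals that of a support line at the same point.
      This line has an admissible slope, and its intercept is at most the best one.\<close>
    have fC: "\<exists>k\<in>S. f (along \<Gamma> \<tau> u) \<le> C k + of_int k * u" if f: "f \<in> R" and u: "0 \<le> u" "u < l" for f u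
    proof -
      obtain \<rho> where \<rho>: "\<rho> \<in> directions \<Gamma>"
        "\<And>u'. 0 \<le> u' \<Longrightarrow> u' < l \<Longrightarrow> f (along \<Gamma> \<tau> u) + of_int (slope f \<rho>) * (u' - u) \<le> f (along \<Gamma> \<tau> u')"
        unfolding \<tau>e using rfun_two_sided_support[OF R(1)[OF f] \<tau> l(2,3,4) u] by metis
      let ?k = "slope f \<rho>" and ?c = "f (along \<Gamma> \<tau> u) - of_int (slope f \<rho>) * u"
      have "?c \<in> Z ?k"
        unfolding Z_def using f \<rho>(2) by (auto simp: algebra_simps intro!: bexI[of _ f])
      moreover have "?k \<in> {-K..K}" using K[OF R(1)[OF f] \<rho>(1)] by auto
      ultimately have "?k \<in> S" "?c \<le> C ?k"
        using Zbdd by (auto simp: S_def C_def intro: cSup_upper)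
      then show ?thesis by (intro bexI[of _ ?k]) auto
    qed
    have finS: "finite S" by (rule finite_subset[of S "{-K..K}"]) (auto simp: S_def)
    have Sne: "S \<noteq> {}" using fC[of _ 0] Rne l(1) by blast
    have FM: "F (along \<Gamma> \<tau> u) = Max ((\<lambda>k. C k + of_int k * u) ` S)" if u: "0 \<le> u" "u < l" for u
    proof (rule antisym)
      show "F (along \<Gamma> \<tau> u) \<le> Max ((\<lambda>k. C k + of_int k * u) ` S)"
      proof (rule Fle)
        fix f assume "f \<in> R"
        then obtain k where "k \<in> S" "f (along \<Gamma> \<tau> u) \<le> C k + of_int k * u" using fC u by blast
        then show "f (along \<Gamma> \<tau> u) \<le> Max ((\<lambda>k. C k + of_int k * u) ` S)"
          using finS by (meson Max_ge finite_imageI image_eqI order_trans)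
      qed
      show "Max ((\<lambda>k. C k + of_int k * u) ` S) \<le> F (along \<Gamma> \<tau> u)"
        using finS Sne CF u by (intro Max.boundedI) auto
    qed
    obtain m where m: "m \<in> S" "C m = Max ((\<lambda>k. C k) ` S)"
      "\<forall>\<^sub>F s in at_right 0. Max ((\<lambda>k. C k + of_int k * s) ` S) = C m + of_int m * s"
      using Max_affine_germ[OF finS Sne] by blast
    have F0: "F (along \<Gamma> \<tau> 0) = C m" using FM[of 0] l(1) m(2) by simp
    have "\<forall>\<^sub>F s in at_right 0. 0 \<le> s \<and> s < l"
      unfolding eventually_at_right_0 using l(1) by (intro exI[of _ l]) auto
    with m(3) have "has_slope \<Gamma> F \<tau> m"
      unfolding has_slope_def F0 by eventually_elim (use FM in simp)
    then show ?thesis ..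
  qed
  have Fg: "integral_germs \<Gamma> F" using germs by (simp add: integral_germs_def)
  have "0 \<le> D x + ord_at \<Gamma> F x" if x: "x \<in> points \<Gamma>" for x
  proof -
    have 1: "\<forall>\<^sub>F s in at_right 0. F (along \<Gamma> \<tau> s) = F x + of_int (slope F \<tau>) * s \<and>
        (\<forall>f\<in>R. f x + of_int (slope f \<tau>) * s \<le> f (along \<Gamma> \<tau> s))" if \<tau>: "\<tau> \<in> tangents \<Gamma> x" for \<tau>
    proof -
      obtain e t \<sigma> where \<tau>e: "\<tau> = (e, t, \<sigma>)" by (cases \<tau>) auto
      note d = tangents_directions[OF \<tau>, unfolded \<tau>e]
      obtain l where l: "0 < l" "0 \<le> t + \<sigma> * l" "t + \<sigma> * l \<le> ell e"
        "\<And>s. 0 < s \<Longrightarrow> s < l \<Longrightarrow> along \<Gamma> (e, t, \<sigma>) s \<notin> special D"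
        using ray[OF d] by blast
      have "f x + of_int (slope f \<tau>) * s \<le> f (along \<Gamma> \<tau> s)" if "f \<in> R" "0 < s" "s < l" for f s
        using rfun_support_line[OF R(1)[OF that(1)] d l(2,3,4), of s] that tangents_along[OF \<tau>]
        unfolding \<tau>e by simp
      then have "\<forall>\<^sub>F s in at_right 0. \<forall>f\<in>R. f x + of_int (slope f \<tau>) * s \<le> f (along \<Gamma> \<tau> s)"
        unfolding eventually_at_right_0 using l(1) by blast
      moreover have "\<forall>\<^sub>F s in at_right 0. F (along \<Gamma> \<tau> s) = F x + of_int (slope F \<tau>) * s"
        using has_slope_outgoing[OF Fg tangents_directions[OF \<tau>]] tangents_along[OF \<tau>]
        by (simp add: has_slope_def)
      ultimately show ?thesis by eventually_elim auto
    qed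
    \<comment> \<open>One positive \<open>s\<close> serves all members of \<open>R\<close> at once,
      because the length on which their support lines are valid depends only on the special
      points.\<close>
    have "\<forall>\<^sub>F s in at_right 0. \<forall>\<tau>\<in>tangents \<Gamma> x. F (along \<Gamma> \<tau> s) = F x + of_int (slope F \<tau>) * s \<and>
        (\<forall>f\<in>R. f x + of_int (slope f \<tau>) * s \<le> f (along \<Gamma> \<tau> s))"
      by (rule eventually_ball_finite) (use 1 in auto)
    then have "\<forall>\<^sub>F s in at_right 0. 0 < s \<and> (\<forall>\<tau>\<in>tangents \<Gamma> x. F (along \<Gamma> \<tau> s) = F x + of_int (slope F \<tau>) * s \<and>
        (\<forall>f\<in>R. f x + of_int (slope f \<tau>) * s \<le> f (along \<Gamma> \<tau> s)))"
      using eventually_at_right_less[of "0::real"] by eventually_elim auto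
    from eventually_happens'[OF _ this] have "\<exists>s. 0 < s \<and> (\<forall>\<tau>\<in>tangents \<Gamma> x. F (along \<Gamma> \<tau> s) = F x + of_int (slope F \<tau>) * s \<and>
        (\<forall>f\<in>R. f x + of_int (slope f \<tau>) * s \<le> f (along \<Gamma> \<tau> s)))" by simp
    then obtain s where s: "0 < s" "\<And>\<tau>. \<tau> \<in> tangents \<Gamma> x \<Longrightarrow> F (along \<Gamma> \<tau> s) = F x + of_int (slope F \<tau>) * s"
      "\<And>\<tau> f. \<tau> \<in> tangents \<Gamma> x \<Longrightarrow> f \<in> R \<Longrightarrow> f x + of_int (slope f \<tau>) * s \<le> f (along \<Gamma> \<tau> s)"
      by blast
    \<comment> \<open>Closeness below \<open>s\<close> at \<open>x\<close> is what integrality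
      needs: comparing \<open>f\<close> and \<open>F\<close> at distance \<open>s\<close> shows that
      each slope of \<open>f\<close> is less than that of \<open>F\<close> plus 1, hence at most
      that of \<open>F\<close>.\<close>
    have "\<exists>f\<in>R. F x - s < f x"
    proof (rule ccontr)
      assume "\<not> ?thesis"
      then have "F x \<le> F x - s" by (intro Fle) force
      then show False using s(1) by simp
    qed
    then obtain f where f: "f \<in> R" "F x - s < f x" by blast
    have "slope f \<tau> \<le> slope F \<tau>" if \<tau>: "\<tau> \<in> tangents \<Gamma> x" for \<tau>
    proof -
      have "f x + of_int (slope f \<tau>) * s \<le> F x + of_int (slope F \<tau>) * s"
        using s(3)[OF \<tau> f(1)] s(2)[OF \<tau>] Fge[OF f(1) along_in_points[OF tangents_directions[OF \<tau>]], of s]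
        by linarith
      then have "of_int (slope f \<tau>) * s < (of_int (slope F \<tau>) + 1) * s"
        using f(2) by (simp add: algebra_simps)
      then have "of_int (slope f \<tau>) < (of_int (slope F \<tau>) + 1 :: real)" using s(1) by simp
      then show ?thesis by linarith
    qed
    then have "ord_at \<Gamma> f x \<le> ord_at \<Gamma> F x" unfolding ord_at_def by (rule sum_mono)
    then show ?thesis using rfun_D(2)[OF R(1)[OF f(1)] x] by linarith
  qed
  then have "F \<in> rfun D" using Fg by (simp add: rfun_def)
  then show thesis using that FP Fge by (auto simp: R_def)
qed

end

section \<open>Reduced divisors: existence\<close>

text \<open>Off a closed subset of the line the distance falls at unit rate towards a nearest point
  and grows at unit rate otherwise, also when the set continues farther away on that side.\<close>

lemma infdist_germ:
  fixes Y :: "real set"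
  assumes Y: "closed Y" "Y \<noteq> {}" and t: "t \<notin> Y" and \<sigma>: "\<sigma> = 1 \<or> \<sigma> = -1"
  shows "\<forall>\<^sub>F s in at_right 0. infdist (t + \<sigma> * s) Y =
    infdist t Y + (if t + \<sigma> * infdist t Y \<in> Y then -1 else 1) * s"
proof -
  let ?d = "infdist t Y"
  have d: "0 < ?d"
    using infdist_pos_not_in_closed[OF Y t] .
  have le: "infdist (t + \<sigma> * s) Y \<le> ?d + s" "?d \<le> infdist (t + \<sigma> * s) Y + s" if "0 < s" for s
    using infdist_triangle[of "t + \<sigma> * s" Y t] infdist_triangle[of t Y "t + \<sigma> * s"] \<sigma> that
    by (auto simp: dist_real_def)
  show ?thesis
  proof (cases "t + \<sigma> * ?d \<in> Y")
    case True
    have "infdist (t + \<sigma> * s) Y = ?d - s" if "0 < s" "s < ?d" for s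
    proof -
      have "infdist (t + \<sigma> * s) Y \<le> dist (t + \<sigma> * s) (t + \<sigma> * ?d)" by (rule infdist_le[OF True])
      also have "\<dots> = ?d - s" using \<sigma> that by (auto simp: dist_real_def)
      finally show ?thesis using le(2)[OF that(1)] by simp
    qed
    then show ?thesis unfolding eventually_at_right_0 using True d by (auto intro!: exI[of _ ?d])
  next
    case False
    then have "open (- Y)" "t + \<sigma> * ?d \<in> - Y" using Y by auto
    then obtain \<eta> where \<eta>: "\<eta> > 0" "ball (t + \<sigma> * ?d) \<eta> \<subseteq> - Y" by (meson open_contains_ball)
    \<comment> \<open>Points of \<open>Y\<close> ahead are at distance at least
      \<open>?d + \<eta>\<close> from \<open>t\<close>. After moving by less than
      \<open>\<eta> / 2\<close> they are still no nearer than \<open>?d + s\<close>.\<close>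
    have "infdist (t + \<sigma> * s) Y = ?d + s" if s: "0 < s" "s < \<eta> / 2" for s
    proof -
      have "?d + s \<le> dist (t + \<sigma> * s) y" if y: "y \<in> Y" for y
      proof -
        have 1: "?d \<le> \<bar>t - y\<bar>" using infdist_le[OF y, of t] by (simp add: dist_real_def)
        have "y \<notin> ball (t + \<sigma> * ?d) \<eta>" using \<eta> y by blast
        then have 2: "\<eta> \<le> \<bar>t + \<sigma> * ?d - y\<bar>" by (simp add: dist_real_def)
        show ?thesis
          using \<sigma> 1 2 s d unfolding dist_real_def by (auto simp: abs_if split: if_splits)
      qed
      then have "?d + s \<le> infdist (t + \<sigma> * s) Y"
        unfolding infdist_def using Y(2) by (auto intro!: cINF_greatest)
      then show ?thesis using le(1)[OF s(1)] by simp
    qed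
    then show ?thesis unfolding eventually_at_right_0 using False \<eta>(1) by (auto intro!: exI[of _ "\<eta>/2"])
  qed
qed

context tropical
begin

section \<open>Firing a closed set\<close>

lemma eventually_along_openin:
  assumes U: "openin CT U" and \<tau>: "\<tau> \<in> directions \<Gamma>" "along \<Gamma> \<tau> 0 \<in> U"
  shows "\<forall>\<^sub>F s in at_right 0. along \<Gamma> \<tau> s \<in> U"
proof -
  obtain e t \<sigma> where \<tau>e: "\<tau> = (e, t, \<sigma>)" by (cases \<tau>) auto
  note D = directionsD[OF \<tau>(1)[unfolded \<tau>e]]
  let ?P = "{t \<in> {0..ell e}. ep e t \<in> U}"
  have "openin (top_of_set {0..ell e}) ?P" using U D(1) by (simp add: openin_curve_topology)
  then have "\<forall>x\<in>?P. \<exists>d>0. \<forall>x'\<in>{0..ell e}. dist x' x < d \<longrightarrow> x' \<in> ?P"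
    unfolding openin_euclidean_subtopology_iff by blast
  moreover have "t \<in> ?P" using D \<tau>(2) \<tau>e by auto
  ultimately obtain d where d: "d > 0" "\<forall>x'\<in>{0..ell e}. dist x' t < d \<longrightarrow> x' \<in> ?P" by blast
  have "\<forall>\<^sub>F s in at_right 0. 0 < s \<and> s < d"
    unfolding eventually_at_right_0 using d(1) by blast
  with eventually_along_inner[OF \<tau>(1)[unfolded \<tau>e]] show ?thesis
  proof eventually_elim
    case (elim s)
    then have "dist (t + \<sigma> * s) t < d" using D(4) by (auto simp: dist_real_def)
    then show ?case using d(2) elim \<tau>e by auto
  qed
qed

lemma leaving_frontier:
  assumes X: "closedin CT X" "v \<in> X" "leaving \<Gamma> X v \<noteq> {}"
  shows "v \<in> CT frontier_of X"
proof -
  obtain \<tau> where \<tau>: "\<tau> \<in> tangents \<Gamma> v" "\<forall>\<^sub>F s in at_right 0. along \<Gamma> \<tau> s \<notin> X"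
    using X(3) by (auto simp: leaving_def)
  have "v \<notin> CT interior_of X"
  proof
    assume "v \<in> CT interior_of X"
    then obtain U where U: "openin CT U" "v \<in> U" "U \<subseteq> X" by (auto simp: interior_of_def)
    have "\<forall>\<^sub>F s in at_right 0. along \<Gamma> \<tau> s \<in> U"
      by (rule eventually_along_openin[OF U(1) tangents_directions[OF \<tau>(1)]])
        (simp add: tangents_along[OF \<tau>(1)] U(2))
    with \<tau>(2) have "\<forall>\<^sub>F s in at_right (0::real). False" by eventually_elim (use U(3) in blast)
    then show False by simp
  qed
  then show ?thesis using X(1,2) closure_of_closedin by (auto simp: frontier_of_def)
qed

lemma closed_edge_preimage:
  assumes X: "closedin CT X" and e: "e \<in> edges \<Gamma>"
  shows "closed {t \<in> {0..ell e}. ep e t \<in> X}"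
  using closedin_continuous_map_preimage[OF continuous_map_ep[OF e] X]
  by (simp add: closedin_closed_eq)



text \<open>If the open piece had a point in \<open>X\<close> and one outside, then on the way from
  the first to the second there would be a last point of the closed set \<open>X\<close>, and the
  direction of travel would leave \<open>X\<close> there.\<close>

lemma closed_no_leaving:
  assumes X: "closedin CT X" and \<tau>: "(e, t, \<sigma>) \<in> directions \<Gamma>"
    and l: "0 \<le> t + \<sigma> * l" "t + \<sigma> * l \<le> ell e"
    and nl: "\<And>s. 0 < s \<Longrightarrow> s < l \<Longrightarrow> along \<Gamma> (e, t, \<sigma>) s \<in> X \<Longrightarrow> leaving \<Gamma> X (along \<Gamma> (e, t, \<sigma>) s) = {}"
  shows "(\<forall>s. 0 < s \<and> s < l \<longrightarrow> along \<Gamma> (e, t, \<sigma>) s \<in> X) \<or> (\<forall>s. 0 < s \<and> s < l \<longrightarrow> along \<Gamma> (e, t, \<sigma>) s \<notin> X)"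
proof (rule ccontr)
  note D = directionsD[OF \<tau>]
  let ?p = "along \<Gamma> (e, t, \<sigma>)"
  assume "\<not> ?thesis"
  then obtain a b where ab: "0 < a" "a < l" "0 < b" "b < l" "?p a \<in> X" "?p b \<notin> X" by blast
  define Y where "Y = {t \<in> {0..ell e}. ep e t \<in> X}"
  have cY: "closed Y" unfolding Y_def by (rule closed_edge_preimage[OF X D(1)])
  have pY: "?p s \<in> X \<longleftrightarrow> t + \<sigma> * s \<in> Y" if "0 < s" "s < l" for s
    using along_between[OF \<tau> l that] by (auto simp: Y_def)
  let ?ta = "t + \<sigma> * a"
  \<comment> \<open>The direction of travel from parameter \<open>a\<close> towards parameter
    \<open>b\<close>; \<open>z\<close> below is the distance from \<open>a\<close> to the last point
    of \<open>X\<close> before \<open>b\<close>.\<close>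
  define \<rho> where "\<rho> = (if a < b then \<sigma> else -\<sigma>)"
  define Z where "Z = {s \<in> {0..\<bar>b - a\<bar>}. ?ta + \<rho> * s \<in> Y}"
  have cZ: "compact Z"
  proof -
    have "closed ((\<lambda>s. ?ta + \<rho> * s) -` Y)"
      by (rule closed_vimage[OF cY]) (intro continuous_intros)
    then have "compact ({0..\<bar>b - a\<bar>} \<inter> (\<lambda>s. ?ta + \<rho> * s) -` Y)"
      by (rule compact_Int_closed[OF compact_Icc])
    moreover have "Z = {0..\<bar>b - a\<bar>} \<inter> (\<lambda>s. ?ta + \<rho> * s) -` Y" by (auto simp: Z_def)
    ultimately show ?thesis by simp
  qed
  have "0 \<in> Z" using pY[OF ab(1,2)] ab(5) by (simp add: Z_def)
  then obtain z where z: "z \<in> Z" "\<forall>s\<in>Z. s \<le> z" using compact_attains_sup[OF cZ] by blast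
  have tb: "?ta + \<rho> * \<bar>b - a\<bar> = t + \<sigma> * b" by (auto simp: \<rho>_def algebra_simps abs_if)
  have "?ta + \<rho> * \<bar>b - a\<bar> \<notin> Y" unfolding tb using pY[OF ab(3,4)] ab(6) by simp
  then have "\<bar>b - a\<bar> \<notin> Z" by (simp add: Z_def)
  then have zlt: "z < \<bar>b - a\<bar>" "0 \<le> z" using z(1) by (auto simp: Z_def less_le)
  define c where "c = (if a < b then a + z else a - z)"
  have c: "0 < c" "c < l" "t + \<sigma> * c = ?ta + \<rho> * z"
    using ab zlt by (auto simp: c_def \<rho>_def algebra_simps split: if_splits)
  have "t + \<sigma> * c \<in> Y" unfolding c(3) using z(1) by (simp add: Z_def)
  then have cX: "?p c \<in> X" using pY[OF c(1,2)] by blast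
  have "(e, t + \<sigma> * c, \<rho>) \<in> leaving \<Gamma> X (?p c)"
  proof -
    have "(e, t + \<sigma> * c, \<rho>) \<in> tangents \<Gamma> (?p c)"
      using directions_between[OF \<tau> l c(1,2)] by (auto simp: tangents_eq \<rho>_def)
    moreover have "along \<Gamma> (e, t + \<sigma> * c, \<rho>) s \<notin> X" if s: "0 < s" "s < \<bar>b - a\<bar> - z" for s
    proof -
      have "z + s \<notin> Z" using z(2) s by force
      then have nY: "?ta + \<rho> * (z + s) \<notin> Y" using s zlt by (auto simp: Z_def)
      define c' where "c' = (if a < b then c + s else c - s)"
      have c': "0 < c'" "c' < l" "t + \<sigma> * c' = ?ta + \<rho> * (z + s)"
        using ab zlt s c(1,2) by (auto simp: c'_def c_def \<rho>_def algebra_simps split: if_splits)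
      have "?p c' \<notin> X" using pY[OF c'(1,2)] nY unfolding c'(3) by blast
      moreover have "along \<Gamma> (e, t + \<sigma> * c, \<rho>) s = ?p c'"
        by (simp add: c'_def \<rho>_def algebra_simps)
      ultimately show ?thesis by simp
    qed
    ultimately show ?thesis
      unfolding leaving_def eventually_at_right_0 using zlt by (auto simp del: along_simp intro!: exI[of _ "\<bar>b - a\<bar> - z"])
  qed
  then show False using nl[OF c(1,2) cX] by blast
qed

text \<open>
  The witness is the function \<open>max 0 (\<epsilon> - d)\<close>, where \<open>d\<close> is the distance to \<open>X\<close> within the edge.
\<close>

lemma firing_function:
  assumes X: "closedin CT X" and fin: "finite {v \<in> X. leaving \<Gamma> X v \<noteq> {}}"
  shows "\<exists>u. integral_germs \<Gamma> u \<and> (\<forall>x\<in>X. ord_at \<Gamma> u x = - int (card (leaving \<Gamma> X x))) \<and>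
    (\<forall>x\<in>points \<Gamma> - X. 0 \<le> ord_at \<Gamma> u x) \<and> (\<forall>x\<in>X. \<forall>y\<in>points \<Gamma> - X. u y < u x)"
proof -
  define Y where "Y e = {t \<in> {0..ell e}. ep e t \<in> X}" for e
  have cY: "closed (Y e)" if "e \<in> edges \<Gamma>" for e
    unfolding Y_def by (rule closed_edge_preimage[OF X that])
  define A where "A = {r. \<exists>e\<in>edges \<Gamma>. \<exists>t\<in>{0, ell e}. Y e \<noteq> {} \<and> t \<notin> Y e \<and> r = infdist t (Y e)}"
  have "finite A"
  proof -
    have "A \<subseteq> (\<lambda>e. infdist 0 (Y e)) ` edges \<Gamma> \<union> (\<lambda>e. infdist (ell e) (Y e)) ` edges \<Gamma>"
      by (auto simp: A_def)
    then show ?thesis by (rule finite_subset) simp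
  qed
  have Apos: "0 < r" if "r \<in> A" for r
    using that cY by (auto simp: A_def intro!: infdist_pos_not_in_closed)
  \<comment> \<open>Smaller than the distance, within its edge, from any edge end outside
    \<open>X\<close> to \<open>X\<close>. The function then vanishes near vertices outside
    \<open>X\<close>, and the definitions on different edges agree at the vertices. The inserted 1
    covers an empty \<open>A\<close>.\<close>
  define \<epsilon> where "\<epsilon> = Min (insert 1 A) / 2"
  have \<epsilon>: "0 < \<epsilon>" using \<open>finite A\<close> Apos by (auto simp: \<epsilon>_def)
  have \<epsilon>A: "\<epsilon> < r" if "r \<in> A" for r
  proof -
    have "Min (insert 1 A) \<le> r" using \<open>finite A\<close> that by (intro Min_le) auto
    then show ?thesis using Apos[OF that] by (simp add: \<epsilon>_def)
  qed
  define h where "h e t = (if Y e = {} then 0 else max 0 (\<epsilon> - infdist t (Y e)))" for e t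
  define u where "u x = (case x of Vertex v \<Rightarrow> if Vertex v \<in> X then \<epsilon> else 0 | Inner e t \<Rightarrow> h e t)" for x
  have h_in: "h e t = \<epsilon>" if "t \<in> Y e" for e t
    using that \<epsilon> by (auto simp: h_def)
  have h_out: "h e t < \<epsilon>" if "t \<notin> Y e" "e \<in> edges \<Gamma>" for e t
    using infdist_pos_not_in_closed[OF cY[OF that(2)] _ that(1)] \<epsilon> by (auto simp: h_def)
  have h_end: "h e t = 0" if "e \<in> edges \<Gamma>" "t \<in> {0, ell e}" "t \<notin> Y e" for e t
  proof (cases "Y e = {}")
    case False
    then have "infdist t (Y e) \<in> A" unfolding A_def using that by blast
    from \<epsilon>A[OF this] show ?thesis by (simp add: h_def)
  qed (simp add: h_def)
  have uep: "u (ep e t) = h e t" if "e \<in> edges \<Gamma>" "t \<in> {0..ell e}" for e t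
  proof -
    consider "t = 0" | "t = ell e" | "0 < t" "t < ell e" using \<open>t \<in> {0..ell e}\<close> by fastforce
    then show ?thesis
    proof cases
      case 1
      then show ?thesis using h_in[of t e] h_end[of e t] that by (auto simp: u_def Y_def)
    next
      case 2
      then show ?thesis using h_in[of t e] h_end[of e t] that by (auto simp: u_def Y_def)
    qed (simp add: u_def)
  qed
  have ual: "\<forall>\<^sub>F s in at_right 0. u (along \<Gamma> (e, t, \<sigma>) s) = h e (t + \<sigma> * s) \<and>
      (along \<Gamma> (e, t, \<sigma>) s \<in> X \<longleftrightarrow> t + \<sigma> * s \<in> Y e)" if "(e, t, \<sigma>) \<in> directions \<Gamma>" for e t \<sigma>
    using eventually_along_inner[OF that]
  proof eventually_elim
    case (elim s)
    then have "t + \<sigma> * s \<in> {0..ell e}" by simp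
    then show ?case using uep[OF directionsD(1)[OF that]] by (simp add: Y_def del: ep_inner)
  qed
  \<comment> \<open>Without the finiteness assumption a ray could enter and leave \<open>X\<close>
    infinitely often near its start. Beyond the finitely many points with a leaving direction
    \<open>closed_no_leaving\<close> applies.\<close>
  have dich: "(\<forall>\<^sub>F s in at_right 0. along \<Gamma> \<tau> s \<in> X) \<or> (\<forall>\<^sub>F s in at_right 0. along \<Gamma> \<tau> s \<notin> X)"
    if "\<tau> \<in> directions \<Gamma>" for \<tau>
  proof -
    obtain e t \<sigma> where \<tau>e: "\<tau> = (e, t, \<sigma>)" by (cases \<tau>) auto
    note \<tau> = that[unfolded \<tau>e]
    let ?W = "{v \<in> X. leaving \<Gamma> X v \<noteq> {}} \<union> Vertex ` verts (model \<Gamma>)"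
    obtain l where l: "0 < l" "0 \<le> t + \<sigma> * l" "t + \<sigma> * l \<le> ell e"
      "\<And>s. 0 < s \<Longrightarrow> s < l \<Longrightarrow> along \<Gamma> (e, t, \<sigma>) s \<notin> ?W"
      using next_special[OF _ _ \<tau>, of ?W] fin by (metis (no_types, lifting) finite_UnI finite_imageI model.finite_verts sup_ge2)
    have "(\<forall>s. 0 < s \<and> s < l \<longrightarrow> along \<Gamma> \<tau> s \<in> X) \<or> (\<forall>s. 0 < s \<and> s < l \<longrightarrow> along \<Gamma> \<tau> s \<notin> X)"
      unfolding \<tau>e by (rule closed_no_leaving[OF X \<tau> l(2,3)]) (use l(4) in blast)
    then show ?thesis unfolding eventually_at_right_0 using l(1) by blast
  qed
  have in_stay: "has_slope \<Gamma> u \<tau> 0" if "\<tau> \<in> tangents \<Gamma> x" "x \<in> X" "\<tau> \<notin> leaving \<Gamma> X x" for \<tau> x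
  proof -
    obtain e t \<sigma> where \<tau>e: "\<tau> = (e, t, \<sigma>)" by (cases \<tau>) auto
    note d = tangents_directions[OF that(1)]
    have ev: "\<forall>\<^sub>F s in at_right 0. along \<Gamma> \<tau> s \<in> X"
      using dich[OF d] that by (auto simp: leaving_def)
    have u0: "u (along \<Gamma> \<tau> 0) = \<epsilon>"
      using that(2) tangents_along[OF that(1)] uep directionsD(1-3)[OF d[unfolded \<tau>e]] h_in[of t e]
      by (auto simp: \<tau>e Y_def)
    show ?thesis
      unfolding has_slope_def u0 using ev ual[OF d[unfolded \<tau>e]] unfolding \<tau>e[symmetric]
      by eventually_elim (simp add: h_in)
  qed
  have in_leave: "has_slope \<Gamma> u \<tau> (-1)" if "\<tau> \<in> tangents \<Gamma> x" "x \<in> X" "\<tau> \<in> leaving \<Gamma> X x" for \<tau> x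
  proof -
    obtain e t \<sigma> where \<tau>e: "\<tau> = (e, t, \<sigma>)" by (cases \<tau>) auto
    note d = tangents_directions[OF that(1)]
    note D = directionsD[OF d[unfolded \<tau>e]]
    have tY: "t \<in> Y e" using that(2) tangents_along[OF that(1)] D by (auto simp: \<tau>e Y_def)
    then have Yne: "Y e \<noteq> {}" by blast
    have "\<forall>\<^sub>F s in at_right 0. along \<Gamma> \<tau> s \<notin> X" using that(3) by (simp add: leaving_def)
    then have "\<forall>\<^sub>F s in at_right 0. t + \<sigma> * s \<notin> Y e"
      using ual[OF d[unfolded \<tau>e]] unfolding \<tau>e[symmetric] by eventually_elim simp
    then obtain r where r: "r > 0" "\<forall>s. 0 < s \<and> s < r \<longrightarrow> t + \<sigma> * s \<notin> Y e"
      unfolding eventually_at_right_0 by blast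
    have inf: "infdist (t + \<sigma> * s) (Y e) = s" if s: "0 < s" "s < r / 2" for s
    proof (rule antisym)
      show "infdist (t + \<sigma> * s) (Y e) \<le> s"
        using infdist_le[OF tY, of "t + \<sigma> * s"] D(4) s by (auto simp: dist_real_def)
      have "s \<le> dist (t + \<sigma> * s) y" if y: "y \<in> Y e" for y
      proof (rule ccontr)
        assume "\<not> ?thesis"
        then have *: "\<bar>t + \<sigma> * s - y\<bar> < s" by (simp add: dist_real_def)
        define w where "w = \<sigma> * (y - t)"
        have "y = t + \<sigma> * w" "0 < w" "w < r" using D(4) * s by (auto simp: w_def)
        then show False using r(2) y by blast
      qed
      then show "s \<le> infdist (t + \<sigma> * s) (Y e)"
        unfolding infdist_def using Yne by (auto intro!: cINF_greatest)
    qed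
    have ev: "\<forall>\<^sub>F s in at_right 0. 0 < s \<and> s < min (r/2) \<epsilon>"
      unfolding eventually_at_right_0 using r(1) \<epsilon> by (intro exI[of _ "min (r/2) \<epsilon>"]) auto
    have u0: "u (along \<Gamma> \<tau> 0) = \<epsilon>"
      using uep[of e t] D h_in[OF tY] by (auto simp: \<tau>e)
    show ?thesis
      unfolding has_slope_def u0 using ev ual[OF d[unfolded \<tau>e]] unfolding \<tau>e[symmetric]
      by eventually_elim (use inf Yne in \<open>auto simp: h_def\<close>)
  qed
  \<comment> \<open>Outside \<open>X\<close> the slope is 1 towards a nearest point of
    \<open>X\<close> at distance at most \<open>\<epsilon>\<close>, and -1 only away from
    \<open>X\<close> at distance below \<open>\<epsilon>\<close>. At distance exactly
    \<open>\<epsilon>\<close> the function starts to rise towards \<open>X\<close> and is constant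
    away from it.\<close>
  have out_slope: "has_slope \<Gamma> u (e, t, \<sigma>)
      (if Y e = {} \<or> infdist t (Y e) > \<epsilon> then 0
       else if t + \<sigma> * infdist t (Y e) \<in> Y e then 1
       else if infdist t (Y e) < \<epsilon> then -1 else 0)"
    if \<tau>: "(e, t, \<sigma>) \<in> directions \<Gamma>" and tY: "t \<notin> Y e" for e t \<sigma>
  proof -
    note D = directionsD[OF \<tau>]
    have u0: "u (along \<Gamma> (e, t, \<sigma>) 0) = h e t" using uep[of e t] D by simp
    show ?thesis
    proof (cases "Y e = {}")
      case True
      then show ?thesis
        unfolding has_slope_def u0 using ual[OF \<tau>] by (auto simp: h_def elim: eventually_mono)
    next
      case False
      let ?d = "infdist t (Y e)"
      have d: "0 < ?d" using infdist_pos_not_in_closed[OF cY[OF D(1)] False tY] .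
      have "\<forall>\<^sub>F s in at_right 0. 0 < s \<and> s < \<bar>?d - \<epsilon>\<bar> \<or> ?d = \<epsilon> \<and> 0 < s \<and> s < \<epsilon>"
        unfolding eventually_at_right_0 using \<epsilon> by (cases "?d = \<epsilon>") (auto intro: exI[of _ \<epsilon>] exI[of _ "\<bar>?d - \<epsilon>\<bar>"])
      with infdist_germ[OF cY[OF D(1)] False tY D(4)] ual[OF \<tau>]
      show ?thesis
        unfolding has_slope_def u0
        by eventually_elim (auto simp: h_def False max_def abs_if split: if_splits)
    qed
  qed
  have germs: "integral_germs \<Gamma> u"
    unfolding integral_germs_def
  proof
    fix \<tau> assume \<tau>: "\<tau> \<in> directions \<Gamma>"
    obtain e t \<sigma> where \<tau>e: "\<tau> = (e, t, \<sigma>)" by (cases \<tau>) auto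
    have \<tau>t: "\<tau> \<in> tangents \<Gamma> (along \<Gamma> \<tau> 0)" using \<tau> by (simp add: tangents_eq)
    show "\<exists>m. has_slope \<Gamma> u \<tau> m"
    proof (cases "along \<Gamma> \<tau> 0 \<in> X")
      case True
      then show ?thesis using in_stay[OF \<tau>t True] in_leave[OF \<tau>t True] by blast
    next
      case False
      then have "t \<notin> Y e" by (simp add: \<tau>e Y_def)
      then show ?thesis using out_slope[of e t \<sigma>] \<tau> unfolding \<tau>e by blast
    qed
  qed
  have ordX: "ord_at \<Gamma> u x = - int (card (leaving \<Gamma> X x))" if x: "x \<in> X" for x
  proof -
    have "ord_at \<Gamma> u x = (\<Sum>\<tau>\<in>tangents \<Gamma> x. if \<tau> \<in> leaving \<Gamma> X x then -1 else 0)"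
      unfolding ord_at_def
    proof (rule sum.cong[OF refl])
      fix \<tau> assume \<tau>: "\<tau> \<in> tangents \<Gamma> x"
      show "slope u \<tau> = (if \<tau> \<in> leaving \<Gamma> X x then -1 else 0)"
        using outgoing_slope_eq[OF in_stay[OF \<tau> x]] outgoing_slope_eq[OF in_leave[OF \<tau> x]] by simp
    qed
    then show ?thesis by (simp add: sum.If_cases leaving_def Int_def)
  qed
  have ordout: "0 \<le> ord_at \<Gamma> u x" if x: "x \<in> points \<Gamma>" "x \<notin> X" for x
    using x(1)
  proof (cases rule: points_cases)
    case (1 v)
    have "slope u \<tau> = 0" if \<tau>: "\<tau> \<in> tangents \<Gamma> x" for \<tau>
    proof -
      obtain e t \<sigma> where \<tau>e: "\<tau> = (e, t, \<sigma>)" by (cases \<tau>) auto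
      note d = tangents_directions[OF \<tau>, unfolded \<tau>e]
      note D = directionsD[OF d]
      have x0: "ep e t = x" using tangents_along[OF \<tau>] \<tau>e by simp
      then have t0: "t \<in> {0, ell e}" using 1 D by (auto simp: edge_point_def split: if_splits)
      have tY: "t \<notin> Y e" using x(2) x0 by (auto simp: Y_def)
      then have "Y e = {} \<or> infdist t (Y e) > \<epsilon>"
        using \<epsilon>A[of "infdist t (Y e)"] t0 D(1) by (auto simp: A_def)
      then show ?thesis using outgoing_slope_eq[OF out_slope[OF d tY]] \<tau>e by simp
    qed
    then show ?thesis by (simp add: ord_at_def)
  next
    case (2 e t)
    have tY: "t \<notin> Y e" using x(2) 2 by (auto simp: Y_def)
    have dirs: "(e, t, 1) \<in> directions \<Gamma>" "(e, t, -1) \<in> directions \<Gamma>"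
      using 2 by (auto simp: directions_def)
    \<comment> \<open>A nearest point lies in at least one of the two directions, and its slope 1
      compensates a possible -1 in the other.\<close>
    have "t + infdist t (Y e) \<in> Y e \<or> t - infdist t (Y e) \<in> Y e" if ne: "Y e \<noteq> {}"
    proof -
      obtain y where "y \<in> Y e" "infdist t (Y e) = dist t y"
        using infdist_attains_inf[OF cY[OF 2(2)] ne] by metis
      moreover then have "y = t + infdist t (Y e) \<or> y = t - infdist t (Y e)" by (auto simp: dist_real_def)
      ultimately show ?thesis by metis
    qed
    then show ?thesis
      using ord_at_ep[OF 2(2,3,4), of 1 u] outgoing_slope_eq[OF out_slope[OF dirs(1) tY]]
        outgoing_slope_eq[OF out_slope[OF dirs(2) tY]] 2 by auto
  qed
  have uX: "u x = \<epsilon>" if "x \<in> X" for x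
  proof -
    have "x \<in> points \<Gamma>" using that closedin_subset[OF X] by auto
    then show ?thesis
    proof (cases rule: points_cases)
      case (2 e t)
      then show ?thesis using that h_in[of t e] uep[of e t] by (auto simp: Y_def)
    qed (use that in \<open>auto simp: u_def\<close>)
  qed
  have uout: "u x < \<epsilon>" if "x \<in> points \<Gamma>" "x \<notin> X" for x
    using that(1)
  proof (cases rule: points_cases)
    case (2 e t)
    then show ?thesis using that h_out[of t e] uep[of e t] by (auto simp: Y_def)
  qed (use that \<epsilon> in \<open>auto simp: u_def\<close>)
  show ?thesis
    by (rule exI[of _ u]) (use germs ordX ordout uX uout in auto)
qed

text \<open>The extremal function \<open>F\<close> yields the reduced divisor: if some set
  \<open>X\<close> could be fired, then \<open>F\<close> plus the firing function, normalized at
  \<open>P\<close>, would still be admissible and would exceed \<open>F\<close> on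
  \<open>X\<close>.\<close>

lemma reduced_exists:
  assumes D: "divisor \<Gamma> D" "effective D" and P: "P \<in> points \<Gamma>"
  shows "\<exists>D'. is_reduced \<Gamma> P D' \<and> lin_equiv \<Gamma> D' D"
proof -
  obtain F where F: "F \<in> rfun D" "F P = 0"
    "\<And>f x. f \<in> rfun D \<Longrightarrow> f P = 0 \<Longrightarrow> x \<in> points \<Gamma> \<Longrightarrow> f x \<le> F x"
    using extremal_function[OF D P] by blast
  note Fg = rfun_D(1)[OF F(1)]
  define D' where "D' x = (if x \<in> points \<Gamma> then D x + ord_at \<Gamma> F x else 0)" for x
  have out: "D x = 0" if "x \<notin> points \<Gamma>" for x
    using D(1) that by (auto simp: divisor_def)
  have lin: "lin_equiv \<Gamma> D' D"
    unfolding lin_equiv_iff by (rule exI[of _ F]) (use Fg out in \<open>auto simp: D'_def\<close>)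
  have "{x. D' x \<noteq> 0} \<subseteq> {x. D x \<noteq> 0} \<union> {x \<in> points \<Gamma>. ord_at \<Gamma> F x \<noteq> 0}"
    by (auto simp: D'_def)
  moreover have "finite {x. D x \<noteq> 0}" using D(1) by (simp add: divisor_def)
  ultimately have fin: "finite {x. D' x \<noteq> 0}"
    using finite_ord_at[OF Fg] by (meson finite_UnI finite_subset)
  then have div: "divisor \<Gamma> D'" by (auto simp: divisor_def D'_def)
  have eff: "0 \<le> D' x" for x using rfun_D(2)[OF F(1)] by (simp add: D'_def)
  have "\<exists>v \<in> CT frontier_of X. D' v < int (Defs.out_degree \<Gamma> X v)"
    if X: "X \<noteq> {}" "closedin CT X" "P \<notin> X" for X
  proof (rule ccontr)
    assume neg: "\<not> ?thesis"
    have Xp: "X \<subseteq> points \<Gamma>" using closedin_subset[OF X(2)] by simp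
    have deg: "int (card (leaving \<Gamma> X v)) \<le> D' v" if v: "v \<in> X" for v
    proof (cases "leaving \<Gamma> X v = {}")
      case False
      then show ?thesis
        using neg leaving_frontier[OF X(2) v False] out_degree_eq_card_leaving[of v X] v Xp by force
    qed (use eff in simp)
    \<comment> \<open>Points of \<open>X\<close> with a leaving direction carry chips of
      \<open>D'\<close>, so there are finitely many of them, as \<open>firing_function\<close>
      requires.\<close>
    have "D' v \<noteq> 0" if "v \<in> X" "leaving \<Gamma> X v \<noteq> {}" for v
    proof -
      have "finite (leaving \<Gamma> X v)" by (simp add: leaving_def)
      then have "0 < card (leaving \<Gamma> X v)" using that(2) by (simp add: card_gt_0_iff)
      then show ?thesis using deg[OF that(1)] by linarith
    qed
    then have "{v \<in> X. leaving \<Gamma> X v \<noteq> {}} \<subseteq> {x. D' x \<noteq> 0}" by blast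
    then have "finite {v \<in> X. leaving \<Gamma> X v \<noteq> {}}" using fin by (rule finite_subset)
    from firing_function[OF X(2) this] obtain u where u: "integral_germs \<Gamma> u"
      "\<forall>x\<in>X. ord_at \<Gamma> u x = - int (card (leaving \<Gamma> X x))"
      "\<forall>x\<in>points \<Gamma> - X. 0 \<le> ord_at \<Gamma> u x" "\<forall>x\<in>X. \<forall>y\<in>points \<Gamma> - X. u y < u x"
      by (elim exE conjE)
    define G where "G = (\<lambda>x. (F x + u x) + (- u P))"
    have G: "integral_germs \<Gamma> G"
      unfolding G_def by (intro integral_germs_add Fg u(1) integral_germs_const)
    have ordG: "ord_at \<Gamma> G x = ord_at \<Gamma> F x + ord_at \<Gamma> u x" for x
      unfolding G_def
      by (simp only: ord_at_add[OF integral_germs_add[OF Fg u(1)] integral_germs_const] ord_at_add[OF Fg u(1)]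
          ord_at_const)
    have "0 \<le> D x + ord_at \<Gamma> G x" if x: "x \<in> points \<Gamma>" for x
    proof (cases "x \<in> X")
      case True
      then show ?thesis using deg[OF True] u(2) x by (simp add: ordG D'_def)
    next
      case False
      then have "0 \<le> ord_at \<Gamma> u x" using u(3) x by blast
      then show ?thesis using eff[of x] x by (simp add: ordG D'_def)
    qed
    then have "G \<in> rfun D" using G by (simp add: rfun_def)
    moreover have "G P = 0" by (simp add: G_def F(2))
    moreover obtain x where x: "x \<in> X" using X(1) by blast
    ultimately have "G x \<le> F x" using F(3) Xp by blast
    moreover have "u P < u x" using u(4) x P X(3) by blast
    ultimately show False by (simp add: G_def)
  qed
  then have "is_reduced \<Gamma> P D'"
    unfolding is_reduced_def using div eff by simp
  then show ?thesis using lin by blast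
qed

end

section \<open>Moving the base point\<close>

lemma sum_nonpos_all_0:
  fixes f :: "'b \<Rightarrow> int"
  assumes "finite T" "\<And>x. x \<in> T \<Longrightarrow> f x \<le> 0" "sum f T = 0" "x \<in> T"
  shows "f x = 0"
  using sum_nonneg_eq_0_iff[of T "\<lambda>x. - f x"] assms by (simp add: sum_negf)

text \<open>The situation of the proof by contradiction: \<open>R P\<close> stands for the reduced
  divisor at \<open>P\<close>, with coefficient exactly \<open>a\<close> at every base
  point.\<close>

locale equi_reduced = tropical \<Gamma> for \<Gamma> :: "('v, 'e) metric_graph" +
  fixes a :: int and R :: "('v, 'e) point \<Rightarrow> ('v, 'e) point \<Rightarrow> int"
  assumes a_ge_1: "1 \<le> a"
    and reduced: "P \<in> points \<Gamma> \<Longrightarrow> is_reduced \<Gamma> P (R P)"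
    and coeff: "P \<in> points \<Gamma> \<Longrightarrow> R P P = a"
    and equiv: "P \<in> points \<Gamma> \<Longrightarrow> Q \<in> points \<Gamma> \<Longrightarrow> lin_equiv \<Gamma> (R Q) (R P)"
begin

text \<open>The divisor \<open>E_P\<close> of the overview.\<close>

definition rest :: "('v, 'e) point \<Rightarrow> ('v, 'e) point \<Rightarrow> int" where
  "rest P = (R P)(P := 0)"

lemma R_nonneg: "P \<in> points \<Gamma> \<Longrightarrow> x \<in> points \<Gamma> \<Longrightarrow> 0 \<le> R P x"
  using reduced[of P] coeff[of P] a_ge_1 by (cases "x = P") (auto simp: is_reduced_def)

lemma rest_self [simp]: "rest P P = 0"
  by (simp add: rest_def)

lemma rest_other: "x \<noteq> P \<Longrightarrow> rest P x = R P x"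
  by (simp add: rest_def)

text \<open>
  \<open>moves P \<tau> \<epsilon> g\<close> expresses that \<open>R Q = R P + div g\<close> for the point \<open>Q\<close> at distance
  \<open>\<epsilon>\<close> from \<open>P\<close> in the direction \<open>\<tau>\<close> and that, near \<open>P\<close>, the function \<open>g\<close> only
  transports \<open>a\<close> chips from \<open>P\<close> to \<open>Q\<close>.
\<close>

definition moves ::
  "('v, 'e) point \<Rightarrow> 'e \<times> real \<times> real \<Rightarrow> real \<Rightarrow> (('v, 'e) point \<Rightarrow> real) \<Rightarrow> bool" where
  "moves P = (\<lambda>(e, t, \<sigma>) \<epsilon> g. integral_germs \<Gamma> g \<and> 0 < \<epsilon> \<and>
     (\<forall>x\<in>points \<Gamma>. R (along \<Gamma> (e, t, \<sigma>) \<epsilon>) x = R P x + ord_at \<Gamma> g x) \<and>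
     (\<forall>x\<in>points \<Gamma>. g x \<le> g P) \<and> (\<forall>x\<in>points \<Gamma>. g (along \<Gamma> (e, t, \<sigma>) \<epsilon>) \<le> g x) \<and>
     g (along \<Gamma> (e, t, \<sigma>) \<epsilon>) < g P \<and>
     (\<forall>\<rho>\<in>tangents \<Gamma> P - {(e, t, \<sigma>)}. slope g \<rho> = 0) \<and>
     slope g (e, t + \<sigma> * \<epsilon>, \<sigma>) = 0 \<and>
     (\<forall>s. 0 < s \<and> s \<le> \<epsilon> \<longrightarrow> 0 < t + \<sigma> * s \<and> t + \<sigma> * s < ell e) \<and>
     (\<forall>s. 0 \<le> s \<and> s < \<epsilon> \<longrightarrow> R (along \<Gamma> (e, t, \<sigma>) \<epsilon>) (along \<Gamma> (e, t, \<sigma>) s) = 0) \<and>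
     (\<forall>s. 0 < s \<and> s \<le> \<epsilon> \<longrightarrow> R P (along \<Gamma> (e, t, \<sigma>) s) = 0))"

text \<open>Since \<open>R Q P\<close> is nonnegative, the slope of \<open>g\<close> from
  \<open>P\<close> towards \<open>Q\<close> is at least \<open>- a\<close>, so \<open>g\<close>
  loses at most \<open>a * \<epsilon>\<close> on the way. A slope of at least 1 beyond
  \<open>Q\<close> would persist by convexity and lift \<open>g\<close> above its maximum. So the
  slope beyond \<open>Q\<close> is 0, the slope back is \<open>a\<close>, and all estimates are
  equalities.\<close>

lemma ex_moves:
  assumes P: "P \<in> points \<Gamma>"
  shows "\<exists>r>0. \<forall>\<tau>\<in>tangents \<Gamma> P. \<forall>\<epsilon>. 0 < \<epsilon> \<and> \<epsilon> < r \<longrightarrow> (\<exists>g. moves P \<tau> \<epsilon> g)"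
proof -
  have "divisor \<Gamma> (R P)" using reduced[OF P] by (simp add: is_reduced_def)
  then have finW: "finite (special (R P))" by (rule finite_special)
  have "\<forall>\<^sub>F s in at_right 0. along \<Gamma> \<tau> s \<notin> special (R P) \<and>
      (case \<tau> of (e, t, \<sigma>) \<Rightarrow> 0 < t + \<sigma> * s \<and> t + \<sigma> * s < ell e)" if "\<tau> \<in> tangents \<Gamma> P" for \<tau>
    using eventually_along_notin_finite[OF tangents_directions[OF that] finW]
      eventually_along_inner[of "fst \<tau>" "fst (snd \<tau>)" "snd (snd \<tau>)"] tangents_directions[OF that]
    by (cases \<tau>) (auto simp: eventually_conj_iff)
  then have "\<forall>\<^sub>F s in at_right 0. \<forall>\<tau>\<in>tangents \<Gamma> P. along \<Gamma> \<tau> s \<notin> special (R P) \<and>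
      (case \<tau> of (e, t, \<sigma>) \<Rightarrow> 0 < t + \<sigma> * s \<and> t + \<sigma> * s < ell e)"
    by (intro eventually_ball_finite) auto
  then obtain r0 where r0: "r0 > 0" "\<forall>s. 0 < s \<and> s < r0 \<longrightarrow> (\<forall>\<tau>\<in>tangents \<Gamma> P. along \<Gamma> \<tau> s \<notin> special (R P) \<and>
      (case \<tau> of (e, t, \<sigma>) \<Rightarrow> 0 < t + \<sigma> * s \<and> t + \<sigma> * s < ell e))"
    unfolding eventually_at_right_0 by blast
  \<comment> \<open>Chosen so that the length \<open>(a + 2) * \<epsilon>\<close> used below stays
    within \<open>r0\<close>.\<close>
  define r where "r = r0 / (of_int a + 3)"
  have "r > 0" using r0(1) a_ge_1 by (simp add: r_def)
  moreover have "\<exists>g. moves P \<tau> \<epsilon> g" if \<tau>: "\<tau> \<in> tangents \<Gamma> P" and \<epsilon>: "0 < \<epsilon>" "\<epsilon> < r" for \<tau> \<epsilon>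
  proof -
    obtain e t \<sigma> where \<tau>e: "\<tau> = (e, t, \<sigma>)" by (cases \<tau>) auto
    note d = tangents_directions[OF \<tau>, unfolded \<tau>e]
    note D = directionsD[OF d]
    let ?p = "along \<Gamma> (e, t, \<sigma>)"
    \<comment> \<open>Beyond \<open>Q\<close> a length of \<open>(a + 1) * \<epsilon>\<close>
      without chips of \<open>R P\<close> remains, more than the greatest possible loss
      \<open>a * \<epsilon>\<close> between \<open>P\<close> and \<open>Q\<close>.\<close>
    define l where "l = (of_int a + 2) * \<epsilon>"
    have a1: "1 \<le> (of_int a :: real)" using a_ge_1 by linarith
    have "(of_int a + 3) * \<epsilon> < r0"
      using \<epsilon>(2) a1 by (simp add: r_def pos_less_divide_eq mult.commute)
    moreover have "0 < of_int a * \<epsilon>" using \<epsilon>(1) a1 by simp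
    ultimately have l: "\<epsilon> < l" "l < r0" using \<epsilon>(1) unfolding l_def distrib_right by linarith+
    have ray: "0 < t + \<sigma> * s" "t + \<sigma> * s < ell e" "?p s \<notin> special (R P)" if "0 < s" "s \<le> l" for s
      using r0(2) that l \<tau> by (fastforce simp: \<tau>e)+
    have ll: "0 \<le> t + \<sigma> * l" "t + \<sigma> * l \<le> ell e" using ray[of l] l \<epsilon> by auto
    have \<epsilon>\<epsilon>: "0 \<le> t + \<sigma> * \<epsilon>" "t + \<sigma> * \<epsilon> \<le> ell e" using ray[of \<epsilon>] l \<epsilon> by auto
    have RP0: "R P (?p s) = 0" if "0 < s" "s \<le> l" for s
      using ray(3)[OF that] by (simp add: special_def)
    let ?Q = "?p \<epsilon>"
    have Q: "?Q \<in> points \<Gamma>" by (rule along_in_points[OF d])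
    have p0: "?p 0 = P" using tangents_along[OF \<tau>] \<tau>e by simp
    obtain g where g: "integral_germs \<Gamma> g" "\<forall>x\<in>points \<Gamma>. R ?Q x = R P x + ord_at \<Gamma> g x"
      using equiv[OF P Q] unfolding lin_equiv_iff by blast
    have max: "g x \<le> g P" if "x \<in> points \<Gamma>" for x
      by (rule reduced_max_at[OF P reduced[OF P] g(1) _ that]) (use g(2) R_nonneg[OF Q] in auto)
    have "- g x \<le> - g ?Q" if "x \<in> points \<Gamma>" for x
      by (rule reduced_max_at[OF Q reduced[OF Q] integral_germs_uminus[OF g(1)] _ that])
        (use g(2) R_nonneg[OF P] ord_at_uminus[OF g(1)] in auto)
    then have min: "g ?Q \<le> g x" if "x \<in> points \<Gamma>" for x using that by fastforce
    have ordp: "ord_at \<Gamma> g (?p s) = R ?Q (?p s)" if "0 < s" "s \<le> l" for s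
      using g(2) along_in_points[OF d, of s] RP0[OF that] by simp
    have ordp0: "0 \<le> ord_at \<Gamma> g (?p s)" if "0 < s" "s \<le> l" for s
      unfolding ordp[OF that] by (rule R_nonneg[OF Q along_in_points[OF d]])
    have slP: "slope g \<rho> \<le> 0" if "\<rho> \<in> tangents \<Gamma> P" for \<rho>
      by (rule slope_at_max[OF g(1) that max])
    let ?m = "slope g \<tau>"
    have sumP: "ord_at \<Gamma> g P = ?m + (\<Sum>\<rho>\<in>tangents \<Gamma> P - {\<tau>}. slope g \<rho>)"
      unfolding ord_at_def by (rule sum.remove[OF finite_tangents \<tau>])
    have sumle: "(\<Sum>\<rho>\<in>tangents \<Gamma> P - {\<tau>}. slope g \<rho>) \<le> 0"
      by (rule sum_nonpos) (use slP in auto)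
    have ordP: "R ?Q P = a + ord_at \<Gamma> g P" using g(2) P coeff[OF P] by simp
    have RQP: "0 \<le> R ?Q P" by (rule R_nonneg[OF Q P])
    have ma: "- a \<le> ?m" using sumP sumle ordP RQP by linarith
    have supP: "g P + of_int ?m * s \<le> g (?p s)" if "0 \<le> s" "s \<le> l" for s
      using along_support_line[OF g(1) d ll _ that] ordp0 p0 \<tau>e by simp
    have dirs: "(e, t + \<sigma> * s, \<sigma>) \<in> directions \<Gamma>" "(e, t + \<sigma> * s, -\<sigma>) \<in> directions \<Gamma>"
      if "0 < s" "s < l" for s
      using directions_between[OF d ll that] by auto
    have fwd: "g (?p s) + of_int (slope g (e, t + \<sigma> * s, \<sigma>)) * (u - s) \<le> g (?p u)"
      if "0 < s" "s \<le> u" "u \<le> l" "s < l" for s u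
    proof -
      have "g (along \<Gamma> (e, t + \<sigma> * s, \<sigma>) 0) + of_int (slope g (e, t + \<sigma> * s, \<sigma>)) * (u - s)
          \<le> g (along \<Gamma> (e, t + \<sigma> * s, \<sigma>) (u - s))"
      proof (rule along_support_line[OF g(1) dirs(1)[OF that(1,4)], of "l - s"])
        show "0 \<le> ord_at \<Gamma> g (along \<Gamma> (e, t + \<sigma> * s, \<sigma>) s')" if "0 < s'" "s' < l - s" for s'
          using ordp0[of "s + s'"] that \<open>0 < s\<close> by (simp add: algebra_simps)
      qed (use that ll in \<open>auto simp: algebra_simps\<close>)
      then show ?thesis by (simp add: algebra_simps)
    qed
    have bwd: "g (?p s) + of_int (slope g (e, t + \<sigma> * s, -\<sigma>)) * s \<le> g P"
      if "0 < s" "s < l" for s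
    proof -
      have "g (along \<Gamma> (e, t + \<sigma> * s, -\<sigma>) 0) + of_int (slope g (e, t + \<sigma> * s, -\<sigma>)) * s
          \<le> g (along \<Gamma> (e, t + \<sigma> * s, -\<sigma>) s)"
      proof (rule along_support_line[OF g(1) dirs(2)[OF that], of s])
        show "0 \<le> ord_at \<Gamma> g (along \<Gamma> (e, t + \<sigma> * s, -\<sigma>) s')" if "0 < s'" "s' < s" for s'
          using ordp0[of "s - s'"] that \<open>s < l\<close> by (simp add: algebra_simps)
      qed (use that D in \<open>auto simp: algebra_simps\<close>)
      then show ?thesis using p0 by simp
    qed
    let ?k = "slope g (e, t + \<sigma> * \<epsilon>, \<sigma>)" and ?k' = "slope g (e, t + \<sigma> * \<epsilon>, -\<sigma>)"
    have ordQ: "?k + ?k' = a"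
      using ord_at_ep[OF D(1) ray(1,2)[of \<epsilon>] D(4), of g] ordp[of \<epsilon>] coeff[OF Q] l \<epsilon> by simp
    have "0 \<le> ?k"
      by (rule slope_at_min[OF g(1) _ min]) (use dirs(1)[OF \<epsilon>(1) l(1)] in \<open>auto simp: tangents_eq\<close>)
    moreover have "?k \<le> 0"
    proof (rule ccontr)
      assume "\<not> ?k \<le> 0"
      then have k1: "(1::real) \<le> of_int ?k" by linarith
      have "1 * (l - \<epsilon>) \<le> of_int ?k * (l - \<epsilon>)" using k1 l by (intro mult_right_mono) auto
      moreover have "g ?Q + of_int ?k * (l - \<epsilon>) \<le> g (?p l)" by (rule fwd) (use \<epsilon> l in auto)
      moreover have "g (?p l) \<le> g P" by (rule max[OF along_in_points[OF d]])
      ultimately have 1: "g ?Q + (l - \<epsilon>) \<le> g P" by simp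
      have "0 \<le> (of_int ?m + of_int a) * \<epsilon>" using ma \<epsilon> by (intro mult_nonneg_nonneg) linarith+
      moreover have "g P + of_int ?m * \<epsilon> \<le> g ?Q" by (rule supP) (use \<epsilon> l in auto)
      ultimately have "g P \<le> g ?Q + of_int a * \<epsilon>" unfolding distrib_right by simp
      moreover have "l - \<epsilon> = of_int a * \<epsilon> + \<epsilon>" by (simp add: l_def algebra_simps)
      ultimately show False using 1 \<epsilon>(1) by simp
    qed
    ultimately have k0: "?k = 0" by simp
    then have k': "?k' = a" using ordQ by simp
    \<comment> \<open>The support lines at \<open>Q\<close> and at \<open>P\<close> bound the loss
      from both sides. Their agreement forces slope \<open>- a\<close> at \<open>P\<close> and
      leaves nothing for the other directions at \<open>P\<close>.\<close>
    have gQ1: "g ?Q + of_int a * \<epsilon> \<le> g P" using bwd[OF \<epsilon>(1) l(1)] unfolding k' .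
    have gQ2: "g P + of_int ?m * \<epsilon> \<le> g ?Q" by (rule supP) (use \<epsilon> l in auto)
    have "(of_int ?m + of_int a) * \<epsilon> \<le> 0" using gQ1 gQ2 by (simp add: algebra_simps)
    then have "of_int ?m + of_int a \<le> (0::real)" using \<epsilon>(1) by (simp add: mult_le_0_iff)
    then have m: "?m = - a" using ma by linarith
    have gQ: "g ?Q = g P - of_int a * \<epsilon>" using gQ1 gQ2 unfolding m by simp
    have "0 < of_int a * \<epsilon>" using \<epsilon>(1) a1 by simp
    then have glt: "g ?Q < g P" using gQ by simp
    have "(\<Sum>\<rho>\<in>tangents \<Gamma> P - {\<tau>}. slope g \<rho>) = 0" using sumP ordP RQP sumle m by linarith
    then have others: "\<forall>\<rho>\<in>tangents \<Gamma> P - {\<tau>}. slope g \<rho> = 0"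
      using sum_nonpos_all_0[of "tangents \<Gamma> P - {\<tau>}" "slope g"] slP by simp
    \<comment> \<open>At \<open>P\<close> itself all \<open>a\<close> chips have left. In between,
      the forward slope is at most \<open>- a\<close> and the backward slope at most
      \<open>a\<close>, so the nonnegative order is 0.\<close>
    have RQ0: "R ?Q (?p s) = 0" if s: "0 \<le> s" "s < \<epsilon>" for s
    proof (cases "s = 0")
      case True
      then show ?thesis using p0 ordP sumP m \<open>(\<Sum>\<rho>\<in>tangents \<Gamma> P - {\<tau>}. slope g \<rho>) = 0\<close> by simp
    next
      case False
      then have s0: "0 < s" "s < l" using s l by auto
      let ?q = "slope g (e, t + \<sigma> * s, \<sigma>)" and ?q' = "slope g (e, t + \<sigma> * s, -\<sigma>)"
      have 1: "g (?p s) + of_int ?q * (\<epsilon> - s) \<le> g ?Q" by (rule fwd) (use s s0 l in auto)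
      have 2: "g (?p s) + of_int ?q' * s \<le> g P" by (rule bwd[OF s0])
      have 3: "g P - of_int a * s \<le> g (?p s)" using supP[of s] s0 unfolding m by simp
      have "(of_int ?q + of_int a) * (\<epsilon> - s) \<le> 0" using 1 3 gQ by (simp add: algebra_simps)
      then have "of_int ?q + of_int a \<le> (0::real)" using s by (simp add: mult_le_0_iff)
      moreover have "(of_int ?q' - of_int a) * s \<le> 0" using 2 3 by (simp add: algebra_simps)
      then have "of_int ?q' - of_int a \<le> (0::real)" using s0 by (simp add: mult_le_0_iff)
      ultimately have "?q + ?q' \<le> 0" by linarith
      moreover have "ord_at \<Gamma> g (?p s) = ?q + ?q'"
        using ord_at_ep[OF D(1) ray(1,2)[of s] D(4), of g] s0 by simp
      ultimately show ?thesis using ordp[of s] ordp0[of s] s0 by simp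
    qed
    have "moves P \<tau> \<epsilon> g"
      unfolding moves_def \<tau>e prod.case
      using g \<epsilon>(1) max min glt others[unfolded \<tau>e] k0 ray(1,2) RQ0 RP0 l(1) by auto
    then show ?thesis by blast
  qed
  ultimately show ?thesis by blast
qed

text \<open>The level set of \<open>c\<close> is relatively open in \<open>K\<close>, because the
  only way to leave it locally is through \<open>S\<close>, which \<open>K\<close> avoids; it is
  relatively closed by continuity.\<close>

lemma connected_level:
  assumes g: "integral_germs \<Gamma> g" and K: "connectedin CT K" "x0 \<in> K" "g x0 = c"
    and S: "K \<inter> S = {}"
    and loc: "\<And>z \<rho>. z \<in> K \<Longrightarrow> g z = c \<Longrightarrow> \<rho> \<in> tangents \<Gamma> z \<Longrightarrow>
      \<forall>\<^sub>F s in at_right 0. g (along \<Gamma> \<rho> s) = c \<or> along \<Gamma> \<rho> s \<in> S"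
    and x: "x \<in> K"
  shows "g x = c"
proof (rule ccontr)
  assume "g x \<noteq> c"
  define Q where "Q y \<longleftrightarrow> g y = c \<or> y \<in> S" for y
  define U where "U = {y \<in> points \<Gamma>. Q y \<and> (\<forall>\<tau>\<in>tangents \<Gamma> y. \<forall>\<^sub>F s in at_right 0. Q (along \<Gamma> \<tau> s))}"
  have "openin CT U" unfolding U_def by (rule openin_star_interior)
  moreover define V where "V = {y \<in> points \<Gamma>. g y \<in> - {c}}"
  have "openin CT V"
    unfolding V_def using openin_continuous_map_preimage[OF integral_germs_continuous[OF g], of "- {c}"]
    by (simp add: open_Compl)
  moreover have Kp: "K \<subseteq> points \<Gamma>" using connectedin_subset_topspace[OF K(1)] by simp
  have KU: "z \<in> U" if "z \<in> K" "g z = c" for z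
    using that Kp loc by (auto simp: U_def Q_def)
  then have "K \<subseteq> U \<union> V" using Kp by (auto simp: V_def)
  moreover have "U \<inter> V \<inter> K = {}" using S by (auto simp: U_def V_def Q_def)
  moreover have "U \<inter> K \<noteq> {}" using KU K(2,3) by blast
  moreover have "x \<in> V \<inter> K" using x Kp \<open>g x \<noteq> c\<close> by (auto simp: V_def)
  then have "V \<inter> K \<noteq> {}" by blast
  ultimately show False using connectedinD[OF K(1)] by metis
qed



text \<open>At a point of \<open>K\<close> other than \<open>P\<close> where \<open>g\<close> is
  maximal there is no chip of \<open>R P\<close>, so the order is nonnegative while all slopes are
  at most 0: they all vanish. At \<open>P\<close> only the direction \<open>\<tau>\<close> has
  nonzero slope, and it enters the segment that \<open>K\<close> avoids. Hence \<open>g\<close> is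
  maximal on \<open>K\<close>, and off \<open>P\<close> the divisors agree there.\<close>

lemma sweep_from:
  assumes P: "P \<in> points \<Gamma>" and \<tau>: "\<tau> \<in> tangents \<Gamma> P" and mv: "moves P \<tau> \<epsilon> g"
    and K: "connectedin CT K" "K \<inter> along \<Gamma> \<tau> ` {0<..<\<epsilon>} = {}" "P \<in> K" "\<And>x. x \<in> K \<Longrightarrow> rest P x = 0"
  shows "along \<Gamma> \<tau> \<epsilon> \<notin> K" "\<And>x. x \<in> K \<Longrightarrow> rest (along \<Gamma> \<tau> \<epsilon>) x = 0"
proof -
  obtain e t \<sigma> where \<tau>e: "\<tau> = (e, t, \<sigma>)" by (cases \<tau>) auto
  let ?Q = "along \<Gamma> \<tau> \<epsilon>"
  have g: "integral_germs \<Gamma> g" "0 < \<epsilon>" "\<And>x. x \<in> points \<Gamma> \<Longrightarrow> R ?Q x = R P x + ord_at \<Gamma> g x"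
    "\<And>x. x \<in> points \<Gamma> \<Longrightarrow> g x \<le> g P" "g ?Q < g P" "\<And>\<rho>. \<rho> \<in> tangents \<Gamma> P \<Longrightarrow> \<rho> \<noteq> \<tau> \<Longrightarrow> slope g \<rho> = 0"
    "R ?Q P = 0"
    using mv tangents_along[OF \<tau>] by (auto simp: moves_def \<tau>e)
  have Q: "?Q \<in> points \<Gamma>" by (rule along_in_points[OF tangents_directions[OF \<tau>]])
  have Kp: "K \<subseteq> points \<Gamma>" using connectedin_subset_topspace[OF K(1)] by simp
  have at: "ord_at \<Gamma> g z = 0 \<and> (\<forall>\<rho>\<in>tangents \<Gamma> z. slope g \<rho> = 0)" if z: "z \<in> K" "g z = g P" "z \<noteq> P" for z
  proof -
    have zp: "z \<in> points \<Gamma>" using z Kp by blast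
    have mx: "slope g \<rho> \<le> 0" if "\<rho> \<in> tangents \<Gamma> z" for \<rho>
      by (rule slope_at_max[OF g(1) that]) (use g(4) z in simp)
    have "R P z = 0" using K(4)[OF z(1)] z(3) by (simp add: rest_other)
    then have ge: "0 \<le> ord_at \<Gamma> g z" using g(3)[OF zp] R_nonneg[OF Q zp] by simp
    have "ord_at \<Gamma> g z \<le> 0" unfolding ord_at_def by (rule sum_nonpos) (use mx in auto)
    then have ord0: "ord_at \<Gamma> g z = 0" using ge by simp
    have "slope g \<rho> = 0" if "\<rho> \<in> tangents \<Gamma> z" for \<rho>
      by (rule sum_nonpos_all_0[OF finite_tangents mx _ that]) (use ord0 in \<open>simp_all add: ord_at_def\<close>)
    then show ?thesis using ord0 by blast
  qed
  have level: "g x = g P" if x: "x \<in> K" for x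
  proof (rule connected_level[OF g(1) K(1) K(3) refl K(2) _ x])
    fix z \<rho> assume z: "z \<in> K" "g z = g P" and \<rho>: "\<rho> \<in> tangents \<Gamma> z"
    show "\<forall>\<^sub>F s in at_right 0. g (along \<Gamma> \<rho> s) = g P \<or> along \<Gamma> \<rho> s \<in> along \<Gamma> \<tau> ` {0<..<\<epsilon>}"
    proof (cases "z = P \<and> \<rho> = \<tau>")
      case True
      have "\<forall>\<^sub>F s in at_right 0. 0 < s \<and> s < \<epsilon>"
        unfolding eventually_at_right_0 using g(2) by blast
      then show ?thesis using True by (auto elim: eventually_mono)
    next
      case False
      then have "slope g \<rho> = 0" using at[OF z] g(6) \<rho> by (cases "z = P") auto
      from slope_0_eventually[OF g(1) \<rho> this] show ?thesis
        using z(2) by (auto elim: eventually_mono)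
    qed
  qed
  show "?Q \<notin> K" using level[of ?Q] g(5) by auto
  show "rest ?Q x = 0" if x: "x \<in> K" for x
  proof (cases "x = P \<or> x = ?Q")
    case True
    then show ?thesis using g(7) by (cases "x = ?Q") (auto simp: rest_other)
  next
    case False
    moreover have "x \<in> points \<Gamma>" using x Kp by blast
    ultimately show ?thesis
      using g(3)[of x] at[OF x level[OF x]] K(4)[OF x] by (simp add: rest_other)
  qed
qed

text \<open>The mirror image with minima, for use when the chips are controlled for the end
  \<open>Q\<close> of the move. At \<open>Q\<close> only the direction back to \<open>P\<close> has
  nonzero slope.\<close>

lemma sweep_to:
  assumes P: "P \<in> points \<Gamma>" and \<tau>: "\<tau> \<in> tangents \<Gamma> P" and mv: "moves P \<tau> \<epsilon> g"
    and K: "connectedin CT K" "K \<inter> along \<Gamma> \<tau> ` {0<..<\<epsilon>} = {}" "along \<Gamma> \<tau> \<epsilon> \<in> K"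
      "\<And>x. x \<in> K \<Longrightarrow> rest (along \<Gamma> \<tau> \<epsilon>) x = 0"
    and x: "x \<in> K"
  shows "rest P x = 0"
proof -
  obtain e t \<sigma> where \<tau>e: "\<tau> = (e, t, \<sigma>)" by (cases \<tau>) auto
  note D = directionsD[OF tangents_directions[OF \<tau>, unfolded \<tau>e]]
  let ?Q = "along \<Gamma> \<tau> \<epsilon>"
  have g: "integral_germs \<Gamma> g" "0 < \<epsilon>" "\<And>x. x \<in> points \<Gamma> \<Longrightarrow> R ?Q x = R P x + ord_at \<Gamma> g x"
    "\<And>x. x \<in> points \<Gamma> \<Longrightarrow> g ?Q \<le> g x" "g ?Q < g P" "slope g (e, t + \<sigma> * \<epsilon>, \<sigma>) = 0"
    "R P ?Q = 0" "0 < t + \<sigma> * \<epsilon>" "t + \<sigma> * \<epsilon> < ell e"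
    using mv by (auto simp: moves_def \<tau>e)
  have Q: "?Q \<in> points \<Gamma>" by (rule along_in_points[OF tangents_directions[OF \<tau>]])
  have Kp: "K \<subseteq> points \<Gamma>" using connectedin_subset_topspace[OF K(1)] by simp
  have at: "ord_at \<Gamma> g z = 0 \<and> (\<forall>\<rho>\<in>tangents \<Gamma> z. slope g \<rho> = 0)" if z: "z \<in> K" "g z = g ?Q" "z \<noteq> ?Q" for z
  proof -
    have zp: "z \<in> points \<Gamma>" using z Kp by blast
    have mn: "0 \<le> slope g \<rho>" if "\<rho> \<in> tangents \<Gamma> z" for \<rho>
      by (rule slope_at_min[OF g(1) that]) (use g(4) z in simp)
    have "R ?Q z = 0" using K(4)[OF z(1)] z(3) by (simp add: rest_other)
    then have le: "ord_at \<Gamma> g z \<le> 0" using g(3)[OF zp] R_nonneg[OF P zp] by simp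
    have "0 \<le> ord_at \<Gamma> g z" unfolding ord_at_def by (rule sum_nonneg) (use mn in auto)
    then have "ord_at \<Gamma> g z = 0" using le by simp
    then show ?thesis
      using sum_nonneg_eq_0_iff[of "tangents \<Gamma> z" "slope g"] mn by (auto simp: ord_at_def)
  qed
  have Qt: "tangents \<Gamma> ?Q = {(e, t + \<sigma> * \<epsilon>, \<sigma>), (e, t + \<sigma> * \<epsilon>, -\<sigma>)}"
    unfolding \<tau>e along_simp by (rule tangents_ep[OF D(1) g(8,9) D(4)])
  have level: "g x = g ?Q" if x: "x \<in> K" for x
  proof (rule connected_level[OF g(1) K(1) K(3) refl K(2) _ x])
    fix z \<rho> assume z: "z \<in> K" "g z = g ?Q" and \<rho>: "\<rho> \<in> tangents \<Gamma> z"
    show "\<forall>\<^sub>F s in at_right 0. g (along \<Gamma> \<rho> s) = g ?Q \<or> along \<Gamma> \<rho> s \<in> along \<Gamma> \<tau> ` {0<..<\<epsilon>}"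
    proof (cases "z = ?Q \<and> \<rho> = (e, t + \<sigma> * \<epsilon>, -\<sigma>)")
      case True
      have "\<forall>\<^sub>F s in at_right 0. 0 < s \<and> s < \<epsilon>"
        unfolding eventually_at_right_0 using g(2) by blast
      then show ?thesis
      proof eventually_elim
        case (elim s)
        have "along \<Gamma> \<rho> s = along \<Gamma> \<tau> (\<epsilon> - s)" using True by (simp add: \<tau>e algebra_simps)
        then show ?case using elim by auto
      qed
    next
      case False
      then have "slope g \<rho> = 0" using at[OF z] g(6) \<rho> Qt by (cases "z = ?Q") auto
      from slope_0_eventually[OF g(1) \<rho> this] show ?thesis
        using z(2) by (auto elim: eventually_mono)
    qed
  qed
  show "rest P x = 0"
  proof (cases "x = P \<or> x = ?Q")
    case True
    then show ?thesis using g(7) by (cases "x = P") (auto simp: rest_other)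
  next
    case False
    moreover have "x \<in> points \<Gamma>" using x Kp by blast
    ultimately show ?thesis
      using g(3)[of x] at[OF x level[OF x]] K(4)[OF x] by (simp add: rest_other)
  qed
qed

text \<open>The base point travels backwards along the edge, and the set known to be free of other
  chips grows with it. The infimum of the base points treated is reached by \<open>limit\<close>,
  and \<open>step\<close> shows that it must be 0.\<close>

lemma along_edge:
  assumes d: "(e, t0, \<sigma>) \<in> directions \<Gamma>" and full: "t0 + \<sigma> * ell e \<in> {0, ell e}"
    and Z: "connectedin CT Z" "along \<Gamma> (e, t0, \<sigma>) (ell e) \<in> Z"
      "Z \<inter> along \<Gamma> (e, t0, \<sigma>) ` {0<..<ell e} = {}"
      "\<And>z. z \<in> Z \<Longrightarrow> rest (along \<Gamma> (e, t0, \<sigma>) (ell e)) z = 0"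
    and x: "x \<in> along \<Gamma> (e, t0, \<sigma>) ` {0..ell e} \<union> Z"
  shows "rest (along \<Gamma> (e, t0, \<sigma>) 0) x = 0"
proof -
  note D = directionsD[OF d]
  let ?p = "along \<Gamma> (e, t0, \<sigma>)" and ?l = "ell e"
  have l0: "0 < ?l" by (rule len_pos[OF D(1)])
  have full': "0 \<le> t0 + \<sigma> * ?l" "t0 + \<sigma> * ?l \<le> ?l" using full l0 by auto
  have inn: "0 < t0 + \<sigma> * s" "t0 + \<sigma> * s < ?l" if "0 < s" "s < ?l" for s
    using along_between[OF d full' that] by auto
  have pin: "?p s = Inner e (t0 + \<sigma> * s)" if "0 < s" "s < ?l" for s
    using inn[OF that] by simp
  have pts: "?p s \<in> points \<Gamma>" for s by (rule along_in_points[OF d])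
  \<comment> \<open>One parameter has to be interior: on a loop the two ends of the edge are the
    same point.\<close>
  have pinj: "s = s'" if "?p s = ?p s'" "0 < s" "s < ?l" "0 \<le> s'" "s' \<le> ?l" for s s'
  proof -
    have "ep e (t0 + \<sigma> * s') = Inner e (t0 + \<sigma> * s)" using that(1) pin[OF that(2,3)] by simp
    then have "t0 + \<sigma> * s' = t0 + \<sigma> * s" using ep_eq_InnerD by blast
    then show ?thesis using D(4) by auto
  qed
  have tan_fwd: "(e, t0 + \<sigma> * s, \<sigma>) \<in> tangents \<Gamma> (?p s)" if "0 \<le> s" "s < ?l" for s
    using directions_between(1)[OF d full', of s] that d by (cases "s = 0") (auto simp: tangents_eq)
  have tan_bwd: "(e, t0 + \<sigma> * s, -\<sigma>) \<in> tangents \<Gamma> (?p s)" if "0 < s" "s \<le> ?l" for s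
    using directions_between(2)[OF d full', of s] direction_end[OF d full' l0] that
    by (cases "s = ?l") (auto simp: tangents_eq)
  \<comment> \<open>What the base point at \<open>s\<close> has left behind, together with
    \<open>Z\<close>. The part of the edge still ahead lies outside it by
    \<open>Kdisj\<close>.\<close>
  define K where "K s = ?p ` {s..?l} \<union> Z" for s
  define N where "N s \<longleftrightarrow> (\<forall>x\<in>K s. rest (?p s) x = 0)" for s
  have Kcon: "connectedin CT (K s)" if s: "0 \<le> s" "s \<le> ?l" for s
  proof -
    have "connectedin CT (?p ` {s..?l})"
    proof (cases "s = ?l")
      case False
      then have dd: "(e, t0 + \<sigma> * s, \<sigma>) \<in> directions \<Gamma>"
        using tan_fwd[OF s(1)] s tangents_directions by force
      have "connectedin CT (along \<Gamma> (e, t0 + \<sigma> * s, \<sigma>) ` {0..?l - s})"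
        by (rule connectedin_along[OF dd]) (use full' in \<open>auto simp: algebra_simps\<close>)
      moreover have "along \<Gamma> (e, t0 + \<sigma> * s, \<sigma>) ` {0..?l - s} = ?p ` {s..?l}"
      proof -
        have "along \<Gamma> (e, t0 + \<sigma> * s, \<sigma>) ` {0..?l - s} = ?p ` ((\<lambda>u. s + u) ` {0..?l - s})"
          unfolding image_image by (rule image_cong) (auto simp: algebra_simps)
        then show ?thesis by simp
      qed
      ultimately show ?thesis by simp
    qed (use pts[of ?l] in \<open>simp add: connectedin_sing\<close>)
    moreover have "?p ?l \<in> ?p ` {s..?l} \<inter> Z" using Z(2) s by (auto simp del: along_simp)
    ultimately show ?thesis
      unfolding K_def using Z(1) by (intro connectedin_Un) blast+
  qed
  have Kdisj: "?p u \<notin> K s" if "0 < u" "u < s" "s \<le> ?l" for u s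
  proof
    assume "?p u \<in> K s"
    moreover have "?p u \<notin> Z"
    proof -
      have "?p u \<in> ?p ` {0<..<?l}" using that by auto
      then show ?thesis using Z(3) by blast
    qed
    ultimately obtain s' where "s' \<in> {s..?l}" "?p u = ?p s'" unfolding K_def by blast
    then show False using pinj[of u s'] that by auto
  qed
  have N1: "N ?l" using Z(4) by (auto simp: N_def K_def)
  have step: "N (i - \<epsilon>)" if i: "0 < i" "i \<le> ?l" "N i" and \<epsilon>: "0 < \<epsilon>" "\<epsilon> < i"
    and mv: "moves (?p i) (e, t0 + \<sigma> * i, -\<sigma>) \<epsilon> g" for i \<epsilon> g
  proof -
    let ?\<rho> = "(e, t0 + \<sigma> * i, -\<sigma>)"
    have \<rho>s: "along \<Gamma> ?\<rho> s = ?p (i - s)" for s by (simp add: algebra_simps)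
    have "K i \<inter> along \<Gamma> ?\<rho> ` {0<..<\<epsilon>} = {}"
      unfolding \<rho>s using Kdisj[of _ i] i \<epsilon> by (auto simp del: along_simp)
    moreover have "?p i \<in> K i" using i by (auto simp: K_def simp del: along_simp)
    moreover have "rest (?p i) y = 0" if "y \<in> K i" for y
      using i(3) that by (simp add: N_def)
    ultimately have sw: "rest (?p (i - \<epsilon>)) y = 0" if "y \<in> K i" for y
      using sweep_from(2)[OF pts tan_bwd[OF i(1,2)] mv Kcon[of i]] i that unfolding \<rho>s by simp
    have "rest (?p (i - \<epsilon>)) (?p u) = 0" if u: "i - \<epsilon> \<le> u" "u \<le> ?l" for u
    proof -
      consider "u = i - \<epsilon>" | "i - \<epsilon> < u" "u \<le> i" | "i \<le> u" using u by linarith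
      then show ?thesis
      proof cases
        \<comment> \<open>These points lie on the segment just traversed and not in
          \<open>K i\<close>; there \<open>moves\<close> itself states that the new divisor has no
          chip.\<close>
        case 2
        have ne: "?p u \<noteq> ?p (i - \<epsilon>)" using pinj[of "i - \<epsilon>" u] 2 i \<epsilon> u by auto
        have "R (along \<Gamma> ?\<rho> \<epsilon>) (along \<Gamma> ?\<rho> (i - u)) = 0"
          using mv 2 unfolding moves_def by auto
        then have "R (?p (i - \<epsilon>)) (?p u) = 0" unfolding \<rho>s by simp
        then show ?thesis using ne by (simp add: rest_other)
      next
        case 3
        then have "?p u \<in> K i" using u by (auto simp: K_def simp del: along_simp)
        then show ?thesis by (rule sw)
      qed simp
    qed
    moreover have "rest (?p (i - \<epsilon>)) y = 0" if "y \<in> Z" for y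
      by (rule sw) (use that in \<open>simp add: K_def\<close>)
    ultimately show ?thesis unfolding N_def K_def by (auto simp del: along_simp)
  qed
  have limit: "N i" if i: "0 \<le> i" "0 < \<epsilon>" "i + \<epsilon> \<le> ?l" "N (i + \<epsilon>)"
    and mv: "moves (?p i) (e, t0 + \<sigma> * i, \<sigma>) \<epsilon> g" for i \<epsilon> g
  proof -
    let ?\<rho> = "(e, t0 + \<sigma> * i, \<sigma>)"
    have \<rho>s: "along \<Gamma> ?\<rho> s = ?p (i + s)" for s by (simp add: algebra_simps)
    have "K (i + \<epsilon>) \<inter> along \<Gamma> ?\<rho> ` {0<..<\<epsilon>} = {}"
      unfolding \<rho>s using Kdisj[of _ "i + \<epsilon>"] i by (auto simp del: along_simp)
    moreover have "?p (i + \<epsilon>) \<in> K (i + \<epsilon>)" using i by (auto simp: K_def simp del: along_simp)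
    moreover have "rest (?p (i + \<epsilon>)) y = 0" if "y \<in> K (i + \<epsilon>)" for y
      using i(4) that by (simp add: N_def)
    moreover have "i < ?l" using i by simp
    ultimately have sw: "rest (?p i) y = 0" if "y \<in> K (i + \<epsilon>)" for y
      using sweep_to[OF pts tan_fwd[OF i(1)] mv Kcon[of "i + \<epsilon>"]] i that unfolding \<rho>s by simp
    have "rest (?p i) (?p u) = 0" if u: "i \<le> u" "u \<le> ?l" for u
    proof -
      consider "u = i" | "i < u" "u < i + \<epsilon>" | "i + \<epsilon> \<le> u" using u by linarith
      then show ?thesis
      proof cases
        case 2
        have ne: "?p u \<noteq> ?p i" using pinj[of u i] 2 i u by auto
        have "R (?p i) (along \<Gamma> ?\<rho> (u - i)) = 0"
          using mv 2 unfolding moves_def by auto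
        then have "R (?p i) (?p u) = 0" unfolding \<rho>s by simp
        then show ?thesis using ne by (simp add: rest_other)
      next
        case 3
        then have "?p u \<in> K (i + \<epsilon>)" using u by (auto simp: K_def simp del: along_simp)
        then show ?thesis by (rule sw)
      qed simp
    qed
    moreover have "rest (?p i) y = 0" if "y \<in> Z" for y
      by (rule sw) (use that in \<open>simp add: K_def\<close>)
    ultimately show ?thesis unfolding N_def K_def by (auto simp del: along_simp)
  qed
  define A where "A = {s \<in> {0..?l}. N s}"
  define i where "i = Inf A"
  have lA: "?l \<in> A" using N1 l0 by (simp add: A_def)
  have bA: "bdd_below A" by (rule bdd_belowI[of _ 0]) (simp add: A_def)
  have i: "0 \<le> i" "i \<le> ?l"
    unfolding i_def using lA bA by (auto intro!: cInf_greatest cInf_lower simp: A_def)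
  obtain r where r: "r > 0" "\<forall>\<tau>\<in>tangents \<Gamma> (?p i). \<forall>\<epsilon>. 0 < \<epsilon> \<and> \<epsilon> < r \<longrightarrow> (\<exists>g. moves (?p i) \<tau> \<epsilon> g)"
    using ex_moves[OF pts] by blast
  have "N i"
  proof (cases "i \<in> A")
    case False
    \<comment> \<open>The radius \<open>r\<close> belongs to the infimum, so the move starts at
      \<open>i\<close> and ends at a treated point. The information flows from the end to the start,
      hence \<open>sweep_to\<close> inside \<open>limit\<close>.\<close>
    have "\<exists>s\<in>A. s < i + r" using cInf_lessD[of A "i + r"] lA r(1) by (auto simp: i_def)
    then obtain s where s: "s \<in> A" "s < i + r" by blast
    have "i \<le> s" unfolding i_def by (rule cInf_lower[OF s(1) bA])
    then have "i < s" using False s(1) by (cases "i = s") auto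
    then have "i < ?l" "0 < s - i \<and> s - i < r" using s by (auto simp: A_def)
    then obtain g where "moves (?p i) (e, t0 + \<sigma> * i, \<sigma>) (s - i) g"
      using r(2) tan_fwd[OF i(1)] by blast
    then show ?thesis using limit[OF i(1), of "s - i" g] s \<open>i < s\<close> by (simp add: A_def)
  qed (simp add: A_def)
  have "i = 0"
  proof (rule ccontr)
    assume "i \<noteq> 0"
    then have i0: "0 < i" using i by simp
    define \<epsilon> where "\<epsilon> = min r i / 2"
    have \<epsilon>: "0 < \<epsilon>" "\<epsilon> < r" "\<epsilon> < i" using i0 r(1) by (auto simp: \<epsilon>_def)
    then obtain g where "moves (?p i) (e, t0 + \<sigma> * i, -\<sigma>) \<epsilon> g"
      using r(2) tan_bwd[OF i0 i(2)] by (auto simp del: along_simp)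
    then have "N (i - \<epsilon>)" using step[OF i0 i(2) \<open>N i\<close> \<epsilon>(1,3)] by blast
    then have "i - \<epsilon> \<in> A" using \<epsilon> i by (simp add: A_def)
    then have "i \<le> i - \<epsilon>" unfolding i_def by (rule cInf_lower[OF _ bA])
    then show False using \<epsilon>(1) by simp
  qed
  then have "N 0" using \<open>N i\<close> by simp
  then show ?thesis using x by (simp add: N_def K_def)
qed

end

section \<open>Trails and cycles\<close>

context tropical
begin

text \<open>An edge with a Boolean is an oriented edge: \<open>True\<close> runs from tail to head,
  so trails may traverse arcs against their direction.\<close>

definition src :: "'e \<times> bool \<Rightarrow> 'v" where
  "src eb = (if snd eb then tl_e (fst eb) else hd_e (fst eb))"

definition dst :: "'e \<times> bool \<Rightarrow> 'v" where
  "dst eb = (if snd eb then hd_e (fst eb) else tl_e (fst eb))"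

text \<open>Edges are not repeated, vertices may be. This is what \<open>along_edge\<close> needs:
  the open edge being traversed is disjoint from the rest of the trail.\<close>

fun trail :: "'v \<Rightarrow> ('e \<times> bool) list \<Rightarrow> 'v \<Rightarrow> bool" where
  "trail x [] y \<longleftrightarrow> x = y \<and> x \<in> verts (model \<Gamma>)"
| "trail x (eb # p) y \<longleftrightarrow> fst eb \<in> edges \<Gamma> \<and> src eb = x \<and> fst eb \<notin> fst ` set p \<and> trail (dst eb) p y"

text \<open>The inserted vertex matters for the empty trail, the base case of the induction in
  \<open>rest_trail\<close>.\<close>

definition support :: "'v \<Rightarrow> ('e \<times> bool) list \<Rightarrow> ('v, 'e) point set" where
  "support x p = insert (Vertex x) (\<Union>e\<in>fst ` set p. ep e ` {0..ell e})"

lemma Vertex_in_support: "Vertex x \<in> support x p"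
  by (simp add: support_def)

lemma connectedin_edge:
  assumes "e \<in> edges \<Gamma>"
  shows "connectedin CT (ep e ` {0..ell e})"
  by (rule connectedin_continuous_map_image[OF continuous_map_ep[OF assms]])
    (simp add: connectedin_subtopology)

lemma ends_in_edge:
  assumes "fst eb \<in> edges \<Gamma>"
  shows "Vertex (src eb) \<in> ep (fst eb) ` {0..ell (fst eb)}" "Vertex (dst eb) \<in> ep (fst eb) ` {0..ell (fst eb)}"
proof -
  let ?e = "fst eb"
  have "0 \<in> {0..ell ?e}" "ell ?e \<in> {0..ell ?e}" using len_pos[OF assms] by auto
  then have "ep ?e 0 \<in> ep ?e ` {0..ell ?e}" "ep ?e (ell ?e) \<in> ep ?e ` {0..ell ?e}"
    by blast+
  then show "Vertex (src eb) \<in> ep ?e ` {0..ell ?e}" "Vertex (dst eb) \<in> ep ?e ` {0..ell ?e}"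
    using assms by (auto simp: src_def dst_def)
qed

lemma support_Cons:
  assumes "fst eb \<in> edges \<Gamma>"
  shows "support (src eb) (eb # p) = ep (fst eb) ` {0..ell (fst eb)} \<union> support (dst eb) p"
  using ends_in_edge[OF assms] by (auto simp: support_def)



lemma connectedin_support: "trail x p y \<Longrightarrow> connectedin CT (support x p)"
proof (induction p arbitrary: x)
  case Nil
  then show ?case by (auto simp: support_def connectedin_sing points_def)
next
  case (Cons eb p)
  then have e: "fst eb \<in> edges \<Gamma>" and x: "src eb = x" and tr: "trail (dst eb) p y" by auto
  have "Vertex (dst eb) \<in> ep (fst eb) ` {0..ell (fst eb)} \<inter> support (dst eb) p"
    using ends_in_edge[OF e] Vertex_in_support by blast
  then show ?case
    unfolding x[symmetric] support_Cons[OF e]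
    by (intro connectedin_Un connectedin_edge[OF e] Cons.IH[OF tr]) blast
qed

lemma trail_end_in_support: "trail x p y \<Longrightarrow> Vertex y \<in> support x p"
proof (induction p arbitrary: x)
  case (Cons eb p)
  then have e: "fst eb \<in> edges \<Gamma>" and x: "src eb = x" and tr: "trail (dst eb) p y" by auto
  show ?case unfolding x[symmetric] support_Cons[OF e] using Cons.IH[OF tr] by blast
qed (simp add: support_def)

lemma support_Inner:
  assumes "Inner e t \<in> support x p"
  shows "e \<in> fst ` set p"
  using assms unfolding support_def by (auto simp: image_iff dest!: ep_eq_InnerD[OF sym])

text \<open>Both orientations of each edge are included, so the closure describes undirected
  connectedness by edges of \<open>A\<close>.\<close>

definition adj :: "'e set \<Rightarrow> ('v \<times> 'v) set" where
  "adj A = {(src eb, dst eb) | eb. fst eb \<in> A}"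

text \<open>A walk is turned into a trail from its end. If the edge to be prepended already occurs,
  its start \<open>u\<close> is an end of that occurrence, so a suffix of the trail begins at
  \<open>u\<close>.\<close>

lemma rtrancl_adj_trail:
  assumes "(u, v) \<in> (adj A)\<^sup>*" "A \<subseteq> edges \<Gamma>" "v \<in> verts (model \<Gamma>)"
  shows "\<exists>p. trail u p v \<and> fst ` set p \<subseteq> A"
  using assms(1)
proof (induction rule: converse_rtrancl_induct)
  case base
  then show ?case using assms(3) by (intro exI[of _ "[]"]) simp
next
  case (step u w)
  then obtain p eb where p: "trail w p v" "fst ` set p \<subseteq> A" and eb: "fst eb \<in> A" "u = src eb" "w = dst eb"
    by (auto simp: adj_def)
  show ?case
  proof (cases "fst eb \<in> fst ` set p")
    case False
    then show ?thesis using p eb assms(2) by (intro exI[of _ "eb # p"]) auto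
  next
    case True
    have suffix: "\<exists>q. trail u q y \<and> fst ` set q \<subseteq> fst ` set p" if "trail x p y" "fst eb \<in> fst ` set p" for x y p
      using that
    proof (induction p arbitrary: x)
      case (Cons fb p)
      show ?case
      proof (cases "fst eb = fst fb")
        case True
        then have "u = src fb \<or> u = dst fb" using eb(2) by (auto simp: src_def dst_def)
        then show ?thesis
        proof
          assume "u = src fb"
          then show ?thesis using Cons.prems by (intro exI[of _ "fb # p"]) auto
        next
          assume "u = dst fb"
          then show ?thesis using Cons.prems by (intro exI[of _ p]) auto
        qed
      next
        case False
        then have "trail (dst fb) p y" "fst eb \<in> fst ` set p" using Cons.prems by auto
        from Cons.IH[OF this] obtain q where "trail u q y" "fst ` set q \<subseteq> fst ` set p" by blast
        then show ?thesis by (intro exI[of _ q]) auto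
      qed
    qed simp
    show ?thesis using suffix[OF p(1) True] p(2) by blast
  qed
qed

text \<open>Edges are added one at a time to a forest whose components carry labels. An edge between
  different labels merges two of them, which lowers the number of labels by one; an edge whose ends
  are already joined closes a cycle.\<close>

lemma cycle_or_labelling:
  assumes "finite A" "A \<subseteq> edges \<Gamma>"
  shows "(\<exists>e\<in>A. (hd_e e, tl_e e) \<in> (adj (A - {e}))\<^sup>*) \<or>
    (\<exists>L :: 'v \<Rightarrow> 'v. (\<forall>u\<in>verts (model \<Gamma>). \<forall>v\<in>verts (model \<Gamma>). L u = L v \<longrightarrow> (u, v) \<in> (adj A)\<^sup>*) \<and>
       card (L ` verts (model \<Gamma>)) + card A = card (verts (model \<Gamma>)))"
  using assms
proof (induction A rule: finite_induct)
  case empty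
  then show ?case by (intro disjI2 exI[of _ id]) auto
next
  case (insert e A)
  let ?V = "verts (model \<Gamma>)" and ?u = "tl_e e" and ?w = "hd_e e"
  have e: "e \<in> edges \<Gamma>" using insert.prems by simp
  have mono: "(adj B)\<^sup>* \<subseteq> (adj C)\<^sup>*" if "B \<subseteq> C" for B C
    by (rule rtrancl_mono) (use that in \<open>auto simp: adj_def\<close>)
  show ?case
  proof (cases "(?w, ?u) \<in> (adj A)\<^sup>*")
    case True
    moreover have "insert e A - {e} = A" using insert.hyps by auto
    ultimately show ?thesis by auto
  next
    case nreach: False
    from insert.IH insert.prems consider
      e' where "e' \<in> A" "(hd_e e', tl_e e') \<in> (adj (A - {e'}))\<^sup>*"
      | L :: "'v \<Rightarrow> 'v" where "\<forall>u\<in>?V. \<forall>v\<in>?V. L u = L v \<longrightarrow> (u, v) \<in> (adj A)\<^sup>*"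
        "card (L ` ?V) + card A = card ?V"
      by auto
    then show ?thesis
    proof cases
      case 1
      then have "(hd_e e', tl_e e') \<in> (adj (insert e A - {e'}))\<^sup>*"
        using mono[of "A - {e'}" "insert e A - {e'}"] by auto
      then show ?thesis using 1 by auto
    next
      case 2
      have V: "?u \<in> ?V" "?w \<in> ?V" using e by auto
      have ne: "L ?w \<noteq> L ?u" using 2(1) V nreach by blast
      define L' where "L' z = (if L z = L ?w then L ?u else L z)" for z
      have "L' ` ?V = L ` ?V - {L ?w}"
        using V ne by (auto simp: L'_def image_iff)
      then have "card (L' ` ?V) + 1 = card (L ` ?V)"
        using V card_Suc_Diff1[of "L ` ?V" "L ?w"] by simp
      then have card: "card (L' ` ?V) + card (insert e A) = card ?V"
        using 2(2) insert.hyps by simp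
      have AeA: "(x, y) \<in> (adj (insert e A))\<^sup>*" if "(x, y) \<in> (adj A)\<^sup>*" for x y
        using mono[of A "insert e A"] that by blast
      have "(?u, ?w) \<in> adj (insert e A)" "(?w, ?u) \<in> adj (insert e A)"
        unfolding adj_def
        by (auto intro!: exI[of _ "(e, True)"] exI[of _ "(e, False)"] simp: src_def dst_def)
      then have uw: "(?u, ?w) \<in> (adj (insert e A))\<^sup>*" "(?w, ?u) \<in> (adj (insert e A))\<^sup>*" by auto
      have "(x, y) \<in> (adj (insert e A))\<^sup>*" if xy: "x \<in> ?V" "y \<in> ?V" "L' x = L' y" for x y
      proof -
        consider "L x = L y" | "L x = L ?w" "L y = L ?u" | "L x = L ?u" "L y = L ?w"
          using xy(3) by (auto simp: L'_def split: if_splits)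
        then show ?thesis
        proof cases
          case 1
          then show ?thesis using 2(1) xy AeA by blast
        next
          case c: 2
          then have "(x, ?w) \<in> (adj (insert e A))\<^sup>*" "(?u, y) \<in> (adj (insert e A))\<^sup>*"
            using 2(1) xy V AeA by metis+
          then show ?thesis using uw(2) by (meson rtrancl_trans)
        next
          case c: 3
          then have "(x, ?u) \<in> (adj (insert e A))\<^sup>*" "(?w, y) \<in> (adj (insert e A))\<^sup>*"
            using 2(1) xy V AeA by metis+
          then show ?thesis using uw(1) by (meson rtrancl_trans)
        qed
      qed
      then show ?thesis using card by blast
    qed
  qed
qed

text \<open>Positive genus means at least as many edges as vertices. A labelling would then have no
  labels, although there is a vertex; so some edge closes a cycle.\<close>

lemma genus_cycle:
  assumes "genus \<Gamma> \<ge> 1"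
  obtains e p where "trail (tl_e e) ((e, True) # p) (tl_e e)"
proof -
  let ?V = "verts (model \<Gamma>)"
  have "strongly_connected (with_proj (mk_symmetric (model \<Gamma>)))"
    using tropical by (simp add: tropical_curve_def Digraph_Component.connected_def)
  then have Vne: "?V \<noteq> {}" by (simp add: strongly_connected_def mk_symmetric_def)
  have "card ?V \<le> card (edges \<Gamma>)" using assms by (simp add: genus_def)
  moreover have "0 < card (L ` ?V)" for L :: "'v \<Rightarrow> 'v" using Vne by (simp add: card_gt_0_iff)
  ultimately have "card (L ` ?V) + card (edges \<Gamma>) \<noteq> card ?V" for L :: "'v \<Rightarrow> 'v"
    by (metis add_le_same_cancel2 linorder_not_le)
  then obtain e where e: "e \<in> edges \<Gamma>" "(hd_e e, tl_e e) \<in> (adj (edges \<Gamma> - {e}))\<^sup>*"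
    using cycle_or_labelling[of "edges \<Gamma>"] by auto
  then obtain p where p: "trail (hd_e e) p (tl_e e)" "fst ` set p \<subseteq> edges \<Gamma> - {e}"
    using rtrancl_adj_trail[OF e(2)] by auto
  have "trail (tl_e e) ((e, True) # p) (tl_e e)"
    using p e(1) by (auto simp: src_def dst_def)
  then show thesis by (rule that)
qed

end

context equi_reduced
begin

text \<open>Induction from the end of the trail: \<open>along_edge\<close> carries the base point
  back over the first edge, with the support of the remaining trail as \<open>Z\<close>.\<close>

lemma rest_trail:
  assumes "trail x p y" "z \<in> support x p"
  shows "rest (Vertex x) z = 0"
  using assms
proof (induction p arbitrary: x z)
  case Nil
  then show ?case by (simp add: support_def)
next
  case (Cons eb p)
  then have e: "fst eb \<in> edges \<Gamma>" and x: "src eb = x" and tr: "trail (dst eb) p y"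
    and nin: "fst eb \<notin> fst ` set p" by auto
  obtain f b where eb: "eb = (f, b)" by (cases eb) auto
  define t0 where "t0 = (if b then 0 else ell f)"
  define \<sigma> where "\<sigma> = (if b then 1 else -1 :: real)"
  have f: "f \<in> edges \<Gamma>" using e eb by simp
  have d: "(f, t0, \<sigma>) \<in> directions \<Gamma>"
    using f len_pos[OF f] by (auto simp: directions_def t0_def \<sigma>_def)
  have full: "t0 + \<sigma> * ell f \<in> {0, ell f}" by (auto simp: t0_def \<sigma>_def)
  have start: "along \<Gamma> (f, t0, \<sigma>) 0 = Vertex (src eb)" and fin: "along \<Gamma> (f, t0, \<sigma>) (ell f) = Vertex (dst eb)"
    using f by (auto simp: eb src_def dst_def t0_def \<sigma>_def)
  have img: "along \<Gamma> (f, t0, \<sigma>) ` {0..ell f} = ep f ` {0..ell f}"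
  proof (cases b)
    case False
    have "(\<lambda>s. ell f - s) ` {0..ell f} = {0..ell f}" by simp
    then have "(\<lambda>s. ep f (ell f - s)) ` {0..ell f} = ep f ` {0..ell f}"
      by (metis image_image)
    then show ?thesis using False by (simp add: t0_def \<sigma>_def along_def)
  qed (simp add: t0_def \<sigma>_def along_def)
  have "support (dst eb) p \<inter> along \<Gamma> (f, t0, \<sigma>) ` {0<..<ell f} = {}"
  proof -
    have False if "s \<in> {0<..<ell f}" "along \<Gamma> (f, t0, \<sigma>) s \<in> support (dst eb) p" for s
    proof -
      have "along \<Gamma> (f, t0, \<sigma>) s = Inner f (t0 + \<sigma> * s)"
        using that(1) by (auto simp: t0_def \<sigma>_def)
      then show False using that(2) support_Inner nin eb by force
    qed
    then show ?thesis by blast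
  qed
  moreover have "z \<in> along \<Gamma> (f, t0, \<sigma>) ` {0..ell f} \<union> support (dst eb) p"
    using Cons.prems(2) unfolding x[symmetric] support_Cons[OF e] img by (simp add: eb)
  ultimately have "rest (along \<Gamma> (f, t0, \<sigma>) 0) z = 0"
    using along_edge[OF d full connectedin_support[OF tr]] Vertex_in_support[of "dst eb" p]
      Cons.IH[OF tr] unfolding fin by metis
  then show ?case unfolding start x .
qed

lemma no_cycle: "\<not> trail (tl_e e) ((e, True) # p) (tl_e e)"
proof
  assume tr: "trail (tl_e e) ((e, True) # p) (tl_e e)"
  let ?x = "Vertex (tl_e e)" and ?\<tau> = "(e, 0, 1::real)"
  have e: "e \<in> edges \<Gamma>" and nin: "e \<notin> fst ` set p" and p: "trail (hd_e e) p (tl_e e)"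
    using tr by (auto simp: dst_def)
  have xp: "?x \<in> points \<Gamma>" using e by (auto simp: points_def)
  have \<tau>: "?\<tau> \<in> tangents \<Gamma> ?x" using e len_pos[OF e] by (auto simp: tangents_def)
  obtain r where r: "r > 0" "\<forall>\<tau>\<in>tangents \<Gamma> ?x. \<forall>\<epsilon>. 0 < \<epsilon> \<and> \<epsilon> < r \<longrightarrow> (\<exists>g. moves ?x \<tau> \<epsilon> g)"
    using ex_moves[OF xp] by blast
  define \<epsilon> where "\<epsilon> = min r (ell e) / 2"
  have \<epsilon>: "0 < \<epsilon>" "\<epsilon> < r" "\<epsilon> < ell e" using r(1) len_pos[OF e] by (auto simp: \<epsilon>_def)
  then obtain g where mv: "moves ?x ?\<tau> \<epsilon> g" using r(2) \<tau> by blast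
  \<comment> \<open>The cycle without the open segment from its start to the point at distance
    \<open>\<epsilon>\<close>.\<close>
  define K where "K = ep e ` {\<epsilon>..ell e} \<union> support (hd_e e) p"
  have "connectedin CT (ep e ` {\<epsilon>..ell e})"
  proof (rule connectedin_continuous_map_image)
    show "continuous_map (top_of_set {\<epsilon>..ell e}) CT (ep e)"
      using continuous_map_from_subtopology_mono[OF continuous_map_ep[OF e], of "{\<epsilon>..ell e}"] \<epsilon> by simp
  qed (simp add: connectedin_subtopology)
  moreover have "ep e (ell e) \<in> ep e ` {\<epsilon>..ell e}" using \<epsilon> by (intro imageI) auto
  then have "Vertex (hd_e e) \<in> ep e ` {\<epsilon>..ell e}" using e by simp
  ultimately have "connectedin CT K"
    unfolding K_def using connectedin_support[OF p] Vertex_in_support[of "hd_e e" p]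
    by (intro connectedin_Un) auto
  moreover have "K \<inter> along \<Gamma> ?\<tau> ` {0<..<\<epsilon>} = {}"
  proof -
    have "along \<Gamma> ?\<tau> s \<notin> K" if s: "0 < s" "s < \<epsilon>" for s
    proof
      assume "along \<Gamma> ?\<tau> s \<in> K"
      moreover have eq: "along \<Gamma> ?\<tau> s = Inner e s" using s \<epsilon> by simp
      ultimately have "Inner e s \<in> ep e ` {\<epsilon>..ell e}"
        using support_Inner nin by (auto simp: K_def)
      then show False using s by (auto dest!: ep_eq_InnerD[OF sym])
    qed
    then show ?thesis by auto
  qed
  \<comment> \<open>Here the trail has to be closed: \<open>p\<close> returns to the start, so
    \<open>K\<close> contains it although the first segment was removed.\<close>
  moreover have "?x \<in> K" using trail_end_in_support[OF p] by (simp add: K_def)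
  moreover have "rest ?x z = 0" if "z \<in> K" for z
  proof (rule rest_trail[OF tr])
    have "support (tl_e e) ((e, True) # p) = ep e ` {0..ell e} \<union> support (hd_e e) p"
      using support_Cons[of "(e, True)" p] e by (simp add: src_def dst_def)
    then show "z \<in> support (tl_e e) ((e, True) # p)" using that \<epsilon>(1) by (auto simp: K_def)
  qed
  ultimately have "along \<Gamma> ?\<tau> \<epsilon> \<notin> K" by (rule sweep_from(1)[OF xp \<tau> mv])
  moreover have "ep e \<epsilon> \<in> ep e ` {\<epsilon>..ell e}" by (rule imageI) (use \<epsilon> in simp)
  then have "along \<Gamma> ?\<tau> \<epsilon> \<in> K" by (simp add: K_def del: ep_inner)
  ultimately show False by simp
qed

end

section \<open>The theorem\<close>

context tropical
begin

lemma lin_equiv_sym: "lin_equiv \<Gamma> D D' \<Longrightarrow> lin_equiv \<Gamma> D' D"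
  unfolding lin_equiv_iff using integral_germs_uminus ord_at_uminus by fastforce

lemma lin_equiv_trans:
  assumes "lin_equiv \<Gamma> D D'" "lin_equiv \<Gamma> D' D''"
  shows "lin_equiv \<Gamma> D D''"
proof -
  obtain f g where "integral_germs \<Gamma> f" "\<forall>x\<in>points \<Gamma>. D x = D' x + ord_at \<Gamma> f x"
    "\<forall>x. x \<notin> points \<Gamma> \<longrightarrow> D x = D' x" "integral_germs \<Gamma> g" "\<forall>x\<in>points \<Gamma>. D' x = D'' x + ord_at \<Gamma> g x"
    "\<forall>x. x \<notin> points \<Gamma> \<longrightarrow> D' x = D'' x"
    using assms unfolding lin_equiv_iff by blast
  then show ?thesis
    unfolding lin_equiv_iff by (intro exI[of _ "\<lambda>x. f x + g x"]) (auto simp: integral_germs_add ord_at_add)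
qed

text \<open>If \<open>linear_system \<Gamma> D\<close> were empty, the zero divisor would be a
  witness of degree 0. Degrees of effective divisors are nonnegative, so the least value would be 0
  and the rank -1.\<close>

lemma rank_linear_system:
  assumes "0 \<le> div_rank \<Gamma> D"
  obtains E where "divisor \<Gamma> E" "effective E" "lin_equiv \<Gamma> E D"
proof -
  define S where "S d \<longleftrightarrow> (\<exists>E. divisor \<Gamma> E \<and> effective E \<and> linear_system \<Gamma> (D - E) = {} \<and> d = div_degree E)" for d
  have S0: "0 \<le> d" if "S d" for d
    using that by (auto simp: S_def effective_def div_degree_def intro!: sum_nonneg)
  have "linear_system \<Gamma> D \<noteq> {}"
  proof
    assume "linear_system \<Gamma> D = {}"
    moreover have "D - (\<lambda>_. 0) = D" by (simp add: fun_eq_iff)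
    ultimately have S: "S 0"
      unfolding S_def by (intro exI[of _ "\<lambda>_. 0"]) (auto simp: divisor_def effective_def div_degree_def)
    have "(LEAST d. S d) = 0" by (rule Least_equality) (use S S0 in auto)
    then show False using assms by (simp add: div_rank_def S_def)
  qed
  then show thesis using that by (auto simp: linear_system_def)
qed

text \<open>Existence is obtained for the effective representative \<open>E\<close> and transferred
  to \<open>D\<close>; with uniqueness the definite description in \<open>reduced_divisor\<close> is
  well defined.\<close>

lemma reduced_divisor_props:
  assumes "divisor \<Gamma> E" "effective E" "lin_equiv \<Gamma> E D" "P \<in> points \<Gamma>"
  shows "is_reduced \<Gamma> P (reduced_divisor \<Gamma> D P)" "lin_equiv \<Gamma> (reduced_divisor \<Gamma> D P) D"
proof -
  have "\<exists>D'. is_reduced \<Gamma> P D' \<and> lin_equiv \<Gamma> D' D"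
    using reduced_exists[OF assms(1,2,4)] lin_equiv_trans[OF _ assms(3)] by blast
  moreover have "D1 = D2" if "is_reduced \<Gamma> P D1 \<and> lin_equiv \<Gamma> D1 D" "is_reduced \<Gamma> P D2 \<and> lin_equiv \<Gamma> D2 D" for D1 D2
    using reduced_unique[OF assms(4)] that by blast
  ultimately have "\<exists>!D'. is_reduced \<Gamma> P D' \<and> lin_equiv \<Gamma> D' D" by blast
  from theI'[OF this] show "is_reduced \<Gamma> P (reduced_divisor \<Gamma> D P)" "lin_equiv \<Gamma> (reduced_divisor \<Gamma> D P) D"
    unfolding reduced_divisor_def by auto
qed

end

theorem theorem14:
  fixes \<Gamma> :: "('v, 'e) metric_graph" and D :: "('v, 'e) point \<Rightarrow> int" and a :: int
  assumes "tropical_curve \<Gamma>"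
    and "genus \<Gamma> \<ge> 1"
    and "divisor \<Gamma> D"
    and "div_rank \<Gamma> D \<ge> 1"
    and "a \<ge> 1"
    and "\<forall>P\<in>points \<Gamma>. reduced_divisor \<Gamma> D P P \<ge> a"
  shows "\<exists>P\<in>points \<Gamma>. reduced_divisor \<Gamma> D P P \<ge> a + 1"
proof (rule ccontr)
  assume neg: "\<not> ?thesis"
  interpret tropical \<Gamma> by unfold_locales (rule assms(1))
  have "0 \<le> div_rank \<Gamma> D" using assms(4) by simp
  then obtain E where E: "divisor \<Gamma> E" "effective E" "lin_equiv \<Gamma> E D"
    by (rule rank_linear_system)
  note red = reduced_divisor_props[OF E]
  interpret equi_reduced \<Gamma> a "reduced_divisor \<Gamma> D"
  proof
    show "1 \<le> a" by (rule assms(5))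
    \<comment> \<open>The negated conclusion gives at most \<open>a\<close> and the hypothesis at
      least \<open>a\<close>, since the coefficients are integers.\<close>
    show "reduced_divisor \<Gamma> D P P = a" if "P \<in> points \<Gamma>" for P
      using neg assms(6) that by force
    show "is_reduced \<Gamma> P (reduced_divisor \<Gamma> D P)" if "P \<in> points \<Gamma>" for P
      by (rule red(1)[OF that])
    show "lin_equiv \<Gamma> (reduced_divisor \<Gamma> D Q) (reduced_divisor \<Gamma> D P)"
      if "P \<in> points \<Gamma>" "Q \<in> points \<Gamma>" for P Q
      by (rule lin_equiv_trans[OF red(2)[OF that(2)] lin_equiv_sym[OF red(2)[OF that(1)]]])
  qed
  show False using genus_cycle[OF assms(2)] no_cycle by blast
qed

end
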